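(* Let $p$ be an odd prime, let $J$ be the graded ring defined in the context, and put $\widehat{J}=\mathbb{Z}_p\otimes J$ (tensor product over $\mathbb{Z}_{(p)}$). Then $\widehat{J}$ is Pontrjagin self-dual and therefore self-injective. It is also totally incoherent, and the reduced quotient is $\widehat{J}/\sqrt{0}=\mathbb{Z}_p$.
   Context: Rings are $\mathbb{Z}$-graded, unital and commutative in the graded sense: $ba=(-1)^{|a||b|}ab$; modules are graded; ``element'' and ``ideal'' mean homogeneous element and homogeneous ideal. $\mathbb{Z}_p$ is the ring of $p$-adic integers, $\mathbb{Z}_{(p)}$ is the localisation of $\mathbb{Z}$ at $p$, and $\mathbb{Q}/\mathbb{Z}_{(p)}\simeq\mathbb{Q}_p/\mathbb{Z}_p$. Definition of $J$: put $J_0=\mathbb{Z}_{(p)}$ and $J_{-2}=\mathbb{Q}_p/\mathbb{Z}_p$; write $\eta\colon\mathbb{Z}_{(p)}\to J_0$ and $\zeta\colon J_{-2}\to\mathbb{Q}_p/\mathbb{Z}_p$ for the identity maps. For each nonzero integer $k$ there is a generator $\alpha_k\in J_{2(p-1)k-1}$ generating a cyclic group of order $p^{v_p(k)+1}$, where $v_p(k)$ is the $p$-adic valuation of $k$ (so $J_{2(p-1)k-1}\simeq\mathbb{Z}/p^{v_p(k)+1}$). All other groups $J_n$ are zero. The product is given by: $\eta(a)\eta(b)=\eta(ab)$, $\eta(a)\zeta^{-1}(b)=\zeta^{-1}(ab)$, $\eta(a)\alpha_k=a\,\alpha_k$; $\zeta^{-1}(a)\zeta^{-1}(b)=0$ and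 $\zeta^{-1}(a)\alpha_k=0$ for all $k$; if $k>0$ then $\alpha_k\alpha_{-k}=-\alpha_{-k}\alpha_k=\zeta^{-1}(p^{-1-v_p(k)}+\mathbb{Z}_{(p)})$; and $\alpha_j\alpha_k=0$ whenever $j+k\neq 0$. Tensoring with $\mathbb{Z}_p$ only replaces $\mathbb{Z}_{(p)}$ in degree zero by $\mathbb{Z}_p$; in particular $\zeta$ gives an isomorphism $\widehat J_{-2}\to\mathbb{Q}_p/\mathbb{Z}_p$. For a $\mathbb{Z}_p$-module $M$ put $M^\vee=\operatorname{Hom}_{\mathbb{Z}_p}(M,\mathbb{Q}_p/\mathbb{Z}_p)$. A graded $\mathbb{Z}_p$-algebra $R$ with a specified isomorphism $\zeta\colon R_d\to\mathbb{Q}_p/\mathbb{Z}_p$ for some $d$ (here $d=-2$) is Pontrjagin self-dual if for all $k$ the map $\zeta^\#\colon R_{d-k}\to R_k^\vee$, $\zeta^\#(a)(b)=\zeta(ab)$, is an isomorphism. A graded ring $R$ is self-injective if $R$ is an injective object in the category of graded $R$-modules. A module $M$ is finitely presented if there is an exact sequence $P_1\to P_0\to M\to 0$ with $P_0,P_1$ finitely generated free, i.e. of the form $\bigoplus_{i=1}^r\Sigma^{d_i}R$. $R$ is totally incoherent if the only finitely presented ideals are $0$ and $R$. $\sqrt{0}$ is the ideal of nilpotent elements. *)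

theory Defs
  imports
    "HOL-Algebra.Module"
    "HOL-Algebra.AbelCoset"
    "HOL-Algebra.Generated_Groups"
    "HOL-Algebra.Free_Abelian_Groups"
    "HOL-Algebra.Product_Groups"
    "HOL-Computational_Algebra.Primes"
begin

section \<open>Graded rings and graded modules\<close>

text \<open>
  A graded object is the family of its homogeneous components, indexed by the degree; every
  element, ideal and homomorphism below is homogeneous. As in \<^const>\<open>free_Abelian_group\<close>, the
  additive groups of the components are monoid records in multiplicative notation: for
  elements of degree \<open>n\<close>, the sum is \<open>x \<otimes>\<^bsub>ggrp R n\<^esub> y\<close> and zero is \<open>\<one>\<^bsub>ggrp R n\<^esub>\<close>. The product
  \<open>gmult R m n x y\<close> of \<open>x\<close> of degree \<open>m\<close> and \<open>y\<close> of degree \<open>n\<close> has degree \<open>m + n\<close>.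
\<close>

record 'a gring =
  ggrp :: "int \<Rightarrow> 'a monoid"
  gmult :: "int \<Rightarrow> int \<Rightarrow> 'a \<Rightarrow> 'a \<Rightarrow> 'a"
  gone :: 'a

abbreviation gcar :: "'a gring \<Rightarrow> int \<Rightarrow> 'a set"
  where "gcar R n \<equiv> carrier (ggrp R n)"

locale graded_comm_ring =
  fixes R :: "'a gring"
  assumes comm_group: "comm_group (ggrp R n)"
    and mult_closed: "\<lbrakk>x \<in> gcar R m; y \<in> gcar R n\<rbrakk> \<Longrightarrow> gmult R m n x y \<in> gcar R (m + n)"
    and one_closed: "gone R \<in> gcar R 0"
    and l_distr: "\<lbrakk>x \<in> gcar R m; x' \<in> gcar R m; y \<in> gcar R n\<rbrakk> \<Longrightarrow>
      gmult R m n (x \<otimes>\<^bsub>ggrp R m\<^esub> x') y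
        = gmult R m n x y \<otimes>\<^bsub>ggrp R (m + n)\<^esub> gmult R m n x' y"
    and r_distr: "\<lbrakk>x \<in> gcar R m; y \<in> gcar R n; y' \<in> gcar R n\<rbrakk> \<Longrightarrow>
      gmult R m n x (y \<otimes>\<^bsub>ggrp R n\<^esub> y')
        = gmult R m n x y \<otimes>\<^bsub>ggrp R (m + n)\<^esub> gmult R m n x y'"
    and assoc: "\<lbrakk>x \<in> gcar R l; y \<in> gcar R m; z \<in> gcar R n\<rbrakk> \<Longrightarrow>
      gmult R (l + m) n (gmult R l m x y) z = gmult R l (m + n) x (gmult R m n y z)"
    and l_one: "x \<in> gcar R n \<Longrightarrow> gmult R 0 n (gone R) x = x"
    and r_one: "x \<in> gcar R n \<Longrightarrow> gmult R n 0 x (gone R) = x"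
    and graded_comm: "\<lbrakk>x \<in> gcar R m; y \<in> gcar R n\<rbrakk> \<Longrightarrow>
      gmult R n m y x =
        (if even (m * n) then gmult R m n x y else inv\<^bsub>ggrp R (m + n)\<^esub> gmult R m n x y)"

definition gring_iso :: "'a gring \<Rightarrow> 'b gring \<Rightarrow> (int \<Rightarrow> 'a \<Rightarrow> 'b) set"
  where "gring_iso R S = {h.
    (\<forall>n. h n \<in> iso (ggrp R n) (ggrp S n)) \<and>
    (\<forall>m n. \<forall>x\<in>gcar R m. \<forall>y\<in>gcar R n.
       h (m + n) (gmult R m n x y) = gmult S m n (h m x) (h n y)) \<and>
    h 0 (gone R) = gone S}"

definition concentrated :: "'a ring \<Rightarrow> 'a gring"
  where "concentrated A =
    \<lparr>ggrp = (\<lambda>n. if n = 0 then add_monoid A else (add_monoid A)\<lparr>carrier := {\<zero>\<^bsub>A\<^esub>}\<rparr>),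
     gmult = (\<lambda>m n. (\<otimes>\<^bsub>A\<^esub>)),
     gone = \<one>\<^bsub>A\<^esub>\<rparr>"

text \<open>
  A graded \<open>A\<close>-algebra over an ungraded commutative ring \<open>A\<close>, with structure map
  \<open>u\<close> from \<open>A\<close> to the degree \<open>0\<close> component.
\<close>

locale graded_algebra = A: cring A + R: graded_comm_ring R
  for A :: "'b ring" and R :: "'a gring" +
  fixes u :: "'b \<Rightarrow> 'a"
  assumes unit_hom: "u \<in> hom (add_monoid A) (ggrp R 0)"
    and unit_mult: "\<lbrakk>a \<in> carrier A; b \<in> carrier A\<rbrakk> \<Longrightarrow> u (a \<otimes>\<^bsub>A\<^esub> b) = gmult R 0 0 (u a) (u b)"
    and unit_one: "u \<one>\<^bsub>A\<^esub> = gone R"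

record ('a, 'm) gmod =
  mgrp :: "int \<Rightarrow> 'm monoid"
  gsmult :: "int \<Rightarrow> int \<Rightarrow> 'a \<Rightarrow> 'm \<Rightarrow> 'm"

abbreviation mcar :: "('a, 'm) gmod \<Rightarrow> int \<Rightarrow> 'm set"
  where "mcar M n \<equiv> carrier (mgrp M n)"

locale graded_module = graded_comm_ring R
  for R :: "'a gring" and M :: "('a, 'm) gmod" +
  assumes mod_comm_group: "comm_group (mgrp M n)"
    and smult_closed: "\<lbrakk>a \<in> gcar R m; x \<in> mcar M n\<rbrakk> \<Longrightarrow> gsmult M m n a x \<in> mcar M (m + n)"
    and smult_l_distr: "\<lbrakk>a \<in> gcar R m; b \<in> gcar R m; x \<in> mcar M n\<rbrakk> \<Longrightarrow>
      gsmult M m n (a \<otimes>\<^bsub>ggrp R m\<^esub> b) x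
        = gsmult M m n a x \<otimes>\<^bsub>mgrp M (m + n)\<^esub> gsmult M m n b x"
    and smult_r_distr: "\<lbrakk>a \<in> gcar R m; x \<in> mcar M n; y \<in> mcar M n\<rbrakk> \<Longrightarrow>
      gsmult M m n a (x \<otimes>\<^bsub>mgrp M n\<^esub> y)
        = gsmult M m n a x \<otimes>\<^bsub>mgrp M (m + n)\<^esub> gsmult M m n a y"
    and smult_assoc: "\<lbrakk>a \<in> gcar R l; b \<in> gcar R m; x \<in> mcar M n\<rbrakk> \<Longrightarrow>
      gsmult M (l + m) n (gmult R l m a b) x = gsmult M l (m + n) a (gsmult M m n b x)"
    and smult_one: "x \<in> mcar M n \<Longrightarrow> gsmult M 0 n (gone R) x = x"

definition gmod_hom ::
    "'a gring \<Rightarrow> ('a, 'm) gmod \<Rightarrow> ('a, 'n) gmod \<Rightarrow> (int \<Rightarrow> 'm \<Rightarrow> 'n) set"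
  where "gmod_hom R M N = {f.
    (\<forall>n. f n \<in> hom (mgrp M n) (mgrp N n)) \<and>
    (\<forall>m n. \<forall>a\<in>gcar R m. \<forall>x\<in>mcar M n. f (m + n) (gsmult M m n a x) = gsmult N m n a (f n x))}"

definition regular_gmod :: "'a gring \<Rightarrow> ('a, 'a) gmod"
  where "regular_gmod R = \<lparr>mgrp = ggrp R, gsmult = gmult R\<rparr>"

text \<open>
  Injective objects: homomorphisms into \<open>Q\<close> extend along all monomorphisms. HOL cannot
  quantify over types inside a formula, so the element types \<open>'m\<close> and \<open>'n\<close> of the source and the
  target of the monomorphism are parameters; a theorem that leaves them free holds for all of them.
\<close>

definition injective_gmod ::
    "'m itself \<Rightarrow> 'n itself \<Rightarrow> 'a gring \<Rightarrow> ('a, 'q) gmod \<Rightarrow> bool"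
  where "injective_gmod _ _ R Q \<longleftrightarrow> graded_module R Q \<and>
    (\<forall>(M :: ('a, 'm) gmod) (N :: ('a, 'n) gmod) i f.
      graded_module R M \<longrightarrow> graded_module R N \<longrightarrow>
      i \<in> gmod_hom R M N \<longrightarrow> (\<forall>n. inj_on (i n) (mcar M n)) \<longrightarrow>
      f \<in> gmod_hom R M Q \<longrightarrow>
      (\<exists>g \<in> gmod_hom R N Q. \<forall>n. \<forall>x\<in>mcar M n. g n (i n x) = f n x))"

definition self_injective :: "'m itself \<Rightarrow> 'n itself \<Rightarrow> 'a gring \<Rightarrow> bool"
  where "self_injective tm tn R \<longleftrightarrow> injective_gmod tm tn R (regular_gmod R)"

text \<open>
  The free module \<open>\<Oplus>i<r. \<Sigma>\<^bsup>d i\<^esup> R\<close>, where the degree \<open>n\<close> component of \<open>\<Sigma>\<^bsup>d\<^esup> R\<close> is the degree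
  \<open>n - d\<close> component of \<open>R\<close>. The action carries no sign: up to the isomorphism that multiplies
  the elements of degree \<open>k\<close> of the \<open>i\<close>-th copy of \<open>R\<close> by \<open>(-1) ^ (k * d i)\<close>, this is the
  same module as the one with the signs of the Koszul rule.
\<close>

definition free_gmod :: "'a gring \<Rightarrow> nat \<Rightarrow> (nat \<Rightarrow> int) \<Rightarrow> ('a, nat \<Rightarrow> 'a) gmod"
  where "free_gmod R r d =
    \<lparr>mgrp = (\<lambda>n. product_group {..<r} (\<lambda>i. ggrp R (n - d i))),
     gsmult = (\<lambda>m n a x. \<lambda>i\<in>{..<r}. gmult R m (n - d i) a (x i))\<rparr>"

definition finitely_presented :: "'a gring \<Rightarrow> ('a, 'm) gmod \<Rightarrow> bool"
  where "finitely_presented R M \<longleftrightarrow>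
    (\<exists>r d s e. \<exists>f \<in> gmod_hom R (free_gmod R s e) (free_gmod R r d).
      \<exists>g \<in> gmod_hom R (free_gmod R r d) M. \<forall>n.
        f n ` mcar (free_gmod R s e) n = kernel (mgrp (free_gmod R r d) n) (mgrp M n) (g n) \<and>
        g n ` mcar (free_gmod R r d) n = mcar M n)"

definition gideal :: "'a gring \<Rightarrow> (int \<Rightarrow> 'a set) \<Rightarrow> bool"
  where "gideal R I \<longleftrightarrow>
    (\<forall>n. subgroup (I n) (ggrp R n)) \<and>
    (\<forall>m n. \<forall>a\<in>gcar R m. \<forall>x\<in>I n. gmult R m n a x \<in> I (m + n) \<and> gmult R n m x a \<in> I (n + m))"

definition ideal_gmod :: "'a gring \<Rightarrow> (int \<Rightarrow> 'a set) \<Rightarrow> ('a, 'a) gmod"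
  where "ideal_gmod R I = \<lparr>mgrp = (\<lambda>n. (ggrp R n)\<lparr>carrier := I n\<rparr>), gsmult = gmult R\<rparr>"

definition totally_incoherent :: "'a gring \<Rightarrow> bool"
  where "totally_incoherent R \<longleftrightarrow>
    (\<forall>I. gideal R I \<longrightarrow>
      (finitely_presented R (ideal_gmod R I) \<longleftrightarrow> I = (\<lambda>n. {\<one>\<^bsub>ggrp R n\<^esub>}) \<or> I = gcar R))"

primrec gpow :: "'a gring \<Rightarrow> int \<Rightarrow> 'a \<Rightarrow> nat \<Rightarrow> 'a"
  where
    "gpow R n x 0 = gone R"
  | "gpow R n x (Suc k) = gmult R (int k * n) n (gpow R n x k) x"

definition nilradical :: "'a gring \<Rightarrow> int \<Rightarrow> 'a set"
  where "nilradical R n = {x \<in> gcar R n. \<exists>k. gpow R n x k = \<one>\<^bsub>ggrp R (int k * n)\<^esub>}"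

definition gquot :: "'a gring \<Rightarrow> (int \<Rightarrow> 'a set) \<Rightarrow> 'a set gring"
  where "gquot R I =
    \<lparr>ggrp = (\<lambda>n. ggrp R n Mod I n),
     gmult = (\<lambda>m n X Y. \<Union>x\<in>X. \<Union>y\<in>Y.
       I (m + n) #>\<^bsub>ggrp R (m + n)\<^esub> gmult R m n x y),
     gone = I 0 #>\<^bsub>ggrp R 0\<^esub> gone R\<rparr>"


section \<open>Base change\<close>

text \<open>
  Let \<open>R\<close> be a graded \<open>A\<close>-algebra with structure map \<open>u\<close>, and \<open>i\<close> a ring homomorphism from \<open>A\<close>
  to \<open>B\<close>. The degree \<open>n\<close> component of \<open>B \<otimes>\<^sub>A R\<close> is the free abelian group on the pairs \<open>(b, x)\<close>
  modulo the relations that make \<open>(b, x)\<close> biadditive and \<open>A\<close>-balanced.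
\<close>

definition tensor_free :: "'b ring \<Rightarrow> 'a gring \<Rightarrow> int \<Rightarrow> ('b \<times> 'a \<Rightarrow>\<^sub>0 int) monoid"
  where "tensor_free B R n = free_Abelian_group (carrier B \<times> gcar R n)"

definition tensor_rel ::
    "'c ring \<Rightarrow> 'b ring \<Rightarrow> ('c \<Rightarrow> 'b) \<Rightarrow> 'a gring \<Rightarrow> ('c \<Rightarrow> 'a) \<Rightarrow> int \<Rightarrow> ('b \<times> 'a \<Rightarrow>\<^sub>0 int) set"
  where "tensor_rel A B i R u n = generate (tensor_free B R n)
    ({frag_of (b \<oplus>\<^bsub>B\<^esub> b', x) - frag_of (b, x) - frag_of (b', x) | b b' x.
        b \<in> carrier B \<and> b' \<in> carrier B \<and> x \<in> gcar R n} \<union>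
     {frag_of (b, x \<otimes>\<^bsub>ggrp R n\<^esub> x') - frag_of (b, x) - frag_of (b, x') | b x x'.
        b \<in> carrier B \<and> x \<in> gcar R n \<and> x' \<in> gcar R n} \<union>
     {frag_of (b \<otimes>\<^bsub>B\<^esub> i a, x) - frag_of (b, gmult R 0 n (u a) x) | a b x.
        a \<in> carrier A \<and> b \<in> carrier B \<and> x \<in> gcar R n})"

definition pure_tensor ::
    "'c ring \<Rightarrow> 'b ring \<Rightarrow> ('c \<Rightarrow> 'b) \<Rightarrow> 'a gring \<Rightarrow> ('c \<Rightarrow> 'a) \<Rightarrow> int \<Rightarrow> 'b \<Rightarrow> 'a
      \<Rightarrow> ('b \<times> 'a \<Rightarrow>\<^sub>0 int) set"
  where "pure_tensor A B i R u n b x = tensor_rel A B i R u n #>\<^bsub>tensor_free B R n\<^esub> frag_of (b, x)"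

text \<open>
  The biadditive extension of \<open>(b, x) (c, y) = (b c, x y)\<close>. Since \<open>B\<close> sits in degree \<open>0\<close>,
  interchanging \<open>x\<close> and \<open>c\<close> produces no sign.
\<close>

definition tensor_frag_mult ::
    "'b ring \<Rightarrow> 'a gring \<Rightarrow> int \<Rightarrow> int \<Rightarrow> ('b \<times> 'a \<Rightarrow>\<^sub>0 int) \<Rightarrow> ('b \<times> 'a \<Rightarrow>\<^sub>0 int) \<Rightarrow> ('b \<times> 'a \<Rightarrow>\<^sub>0 int)"
  where "tensor_frag_mult B R m n f g =
    frag_extend (\<lambda>(b, x). frag_extend (\<lambda>(c, y). frag_of (b \<otimes>\<^bsub>B\<^esub> c, gmult R m n x y)) g) f"

definition base_change ::
    "'c ring \<Rightarrow> 'b ring \<Rightarrow> ('c \<Rightarrow> 'b) \<Rightarrow> 'a gring \<Rightarrow> ('c \<Rightarrow> 'a) \<Rightarrow> ('b \<times> 'a \<Rightarrow>\<^sub>0 int) set gring"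
  where "base_change A B i R u =
    \<lparr>ggrp = (\<lambda>n. tensor_free B R n Mod tensor_rel A B i R u n),
     gmult = (\<lambda>m n X Y. \<Union>f\<in>X. \<Union>g\<in>Y.
       tensor_rel A B i R u (m + n) #>\<^bsub>tensor_free B R (m + n)\<^esub> tensor_frag_mult B R m n f g),
     gone = pure_tensor A B i R u 0 \<one>\<^bsub>B\<^esub> (gone R)\<rparr>"


section \<open>The local ring at \<open>p\<close>, the \<open>p\<close>-adic integers and the dualising module\<close>

definition rat_ring :: "rat ring"
  where "rat_ring = \<lparr>carrier = UNIV, monoid.mult = (*), one = 1, ring.zero = 0, ring.add = (+)\<rparr>"

definition Zloc :: "nat \<Rightarrow> rat ring"
  where "Zloc p = rat_ring\<lparr>carrier := {of_int a / of_int b | a b. \<not> int p dvd b}\<rparr>"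

text \<open>The inverse limit of the rings \<open>\<int>/p\<^sup>n\<close>, with residues represented in \<open>{0..<p\<^sup>n}\<close>.\<close>

definition Zp :: "nat \<Rightarrow> (nat \<Rightarrow> int) ring"
  where "Zp p =
    \<lparr>carrier = {a. \<forall>n. a n \<in> {0..<int p ^ n} \<and> a (Suc n) mod int p ^ n = a n},
     monoid.mult = (\<lambda>a b n. (a n * b n) mod int p ^ n),
     one = (\<lambda>n. 1 mod int p ^ n),
     ring.zero = (\<lambda>n. 0),
     ring.add = (\<lambda>a b n. (a n + b n) mod int p ^ n)\<rparr>"

text \<open>The canonical homomorphism from \<^term>\<open>Zloc p\<close> to \<^term>\<open>Zp p\<close>.\<close>

definition Zloc_to_Zp :: "nat \<Rightarrow> rat \<Rightarrow> nat \<Rightarrow> int"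
  where "Zloc_to_Zp p x =
    (\<lambda>n. THE r. r \<in> {0..<int p ^ n} \<and> (x - of_int r) / of_nat p ^ n \<in> carrier (Zloc p))"

text \<open>
  \<open>\<rat>\<^sub>p/\<int>\<^sub>p\<close>, realised as \<open>\<rat>/\<int>\<^bsub>(p)\<^esub>\<close>. A \<open>p\<close>-adic integer \<open>a\<close> acts on a class that is killed by
  \<open>p\<^sup>m\<close> through its residue \<open>a m\<close> modulo \<open>p\<^sup>m\<close>. The ring multiplication and unit of a
  \<^typ>\<open>('a, 'b) module\<close> record play no role here and below.
\<close>

definition QpZp :: "nat \<Rightarrow> (nat \<Rightarrow> int, rat set) module"
  where "QpZp p =
    \<lparr>carrier = a_rcosets\<^bsub>rat_ring\<^esub> carrier (Zloc p),
     monoid.mult = undefined,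
     one = undefined,
     ring.zero = carrier (Zloc p),
     ring.add = (<+>\<^bsub>rat_ring\<^esub>),
     smult = (\<lambda>a X. \<Union>x\<in>X. \<Union>m\<in>{m. of_nat p ^ m * x \<in> carrier (Zloc p)}.
       carrier (Zloc p) +>\<^bsub>rat_ring\<^esub> (of_int (a m) * x))\<rparr>"


section \<open>Pontrjagin self-duality\<close>

definition mod_iso ::
    "('c, 'e) ring_scheme \<Rightarrow> ('c, 'a) module \<Rightarrow> ('c, 'b) module \<Rightarrow> ('a \<Rightarrow> 'b) set"
  where "mod_iso A M N = {f \<in> iso (add_monoid M) (add_monoid N).
    \<forall>a\<in>carrier A. \<forall>x\<in>carrier M. f (a \<odot>\<^bsub>M\<^esub> x) = a \<odot>\<^bsub>N\<^esub> f x}"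

definition component :: "'a gring \<Rightarrow> ('c \<Rightarrow> 'a) \<Rightarrow> int \<Rightarrow> ('c, 'a) module"
  where "component R u n =
    \<lparr>carrier = gcar R n,
     monoid.mult = undefined,
     one = undefined,
     ring.zero = \<one>\<^bsub>ggrp R n\<^esub>,
     ring.add = (\<otimes>\<^bsub>ggrp R n\<^esub>),
     smult = (\<lambda>a x. gmult R 0 n (u a) x)\<rparr>"

definition pontrjagin_dual ::
    "nat \<Rightarrow> (nat \<Rightarrow> int, 'a) module \<Rightarrow> (nat \<Rightarrow> int, 'a \<Rightarrow> rat set) module"
  where "pontrjagin_dual p M =
    \<lparr>carrier = {\<phi> \<in> extensional (carrier M). \<phi> \<in> hom (add_monoid M) (add_monoid (QpZp p)) \<and>
       (\<forall>a\<in>carrier (Zp p). \<forall>x\<in>carrier M. \<phi> (a \<odot>\<^bsub>M\<^esub> x) = a \<odot>\<^bsub>QpZp p\<^esub> \<phi> x)},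
     monoid.mult = undefined,
     one = undefined,
     ring.zero = (\<lambda>x\<in>carrier M. \<zero>\<^bsub>QpZp p\<^esub>),
     ring.add = (\<lambda>\<phi> \<psi>. \<lambda>x\<in>carrier M. \<phi> x \<oplus>\<^bsub>QpZp p\<^esub> \<psi> x),
     smult = (\<lambda>a \<phi>. \<lambda>x\<in>carrier M. a \<odot>\<^bsub>QpZp p\<^esub> \<phi> x)\<rparr>"

definition pontrjagin_self_dual ::
    "nat \<Rightarrow> 'a gring \<Rightarrow> ((nat \<Rightarrow> int) \<Rightarrow> 'a) \<Rightarrow> int \<Rightarrow> ('a \<Rightarrow> rat set) \<Rightarrow> bool"
  where "pontrjagin_self_dual p R u d \<zeta> \<longleftrightarrow>
    graded_algebra (Zp p) R u \<and>
    \<zeta> \<in> mod_iso (Zp p) (component R u d) (QpZp p) \<and>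
    (\<forall>k. (\<lambda>a. \<lambda>b\<in>gcar R k. \<zeta> (gmult R (d - k) k a b))
      \<in> mod_iso (Zp p) (component R u (d - k)) (pontrjagin_dual p (component R u k)))"


section \<open>The ring \<open>J\<close>\<close>

text \<open>
  \<open>Eta a\<close> is \<open>\<eta>(a)\<close>, \<open>Zeta_inv X\<close> is \<open>\<zeta>\<^sup>-\<^sup>1(X)\<close>, \<open>Alpha k c\<close> is \<open>c \<alpha>\<^sub>k\<close> with \<open>c\<close> reduced modulo
  the order of \<open>\<alpha>\<^sub>k\<close>, and \<open>Null\<close> is the element of the trivial components.
\<close>

datatype J_elt = Eta rat | Zeta_inv (zeta: "rat set") | Alpha int int | Null

definition alpha_deg :: "nat \<Rightarrow> int \<Rightarrow> int"
  where "alpha_deg p k = 2 * (int p - 1) * k - 1"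

definition alpha_exp :: "nat \<Rightarrow> int \<Rightarrow> nat"
  where "alpha_exp p k = multiplicity (int p) k + 1"

definition J_carrier :: "nat \<Rightarrow> int \<Rightarrow> J_elt set"
  where "J_carrier p n =
    (if n = 0 then Eta ` carrier (Zloc p)
     else if n = -2 then Zeta_inv ` carrier (QpZp p)
     else if \<exists>k. k \<noteq> 0 \<and> n = alpha_deg p k then
       {Alpha k c | k c. k \<noteq> 0 \<and> n = alpha_deg p k \<and> c \<in> {0..<int p ^ alpha_exp p k}}
     else {Null})"

definition J_zero :: "nat \<Rightarrow> int \<Rightarrow> J_elt"
  where "J_zero p n =
    (if n = 0 then Eta 0
     else if n = -2 then Zeta_inv \<zero>\<^bsub>QpZp p\<^esub>
     else if \<exists>k. k \<noteq> 0 \<and> n = alpha_deg p k then Alpha (THE k. n = alpha_deg p k) 0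
     else Null)"

fun J_add :: "nat \<Rightarrow> J_elt \<Rightarrow> J_elt \<Rightarrow> J_elt"
  where
    "J_add p (Eta a) (Eta b) = Eta (a + b)"
  | "J_add p (Zeta_inv X) (Zeta_inv Y) = Zeta_inv (X \<oplus>\<^bsub>QpZp p\<^esub> Y)"
  | "J_add p (Alpha k c) (Alpha _ d) = Alpha k ((c + d) mod int p ^ alpha_exp p k)"
  | "J_add p _ _ = Null"

definition Zloc_act_QpZp :: "nat \<Rightarrow> rat \<Rightarrow> rat set \<Rightarrow> rat set"
  where "Zloc_act_QpZp p a X = (\<Union>x\<in>X. carrier (Zloc p) +>\<^bsub>rat_ring\<^esub> (a * x))"

definition Zloc_act_alpha :: "nat \<Rightarrow> int \<Rightarrow> rat \<Rightarrow> int \<Rightarrow> int"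
  where "Zloc_act_alpha p k a c =
    (Zloc_to_Zp p a (alpha_exp p k) * c) mod int p ^ alpha_exp p k"

text \<open>
  The factor \<open>sgn j\<close> encodes \<open>\<alpha>\<^sub>k \<alpha>\<^bsub>-k\<^esub> = - \<alpha>\<^bsub>-k\<^esub> \<alpha>\<^sub>k\<close>; note that \<open>j\<close> and \<open>-j\<close> have the same valuation.
\<close>

fun J_mult :: "nat \<Rightarrow> int \<Rightarrow> int \<Rightarrow> J_elt \<Rightarrow> J_elt \<Rightarrow> J_elt"
  where
    "J_mult p m n (Eta a) (Eta b) = Eta (a * b)"
  | "J_mult p m n (Eta a) (Zeta_inv X) = Zeta_inv (Zloc_act_QpZp p a X)"
  | "J_mult p m n (Zeta_inv X) (Eta a) = Zeta_inv (Zloc_act_QpZp p a X)"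
  | "J_mult p m n (Eta a) (Alpha k c) = Alpha k (Zloc_act_alpha p k a c)"
  | "J_mult p m n (Alpha k c) (Eta a) = Alpha k (Zloc_act_alpha p k a c)"
  | "J_mult p m n (Alpha j c) (Alpha k d) =
      (if j + k = 0
       then Zeta_inv (carrier (Zloc p) +>\<^bsub>rat_ring\<^esub> (of_int (sgn j * c * d) / of_nat p ^ alpha_exp p j))
       else J_zero p (m + n))"
  | "J_mult p m n _ _ = J_zero p (m + n)"

definition J :: "nat \<Rightarrow> J_elt gring"
  where "J p =
    \<lparr>ggrp = (\<lambda>n. \<lparr>carrier = J_carrier p n, monoid.mult = J_add p, one = J_zero p n\<rparr>),
     gmult = J_mult p,
     gone = Eta 1\<rparr>"

definition J_hat :: "nat \<Rightarrow> ((nat \<Rightarrow> int) \<times> J_elt \<Rightarrow>\<^sub>0 int) set gring"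
  where "J_hat p = base_change (Zloc p) (Zp p) (Zloc_to_Zp p) (J p) Eta"

definition J_hat_tensor :: "nat \<Rightarrow> int \<Rightarrow> (nat \<Rightarrow> int) \<Rightarrow> J_elt \<Rightarrow> ((nat \<Rightarrow> int) \<times> J_elt \<Rightarrow>\<^sub>0 int) set"
  where "J_hat_tensor p = pure_tensor (Zloc p) (Zp p) (Zloc_to_Zp p) (J p) Eta"

definition J_hat_unit :: "nat \<Rightarrow> (nat \<Rightarrow> int) \<Rightarrow> ((nat \<Rightarrow> int) \<times> J_elt \<Rightarrow>\<^sub>0 int) set"
  where "J_hat_unit p a = J_hat_tensor p 0 a (gone (J p))"

text \<open>
  The extension of \<open>\<zeta>\<close> to \<open>\<int>\<^sub>p \<otimes> J\<close> in degree \<open>-2\<close>, sending \<open>a \<otimes> x\<close> to \<open>a \<zeta>(x)\<close>; it is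
  evaluated on the representatives of a class.
\<close>

definition zeta_hat :: "nat \<Rightarrow> ((nat \<Rightarrow> int) \<times> J_elt \<Rightarrow>\<^sub>0 int) set \<Rightarrow> rat set"
  where "zeta_hat p X = the_elem
    ((\<lambda>f. \<Oplus>\<^bsub>QpZp p\<^esub>t\<in>Poly_Mapping.keys f.
        [Poly_Mapping.lookup f t] \<cdot>\<^bsub>QpZp p\<^esub> (fst t \<odot>\<^bsub>QpZp p\<^esub> zeta (snd t))) ` X)"

end

theory Submission
  imports Defs "HOL-Number_Theory.Cong"
begin

text \<open>
  The ring \<open>\<int>\<^sub>p \<otimes> J\<close> is as explicit as \<open>J\<close>. A \<open>p\<close>-adic integer acts on an element that is killed by
  \<open>p\<^sup>m\<close> through its residue modulo \<open>p\<^sup>m\<close>, so tensoring with \<open>\<int>\<^sub>p\<close> does not change the torsion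
  components \<open>J\<^sub>n\<close>, \<open>n \<noteq> 0\<close>: the map \<open>x \<mapsto> 1 \<otimes> x\<close> (\<open>jhat\<close>) is bijective there, and \<open>b \<mapsto> b \<otimes> 1\<close> is a
  bijection from \<open>\<int>\<^sub>p\<close> to the component of degree \<open>0\<close> (\<open>tau_eq_jhat\<close>, \<open>jhat_inj\<close>, \<open>unit_inj\<close>).
  
  \<^emph>\<open>Self-duality.\<close> Under these identifications the pairing of the components of degree \<open>-2 - k\<close> and
  \<open>k\<close> is the action of \<open>\<int>\<^sub>p\<close> on \<open>\<rat>\<^sub>p/\<int>\<^sub>p\<close>, or up to sign the multiplication of \<open>\<int>/p\<^sup>e\<close>, read in
  \<open>p\<^bsup>-e\<^esup>\<int>/\<int>\<close>. It is perfect: a homomorphism from a cyclic group is given by the image of the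
  generator, and an endomorphism of \<open>\<rat>\<^sub>p/\<int>\<^sub>p\<close> by the compatible images of the classes of \<open>1/p\<^sup>m\<close>,
  which are the residues of a \<open>p\<close>-adic integer.
  
  \<^emph>\<open>Self-injectivity\<close> holds for every self-dual algebra \<open>R\<close> (\<open>self_dual_imp_self_injective\<close>). The
  group \<open>\<rat>\<^sub>p/\<int>\<^sub>p\<close> is injective over \<open>\<int>\<^sub>p\<close>, since it is divisible and the nonzero ideals of \<open>\<int>\<^sub>p\<close> are
  generated by powers of \<open>p\<close>. Hence for \<open>M \<subseteq> N\<close> and \<open>f : M \<rightarrow> R\<close> the functional \<open>\<zeta> \<circ> f\<close> on the component
  of degree \<open>d\<close> extends from \<open>M\<close> to a functional \<open>g\<close> on \<open>N\<close>. By duality there is exactly one \<open>h z\<close> with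
  \<open>\<zeta> (b \<cdot> h z) = g (b z)\<close> for all \<open>b\<close>, and uniqueness makes \<open>h\<close> an \<open>R\<close>-linear extension of \<open>f\<close>.
  
  The two other statements depend only on which products vanish (\<open>sparse_algebra\<close>): for factors of nonzero
  degrees, everything outside degree \<open>-2\<close>. So every element of degree \<open>n \<noteq> 0\<close> has cube zero, as
  \<open>3n \<noteq> -2\<close>, while \<open>\<int>\<^sub>p\<close> is a domain; this gives the reduced quotient.
  
  \<^emph>\<open>Total incoherence.\<close> Let a proper ideal have generators \<open>x\<^sub>1, \<dots>, x\<^sub>r\<close> with a finitely generated module
  \<open>K\<close> of relations. Take \<open>\<alpha> = \<alpha>\<^sub>k\<close> with \<open>k\<close> prime to \<open>p\<close>, so that \<open>p \<alpha> = 0\<close>, in a degree that avoids finitely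
  many values. Then \<open>\<alpha> x\<^sub>i = 0\<close>: in degree \<open>0\<close> because \<open>x\<^sub>i\<close> is not a unit and hence divisible by \<open>p\<close>, otherwise
  because the degree is not \<open>-2\<close>. Thus \<open>\<alpha> e\<^sub>i\<close> lies in \<open>K\<close>, and only the coordinates of degree \<open>0\<close> of the
  generators of \<open>K\<close> can contribute to it. Stripping \<open>\<alpha>\<close> off gives a relation whose coordinates at the
  generators \<open>x\<^sub>j\<close> of the degree of \<open>x\<^sub>i\<close> are \<open>\<delta>\<^sub>i\<^sub>j\<close> modulo \<open>p\<close> (\<open>presentation_nakayama_relation\<close>). An argument
  as in Nakayama's lemma, first in degree \<open>0\<close>, then in the degrees other than \<open>-2\<close>, and finally in degree
  \<open>-2\<close>, shows that all \<open>x\<^sub>i\<close> vanish.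
\<close>

section \<open>Localized integers and p-adic integers\<close>

definition cls :: "nat \<Rightarrow> rat \<Rightarrow> rat set"
  where "cls p x = carrier (Zloc p) +>\<^bsub>rat_ring\<^esub> x"

definition Zint :: "nat \<Rightarrow> int \<Rightarrow> nat \<Rightarrow> int"
  where "Zint p z = (\<lambda>n. z mod int p ^ n)"

locale prime_num =
  fixes p :: nat
  assumes prime_p: "prime p"
begin

abbreviation Zl :: "rat set" where "Zl \<equiv> carrier (Zloc p)"

abbreviation Q_zero (\<open>\<zero>\<^sub>Q\<close>) where "\<zero>\<^sub>Q \<equiv> \<zero>\<^bsub>QpZp p\<^esub>"
abbreviation Q_add (infixl \<open>\<oplus>\<^sub>Q\<close> 65) where "x \<oplus>\<^sub>Q y \<equiv> x \<oplus>\<^bsub>QpZp p\<^esub> y"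
abbreviation Q_minus (\<open>\<ominus>\<^sub>Q _\<close> [81] 80) where "\<ominus>\<^sub>Q x \<equiv> \<ominus>\<^bsub>QpZp p\<^esub> x"
abbreviation Q_smult (infixl \<open>\<odot>\<^sub>Q\<close> 70) where "a \<odot>\<^sub>Q x \<equiv> a \<odot>\<^bsub>QpZp p\<^esub> x"
abbreviation Z_zero (\<open>\<zero>\<^sub>Z\<close>) where "\<zero>\<^sub>Z \<equiv> \<zero>\<^bsub>Zp p\<^esub>"
abbreviation Z_one (\<open>\<one>\<^sub>Z\<close>) where "\<one>\<^sub>Z \<equiv> \<one>\<^bsub>Zp p\<^esub>"
abbreviation Z_add (infixl \<open>\<oplus>\<^sub>Z\<close> 65) where "a \<oplus>\<^sub>Z b \<equiv> a \<oplus>\<^bsub>Zp p\<^esub> b"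
abbreviation Z_diff (infixl \<open>\<ominus>\<^sub>Z\<close> 65) where "a \<ominus>\<^sub>Z b \<equiv> a \<ominus>\<^bsub>Zp p\<^esub> b"
abbreviation Z_mult (infixl \<open>\<otimes>\<^sub>Z\<close> 70) where "a \<otimes>\<^sub>Z b \<equiv> a \<otimes>\<^bsub>Zp p\<^esub> b"

lemma p_gt_1: "1 < int p"
  using prime_p prime_gt_1_nat by auto

lemma p_pos [simp]: "0 < int p" "0 < p" "p \<noteq> 0"
  using p_gt_1 by auto

lemma p_power_pos [simp]: "0 < int p ^ n" "int p ^ n \<noteq> 0" "(of_nat p :: rat) ^ n \<noteq> 0"
  by auto

lemma prime_int_p: "prime (int p)"
  using prime_p by simp

lemma Zl_iff: "x \<in> Zl \<longleftrightarrow> (\<exists>a b. x = of_int a / of_int b \<and> \<not> int p dvd b)"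
  by (auto simp: Zloc_def rat_ring_def)

lemma Zl_of_int [simp]: "of_int a \<in> Zl"
  unfolding Zl_iff using p_gt_1 by (intro exI[of _ a] exI[of _ 1]) auto

lemma Zl_0 [simp]: "0 \<in> Zl" and Zl_1 [simp]: "1 \<in> Zl"
  using Zl_of_int[of 0] Zl_of_int[of 1] by auto

lemma Zl_of_nat_power [simp]: "of_nat p ^ n \<in> Zl"
  using Zl_of_int[of "int p ^ n"] by simp

lemma Zl_add: assumes "x \<in> Zl" "y \<in> Zl" shows "x + y \<in> Zl"
proof -
  obtain a b c d where x: "x = of_int a / of_int b" "\<not> int p dvd b"
    and y: "y = of_int c / of_int d" "\<not> int p dvd d"
    using assms unfolding Zl_iff by blast
  then have nz: "b \<noteq> 0" "d \<noteq> 0" by auto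
  have "x + y = of_int (a * d + c * b) / of_int (b * d)"
    using nz unfolding x y by (simp add: field_simps)
  moreover have "\<not> int p dvd b * d" using x y prime_int_p by (simp add: prime_dvd_mult_iff)
  ultimately show ?thesis unfolding Zl_iff by blast
qed

lemma Zl_mult: assumes "x \<in> Zl" "y \<in> Zl" shows "x * y \<in> Zl"
proof -
  obtain a b c d where x: "x = of_int a / of_int b" "\<not> int p dvd b"
    and y: "y = of_int c / of_int d" "\<not> int p dvd d"
    using assms unfolding Zl_iff by blast
  have "x * y = of_int (a * c) / of_int (b * d)" unfolding x y by simp
  moreover have "\<not> int p dvd b * d" using x y prime_int_p by (simp add: prime_dvd_mult_iff)
  ultimately show ?thesis unfolding Zl_iff by blast
qed

lemma Zl_uminus: assumes "x \<in> Zl" shows "- x \<in> Zl"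
  using Zl_mult[OF Zl_of_int[of "-1"] assms] by simp

lemma Zl_diff: assumes "x \<in> Zl" "y \<in> Zl" shows "x - y \<in> Zl"
  using Zl_add[OF assms(1) Zl_uminus[OF assms(2)]] by simp

lemma Zl_int_mult: "x \<in> Zl \<Longrightarrow> of_int a * x \<in> Zl"
  by (simp add: Zl_mult)

lemma Zl_div_iff: "of_int a / of_nat p ^ n \<in> Zl \<longleftrightarrow> int p ^ n dvd a"
proof
  assume "int p ^ n dvd a"
  then obtain k where "a = int p ^ n * k" by (auto elim: dvdE)
  then have "of_int a / of_nat p ^ n = (of_int k :: rat)" by simp
  then show "of_int a / of_nat p ^ n \<in> Zl" by (metis Zl_of_int)
next
  assume "of_int a / of_nat p ^ n \<in> Zl"
  then obtain c d where *: "(of_int a / of_nat p ^ n :: rat) = of_int c / of_int d" "\<not> int p dvd d"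
    unfolding Zl_iff by blast
  then have "d \<noteq> 0" by auto
  with * have "(of_int (a * d) :: rat) = of_int (c * int p ^ n)"
    by (simp add: field_simps)
  then have "a * d = c * int p ^ n" by (simp only: of_int_eq_iff)
  then have "int p ^ n dvd a * d" by simp
  moreover have "coprime (int p ^ n) d"
    using * prime_int_p by (simp add: prime_imp_coprime)
  ultimately show "int p ^ n dvd a" by (simp add: coprime_dvd_mult_left_iff)
qed

lemma ex_denominator: "\<exists>m. of_nat p ^ m * x \<in> Zl"
proof -
  obtain a b where x: "x = of_int a / of_int b" "b > 0"
    using quotient_of_denom_pos quotient_of_div by (metis surj_pair)
  have "\<not> is_unit (int p)" using p_gt_1 by auto
  then obtain b' where b: "b = int p ^ multiplicity (int p) b * b'" "\<not> int p dvd b'"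
    using multiplicity_decompose'[of b "int p"] x(2) by auto
  define m where "m = multiplicity (int p) b"
  have "b' \<noteq> 0" using b by auto
  have rb: "(of_int b :: rat) = of_nat p ^ m * of_int b'"
    using arg_cong[OF b(1), of "of_int :: int \<Rightarrow> rat"] by (simp add: m_def)
  have "of_nat p ^ m * x = of_int a / of_int b'"
    unfolding x(1) rb by simp
  then show ?thesis using b(2) unfolding Zl_iff by blast
qed

lemma denominator_mono: assumes "of_nat p ^ m * x \<in> Zl" "m \<le> n" shows "of_nat p ^ n * x \<in> Zl"
proof -
  have "of_nat p ^ n * x = of_nat p ^ (n - m) * (of_nat p ^ m * x)"
    unfolding mult.assoc[symmetric] power_add[symmetric] using assms(2) by simp
  then show ?thesis using Zl_mult[OF Zl_of_nat_power[of "n - m"] assms(1)] by metis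
qed

text \<open>
  Inverting the denominator of \<open>x\<close> modulo \<open>p ^ n\<close> gives the residue class of \<open>x\<close>.
\<close>

lemma Zl_residue_ex1:
  assumes "x \<in> Zl"
  shows "\<exists>!r. r \<in> {0..<int p ^ n} \<and> (x - of_int r) / of_nat p ^ n \<in> Zl"
proof -
  obtain a b where x: "x = of_int a / of_int b" "\<not> int p dvd b"
    using assms unfolding Zl_iff by blast
  then have "b \<noteq> 0" by auto
  have "coprime b (int p ^ n)"
    using prime_imp_coprime[OF prime_int_p x(2)] by (simp add: coprime_commute)
  then obtain c where c: "[b * c = 1] (mod int p ^ n)"
    using cong_solve_coprime_int by blast
  define r where "r = (a * c) mod int p ^ n"
  have "[r * b = a * c * b] (mod int p ^ n)" unfolding r_def by (simp add: cong_def mod_mult_left_eq)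
  also have "[a * c * b = a * 1] (mod int p ^ n)"
    using cong_scalar_left[OF c, of a] by (simp add: mult_ac)
  finally have "int p ^ n dvd a - r * b"
    using cong_iff_dvd_diff cong_sym by fastforce
  then obtain k where k: "a - r * b = int p ^ n * k" by (auto elim: dvdE)
  have "(x - of_int r) / of_nat p ^ n = of_int (a - r * b) / (of_int b * of_nat p ^ n)"
    unfolding x using \<open>b \<noteq> 0\<close> by (simp add: field_simps)
  also have "\<dots> = of_int k / of_int b" unfolding k by simp
  finally have 1: "(x - of_int r) / of_nat p ^ n \<in> Zl" using x unfolding Zl_iff by blast
  have 2: "r \<in> {0..<int p ^ n}" unfolding r_def by simp
  have 3: "r' = r" if "r' \<in> {0..<int p ^ n}" "(x - of_int r') / of_nat p ^ n \<in> Zl" for r'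
  proof -
    have "of_int (r' - r) / of_nat p ^ n \<in> Zl"
      using Zl_diff[OF 1 that(2)] by (simp add: diff_divide_distrib[symmetric])
    then have "int p ^ n dvd r' - r" by (simp only: Zl_div_iff)
    then have "r' mod int p ^ n = r mod int p ^ n" by (simp add: mod_eq_dvd_iff)
    then show ?thesis using 2 that(1) by simp
  qed
  show ?thesis using 1 2 3 by blast
qed

lemma Zloc_to_Zp_spec:
  assumes "x \<in> Zl"
  shows "Zloc_to_Zp p x n \<in> {0..<int p ^ n}" "(x - of_int (Zloc_to_Zp p x n)) / of_nat p ^ n \<in> Zl"
  using theI'[OF Zl_residue_ex1[OF assms, of n]] unfolding Zloc_to_Zp_def by auto

lemma Zloc_to_Zp_eqI:
  assumes "x \<in> Zl" "r \<in> {0..<int p ^ n}" "(x - of_int r) / of_nat p ^ n \<in> Zl"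
  shows "Zloc_to_Zp p x n = r"
  using Zl_residue_ex1[OF assms(1), of n] Zloc_to_Zp_spec[OF assms(1), of n] assms(2,3) by blast

subsection \<open>The Pruefer group\<close>

lemma mem_cls: "y \<in> cls p x \<longleftrightarrow> y - x \<in> Zl"
proof -
  have "(\<exists>h\<in>Zl. y = h + x) \<longleftrightarrow> y - x \<in> Zl"
    by (metis add_diff_cancel_right' diff_add_cancel)
  then show ?thesis by (simp add: cls_def a_r_coset_def' rat_ring_def)
qed

lemma cls_eq_iff: "cls p x = cls p y \<longleftrightarrow> x - y \<in> Zl"
proof
  assume "cls p x = cls p y"
  moreover have "x \<in> cls p x" by (simp add: mem_cls)
  ultimately show "x - y \<in> Zl" by (metis mem_cls)
next
  assume *: "x - y \<in> Zl"
  have "z - x \<in> Zl \<longleftrightarrow> z - y \<in> Zl" for z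
    using Zl_add[OF _ *, of "z - x"] Zl_diff[OF _ *, of "z - y"] by auto
  then show "cls p x = cls p y" by (auto simp: mem_cls)
qed

lemma cls_eq_0_iff: "cls p x = cls p 0 \<longleftrightarrow> x \<in> Zl"
  by (simp add: cls_eq_iff)

lemma carrier_QpZp: "carrier (QpZp p) = range (cls p)"
  by (auto simp: QpZp_def A_RCOSETS_def' cls_def rat_ring_def)

lemma cls_in_QpZp [simp]: "cls p x \<in> carrier (QpZp p)"
  by (simp add: carrier_QpZp)

lemma QpZp_E: assumes "X \<in> carrier (QpZp p)" obtains x where "X = cls p x"
  using assms by (auto simp: carrier_QpZp)

lemma QpZp_add: "cls p x \<oplus>\<^sub>Q cls p y = cls p (x + y)"
proof -
  have "cls p x \<oplus>\<^sub>Q cls p y = {a + b | a b. a - x \<in> Zl \<and> b - y \<in> Zl}"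
    by (auto simp: QpZp_def set_add_def' mem_cls rat_ring_def; blast)
  also have "\<dots> = cls p (x + y)"
  proof (intro equalityI subsetI)
    fix z assume "z \<in> {a + b | a b. a - x \<in> Zl \<and> b - y \<in> Zl}"
    then obtain a b where "z = a + b" "a - x \<in> Zl" "b - y \<in> Zl" by blast
    then show "z \<in> cls p (x + y)" using Zl_add[of "a - x" "b - y"] by (simp add: mem_cls algebra_simps)
  next
    fix z assume "z \<in> cls p (x + y)"
    then have "z = (z - y) + y" "(z - y) - x \<in> Zl" "y - y \<in> Zl" by (auto simp: mem_cls algebra_simps)
    then show "z \<in> {a + b | a b. a - x \<in> Zl \<and> b - y \<in> Zl}" by blast
  qed
  finally show ?thesis .
qed

lemma QpZp_zero: "\<zero>\<^sub>Q = cls p 0"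
  by (auto simp: QpZp_def mem_cls)

lemma QpZp_abelian_group: "abelian_group (QpZp p)"
proof (rule abelian_groupI)
  fix x assume "x \<in> carrier (QpZp p)"
  then obtain a where "x = cls p a" by (rule QpZp_E)
  then have "cls p (- a) \<oplus>\<^sub>Q x = \<zero>\<^sub>Q" by (simp add: QpZp_add QpZp_zero)
  then show "\<exists>y\<in>carrier (QpZp p). y \<oplus>\<^sub>Q x = \<zero>\<^sub>Q" using cls_in_QpZp by blast
qed (auto elim!: QpZp_E simp: QpZp_add QpZp_zero add_ac)

lemma QpZp_comm_group: "comm_group (add_monoid (QpZp p))"
  using QpZp_abelian_group by (rule abelian_group.a_comm_group)

lemma Zloc_act_cls:
  assumes "a \<in> Zl" shows "Zloc_act_QpZp p a (cls p x) = cls p (a * x)"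
proof -
  have "Zl +>\<^bsub>rat_ring\<^esub> (a * y) = cls p (a * x)" if "y \<in> cls p x" for y
  proof -
    have "a * (y - x) \<in> Zl" using that assms Zl_mult by (simp add: mem_cls)
    then have "cls p (a * y) = cls p (a * x)" unfolding cls_eq_iff by (simp add: algebra_simps)
    then show ?thesis by (simp add: cls_def)
  qed
  moreover have "x \<in> cls p x" by (simp add: mem_cls)
  ultimately show ?thesis unfolding Zloc_act_QpZp_def by blast
qed

subsection \<open>The p-adic integers\<close>

lemma Zp_iff: "a \<in> carrier (Zp p) \<longleftrightarrow>
    (\<forall>n. 0 \<le> a n \<and> a n < int p ^ n \<and> a (Suc n) mod int p ^ n = a n)"
  by (auto simp: Zp_def)

lemma Zp_range: "a \<in> carrier (Zp p) \<Longrightarrow> 0 \<le> a n \<and> a n < int p ^ n"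
  by (simp add: Zp_iff)

lemma Zp_mod: assumes "a \<in> carrier (Zp p)" "m \<le> n" shows "a n mod int p ^ m = a m"
  using assms(2)
proof (induction n rule: dec_induct)
  case base
  then show ?case using Zp_range[OF assms(1)] by simp
next
  case (step n)
  have "a (Suc n) mod int p ^ m = a (Suc n) mod int p ^ n mod int p ^ m"
    using step by (simp add: mod_mod_cancel le_imp_power_dvd)
  also have "a (Suc n) mod int p ^ n = a n" using assms(1) by (simp add: Zp_iff)
  finally show ?case using step by simp
qed

lemma Zp_dvd_diff: assumes "a \<in> carrier (Zp p)" "m \<le> n" shows "int p ^ m dvd a n - a m"
  using Zp_mod[OF assms] Zp_range[OF assms(1), of m] by (metis mod_eq_dvd_iff mod_pos_pos_trivial)

lemma Zp_memI:
  assumes "\<And>n. 0 \<le> a n \<and> a n < int p ^ n" "\<And>n. int p ^ n dvd a (Suc n) - a n"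
  shows "a \<in> carrier (Zp p)"
  unfolding Zp_iff using assms by (metis mod_eq_dvd_iff mod_pos_pos_trivial)

lemma Zp_mult: "(a \<otimes>\<^sub>Z b) n = (a n * b n) mod int p ^ n"
  and Zp_add: "(a \<oplus>\<^sub>Z b) n = (a n + b n) mod int p ^ n"
  and Zp_one: "\<one>\<^sub>Z n = 1 mod int p ^ n"
  and Zp_zero: "\<zero>\<^sub>Z n = 0"
  by (auto simp: Zp_def)

lemma mod_p_Suc: "x mod int p ^ Suc n mod int p ^ n = x mod int p ^ n"
  by (rule mod_mod_cancel) simp

lemma Zint_closed [simp]: "Zint p z \<in> carrier (Zp p)"
  by (auto simp: Zp_iff Zint_def mod_p_Suc simp del: power_Suc)

lemma Zint_0: "Zint p 0 = \<zero>\<^sub>Z" and Zint_1: "Zint p 1 = \<one>\<^sub>Z"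
  by (auto simp: Zint_def Zp_def)

lemma Zint_mult: "Zint p (x * y) = Zint p x \<otimes>\<^sub>Z Zint p y"
  by (auto simp: Zint_def Zp_add Zp_mult fun_eq_iff mod_simps)

lemma Zp_closed:
  assumes "a \<in> carrier (Zp p)" "b \<in> carrier (Zp p)"
  shows "a \<oplus>\<^sub>Z b \<in> carrier (Zp p)" "a \<otimes>\<^sub>Z b \<in> carrier (Zp p)"
proof -
  have *: "a (Suc n) mod int p ^ n = a n" "b (Suc n) mod int p ^ n = b n" for n
    using assms by (simp_all add: Zp_iff)
  have "(a (Suc n) + b (Suc n)) mod int p ^ n = (a n + b n) mod int p ^ n" for n
    by (metis * mod_add_eq)
  moreover have "(a (Suc n) * b (Suc n)) mod int p ^ n = (a n * b n) mod int p ^ n" for n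
    by (metis * mod_mult_eq)
  ultimately show "a \<oplus>\<^sub>Z b \<in> carrier (Zp p)" "a \<otimes>\<^sub>Z b \<in> carrier (Zp p)"
    by (simp_all add: Zp_iff Zp_add Zp_mult mod_p_Suc del: power_Suc)
qed

lemma Zp_cring: "cring (Zp p)"
proof (rule cringI)
  have one: "\<one>\<^sub>Z \<in> carrier (Zp p)" "\<zero>\<^sub>Z \<in> carrier (Zp p)"
    by (simp_all flip: Zint_1 Zint_0)
  have res: "a n mod int p ^ n = a n" if "a \<in> carrier (Zp p)" for a n
    using Zp_range[OF that] by simp
  show "abelian_group (Zp p)"
  proof (rule abelian_groupI)
    fix a assume a: "a \<in> carrier (Zp p)"
    have "(\<lambda>n. (- a n) mod int p ^ n) \<in> carrier (Zp p)"
    proof -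
      have "(- a (Suc n)) mod int p ^ n = (- a n) mod int p ^ n" for n
        using a by (metis Zp_iff mod_minus_eq)
      then show ?thesis by (simp add: Zp_iff mod_p_Suc del: power_Suc)
    qed
    moreover have "(\<lambda>n. (- a n) mod int p ^ n) \<oplus>\<^sub>Z a = \<zero>\<^sub>Z"
      by (auto simp: fun_eq_iff Zp_add Zp_zero mod_simps)
    ultimately show "\<exists>y\<in>carrier (Zp p). y \<oplus>\<^sub>Z a = \<zero>\<^sub>Z" by blast
  qed (auto simp: one Zp_closed fun_eq_iff Zp_add Zp_zero mod_simps res add_ac)
  show "comm_monoid (Zp p)"
    by (rule comm_monoidI) (auto simp: one Zp_closed fun_eq_iff Zp_mult Zp_one mod_simps res mult_ac)
qed (auto simp: Zp_closed fun_eq_iff Zp_mult Zp_add mod_simps algebra_simps)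

lemma Zloc_to_Zp_closed: assumes "x \<in> Zl" shows "Zloc_to_Zp p x \<in> carrier (Zp p)"
proof (rule Zp_memI)
  fix n
  let ?r = "Zloc_to_Zp p x"
  show "0 \<le> ?r n \<and> ?r n < int p ^ n" using Zloc_to_Zp_spec(1)[OF assms, of n] by simp
  have "(x - of_int (?r (Suc n))) / of_nat p ^ n = of_nat p * ((x - of_int (?r (Suc n))) / of_nat p ^ Suc n)"
    by simp
  then have "(x - of_int (?r (Suc n))) / of_nat p ^ n \<in> Zl"
    using Zloc_to_Zp_spec(2)[OF assms, of "Suc n"] Zl_mult[OF Zl_of_nat_power[of 1]]
    by (metis power_one_right)
  from Zl_diff[OF Zloc_to_Zp_spec(2)[OF assms, of n] this]
  have "of_int (?r (Suc n) - ?r n) / of_nat p ^ n \<in> Zl" by (simp add: diff_divide_distrib[symmetric])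
  then show "int p ^ n dvd ?r (Suc n) - ?r n" by (simp only: Zl_div_iff)
qed

lemma Zloc_to_Zp_of_int: "Zloc_to_Zp p (of_int z) = Zint p z"
proof
  fix n
  have "of_int (z - z mod int p ^ n) / of_nat p ^ n \<in> Zl"
    unfolding Zl_div_iff by (simp add: minus_mod_eq_mult_div)
  then show "Zloc_to_Zp p (of_int z) n = Zint p z n"
    by (intro Zloc_to_Zp_eqI) (auto simp: Zint_def)
qed

lemma Zloc_to_Zp_dvdI:
  assumes "x \<in> Zl" "(x - of_int r) / of_nat p ^ n \<in> Zl" shows "Zloc_to_Zp p x n = r mod int p ^ n"
proof (rule Zloc_to_Zp_eqI[OF assms(1)])
  have "of_int (r - r mod int p ^ n) / of_nat p ^ n \<in> Zl"
    unfolding Zl_div_iff by (simp add: minus_mod_eq_mult_div)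
  from Zl_add[OF assms(2) this]
  show "(x - of_int (r mod int p ^ n)) / of_nat p ^ n \<in> Zl"
    by (simp add: add_divide_distrib[symmetric])
qed simp

lemma Zloc_to_Zp_add:
  assumes "x \<in> Zl" "y \<in> Zl"
  shows "Zloc_to_Zp p (x + y) = Zloc_to_Zp p x \<oplus>\<^sub>Z Zloc_to_Zp p y"
proof
  fix n
  have "(x + y - of_int (Zloc_to_Zp p x n + Zloc_to_Zp p y n)) / of_nat p ^ n \<in> Zl"
    using Zl_add[OF Zloc_to_Zp_spec(2)[OF assms(1), of n] Zloc_to_Zp_spec(2)[OF assms(2), of n]]
    by (simp add: add_divide_distrib[symmetric] algebra_simps)
  then show "Zloc_to_Zp p (x + y) n = (Zloc_to_Zp p x \<oplus>\<^sub>Z Zloc_to_Zp p y) n"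
    using Zloc_to_Zp_dvdI[OF Zl_add[OF assms]] by (simp add: Zp_add)
qed

lemma Zloc_to_Zp_mult:
  assumes "x \<in> Zl" "y \<in> Zl"
  shows "Zloc_to_Zp p (x * y) = Zloc_to_Zp p x \<otimes>\<^sub>Z Zloc_to_Zp p y"
proof
  fix n
  let ?r = "Zloc_to_Zp p x n" and ?s = "Zloc_to_Zp p y n"
  have "(x * y - of_int (?r * ?s)) / of_nat p ^ n
      = x * ((y - of_int ?s) / of_nat p ^ n) + of_int ?s * ((x - of_int ?r) / of_nat p ^ n)"
    by (simp add: add_divide_distrib[symmetric] algebra_simps)
  also have "\<dots> \<in> Zl"
    using assms Zloc_to_Zp_spec(2) by (intro Zl_add Zl_mult) auto
  finally show "Zloc_to_Zp p (x * y) n = (Zloc_to_Zp p x \<otimes>\<^sub>Z Zloc_to_Zp p y) n"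
    using Zloc_to_Zp_dvdI[OF Zl_mult[OF assms]] by (simp add: Zp_mult)
qed

lemma Zloc_cring: "cring (Zloc p)"
proof (rule cringI)
  show "abelian_group (Zloc p)"
  proof (rule abelian_groupI)
    fix x assume "x \<in> Zl"
    then have "- x \<in> Zl" "- x \<oplus>\<^bsub>Zloc p\<^esub> x = \<zero>\<^bsub>Zloc p\<^esub>" 
      by (auto simp: Zl_uminus) (simp add: Zloc_def rat_ring_def)
    then show "\<exists>y\<in>Zl. y \<oplus>\<^bsub>Zloc p\<^esub> x = \<zero>\<^bsub>Zloc p\<^esub>" by blast
  next
    fix x y assume "x \<in> Zl" "y \<in> Zl"
    then show "x \<oplus>\<^bsub>Zloc p\<^esub> y \<in> Zl" using Zl_add by (simp add: Zloc_def rat_ring_def)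
  next
    show "\<zero>\<^bsub>Zloc p\<^esub> \<in> Zl" using Zl_0 by (simp add: Zloc_def rat_ring_def)
  qed (auto simp: Zloc_def rat_ring_def)
  show "comm_monoid (Zloc p)"
  proof (rule comm_monoidI)
    fix x y assume "x \<in> Zl" "y \<in> Zl"
    then show "x \<otimes>\<^bsub>Zloc p\<^esub> y \<in> Zl" using Zl_mult by (simp add: Zloc_def rat_ring_def)
  next
    show "\<one>\<^bsub>Zloc p\<^esub> \<in> Zl" using Zl_1 by (simp add: Zloc_def rat_ring_def)
  qed (auto simp: Zloc_def rat_ring_def)
qed (auto simp: Zloc_def rat_ring_def algebra_simps)

lemma Zloc_ops: "x \<otimes>\<^bsub>Zloc p\<^esub> y = x * y" "x \<oplus>\<^bsub>Zloc p\<^esub> y = x + y" "\<one>\<^bsub>Zloc p\<^esub> = 1" "\<zero>\<^bsub>Zloc p\<^esub> = 0"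
  by (auto simp: Zloc_def rat_ring_def)

lemma Zloc_to_Zp_hom: "Zloc_to_Zp p \<in> ring_hom (Zloc p) (Zp p)"
  using Zloc_to_Zp_of_int[of 1]
  by (auto simp: ring_hom_def Zloc_ops Zloc_to_Zp_closed Zloc_to_Zp_add Zloc_to_Zp_mult Zint_1)

text \<open>
  The residue of the quotient modulo \<open>p\<^sup>k\<close> comes from the residue of \<open>a\<close> modulo \<open>p\<^bsup>n + k\<^esup>\<close>.
\<close>

lemma Zp_divisible:
  assumes "a \<in> carrier (Zp p)" "a n = 0"
  shows "\<exists>b\<in>carrier (Zp p). a = Zint p (int p ^ n) \<otimes>\<^sub>Z b"
proof -
  have dv: "int p ^ n dvd a (n + k)" for k
    using Zp_dvd_diff[OF assms(1), of n "n + k"] assms(2) by simp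
  define b where "b k = a (n + k) div int p ^ n" for k
  have ab: "a (n + k) = int p ^ n * b k" for k
    using dv[of k] by (simp add: b_def)
  have "b \<in> carrier (Zp p)"
  proof (rule Zp_memI)
    fix k
    have "0 \<le> int p ^ n * b k \<and> int p ^ n * b k < int p ^ n * int p ^ k"
      using Zp_range[OF assms(1), of "n + k"] by (simp add: ab power_add)
    then show "0 \<le> b k \<and> b k < int p ^ k"
      using mult_less_cancel_left_pos[of "int p ^ n" "b k" "int p ^ k"]
        zero_le_mult_iff[of "int p ^ n" "b k"] p_power_pos(1)[of n] by linarith
    have "int p ^ n * int p ^ k dvd int p ^ n * (b (Suc k) - b k)"
      using Zp_dvd_diff[OF assms(1), of "n + k" "n + Suc k"] by (simp add: ab power_add right_diff_distrib flip: add_Suc_right)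
    then show "int p ^ k dvd b (Suc k) - b k" by (subst (asm) dvd_mult_cancel_left) auto
  qed
  moreover have "a = Zint p (int p ^ n) \<otimes>\<^sub>Z b"
  proof
    fix k
    have "a k = a (n + k) mod int p ^ k" using Zp_mod[OF assms(1), of k "n + k"] by simp
    also have "\<dots> = (Zint p (int p ^ n) \<otimes>\<^sub>Z b) k"
      by (simp add: ab Zp_mult Zint_def mod_simps)
    finally show "a k = (Zint p (int p ^ n) \<otimes>\<^sub>Z b) k" .
  qed
  ultimately show ?thesis by blast
qed

text \<open>
  Each residue \<open>a k\<close> is prime to \<open>p\<close> and has an inverse modulo \<open>p\<^sup>k\<close>. The inverses are compatible
  because they are unique.
\<close>

lemma Zp_unit:
  assumes "a \<in> carrier (Zp p)" "a 1 \<noteq> 0"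
  shows "\<exists>b\<in>carrier (Zp p). a \<otimes>\<^sub>Z b = \<one>\<^sub>Z"
proof -
  have "\<exists>c. [a k * c = 1] (mod int p ^ k)" for k
  proof (cases k)
    case (Suc l)
    have "\<not> int p dvd a k"
    proof
      assume "int p dvd a k"
      then have "a k mod int p ^ 1 = 0" by auto
      then show False using Zp_mod[OF assms(1), of 1 k] Suc assms(2) by simp
    qed
    then have "coprime (a k) (int p ^ k)"
      using prime_imp_coprime[OF prime_int_p, of "a k"] by (simp add: coprime_commute)
    then show ?thesis using cong_solve_coprime_int by blast
  qed auto
  then obtain c where c: "[a k * c k = 1] (mod int p ^ k)" for k by metis
  define b where "b k = c k mod int p ^ k" for k
  have ab: "[a k * b k = 1] (mod int p ^ k)" for k
    using c[of k] by (simp add: b_def cong_def mod_mult_right_eq)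
  have "b \<in> carrier (Zp p)"
  proof (rule Zp_memI)
    fix k
    show "0 \<le> b k \<and> b k < int p ^ k" by (simp add: b_def)
    have 1: "[a (Suc k) = a k] (mod int p ^ k)"
      using Zp_dvd_diff[OF assms(1), of k "Suc k"] by (simp add: cong_iff_dvd_diff)
    have "[a (Suc k) * b (Suc k) = 1] (mod int p ^ k)"
      using ab[of "Suc k"] by (rule cong_dvd_modulus) (simp add: le_imp_power_dvd)
    then have 2: "[a k * b (Suc k) = 1] (mod int p ^ k)"
      using cong_scalar_right[OF 1] cong_sym cong_trans by blast
    have "[b (Suc k) = b (Suc k) * (a k * b k)] (mod int p ^ k)"
      using cong_scalar_left[OF cong_sym[OF ab[of k]], of "b (Suc k)"] by simp
    also have "[b (Suc k) * (a k * b k) = 1 * b k] (mod int p ^ k)"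
      using cong_scalar_right[OF 2, of "b k"] by (simp add: mult_ac)
    finally show "int p ^ k dvd b (Suc k) - b k" by (simp add: cong_iff_dvd_diff)
  qed
  moreover have "a \<otimes>\<^sub>Z b = \<one>\<^sub>Z"
    using ab by (auto simp: fun_eq_iff Zp_mult Zp_one cong_def)
  ultimately show ?thesis by blast
qed

text \<open>The number \<open>n\<close> is the valuation of \<open>a\<close>: the first residue that does not vanish is \<open>a (n + 1)\<close>.\<close>

lemma Zp_decompose:
  assumes "a \<in> carrier (Zp p)" "a \<noteq> \<zero>\<^sub>Z"
  obtains n u v where "u \<in> carrier (Zp p)" "v \<in> carrier (Zp p)" "u \<otimes>\<^sub>Z v = \<one>\<^sub>Z"
    "a = Zint p (int p ^ n) \<otimes>\<^sub>Z u" "a n = 0" "a (Suc n) \<noteq> 0"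
proof -
  have a0: "a 0 = 0" using Zp_range[OF assms(1), of 0] by auto
  have "\<exists>k. a k \<noteq> 0" using assms(2) by (auto simp: fun_eq_iff Zp_zero)
  then obtain m where m: "a m \<noteq> 0" "\<And>j. j < m \<Longrightarrow> a j = 0" using exists_least_iff[of "\<lambda>k. a k \<noteq> 0"] by auto
  then obtain n where n: "m = Suc n" using a0 by (cases m) auto
  then have an: "a n = 0" "a (Suc n) \<noteq> 0" using m by auto
  then obtain u where u: "u \<in> carrier (Zp p)" "a = Zint p (int p ^ n) \<otimes>\<^sub>Z u"
    using Zp_divisible[OF assms(1)] by blast
  have "u 1 \<noteq> 0"
  proof
    assume "u 1 = 0"
    then have "int p dvd u (Suc n)" using Zp_dvd_diff[OF u(1), of 1 "Suc n"] by simp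
    then have "int p ^ n * int p dvd int p ^ n * u (Suc n)" by (rule mult_dvd_mono[OF dvd_refl])
    then have "int p ^ Suc n dvd int p ^ n * u (Suc n)" by (simp add: mult.commute)
    then have "(int p ^ n * u (Suc n)) mod int p ^ Suc n = 0" by (simp only: dvd_imp_mod_0)
    moreover have "a (Suc n) = (int p ^ n * u (Suc n)) mod int p ^ Suc n"
      by (subst u(2)) (simp add: Zp_mult Zint_def mod_mult_left_eq)
    ultimately show False using an by simp
  qed
  then show ?thesis using that Zp_unit u an by metis
qed

lemma Zint_mult_eq_0:
  assumes "a \<in> carrier (Zp p)" "Zint p (int p ^ n) \<otimes>\<^sub>Z a = \<zero>\<^sub>Z"
  shows "a = \<zero>\<^sub>Z"
proof
  fix k
  have "(Zint p (int p ^ n) \<otimes>\<^sub>Z a) (n + k) = 0" using assms(2) by (simp add: Zp_zero)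
  then have "int p ^ n * int p ^ k dvd int p ^ n * a (n + k)"
    by (auto simp: Zp_mult Zint_def mod_mult_left_eq power_add)
  then have "int p ^ k dvd a (n + k)" by (subst (asm) dvd_mult_cancel_left) auto
  then show "a k = \<zero>\<^sub>Z k" using Zp_mod[OF assms(1), of k "n + k"] by (simp add: Zp_zero)
qed

lemma Zp_integral:
  assumes "a \<in> carrier (Zp p)" "b \<in> carrier (Zp p)" "a \<otimes>\<^sub>Z b = \<zero>\<^sub>Z" "a \<noteq> \<zero>\<^sub>Z"
  shows "b = \<zero>\<^sub>Z"
proof -
  interpret cring "Zp p" by (rule Zp_cring)
  obtain n u v where u: "u \<in> carrier (Zp p)" "v \<in> carrier (Zp p)" "u \<otimes>\<^sub>Z v = \<one>\<^sub>Z"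
    "a = Zint p (int p ^ n) \<otimes>\<^sub>Z u"
    using Zp_decompose[OF assms(1,4)] by metis
  have "Zint p (int p ^ n) \<otimes>\<^sub>Z (u \<otimes>\<^sub>Z b) = \<zero>\<^sub>Z"
    using assms u by (simp add: m_assoc)
  then have "u \<otimes>\<^sub>Z b = \<zero>\<^sub>Z" using Zint_mult_eq_0 u assms by blast
  then have "v \<otimes>\<^sub>Z (u \<otimes>\<^sub>Z b) = \<zero>\<^sub>Z" using u by simp
  then show ?thesis using u assms(2) by (metis l_one m_assoc m_comm)
qed

lemma Zp_one_not_zero: "\<one>\<^sub>Z \<noteq> \<zero>\<^sub>Z"
proof
  assume "\<one>\<^sub>Z = \<zero>\<^sub>Z"
  then have "\<one>\<^sub>Z 1 = \<zero>\<^sub>Z 1" by simp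
  then show False using p_gt_1 by (simp add: Zp_one Zp_zero)
qed

text \<open>
  The scalar multiplication collects the values for all representatives of the class and all exponents
  that kill them. They agree: \<open>a k\<close> and \<open>a l\<close> are congruent modulo \<open>p\<^sup>k\<close> for \<open>k \<le> l\<close>, and changing the
  representative by an element of the local ring changes the value by such an element.
\<close>

lemma QpZp_smult:
  assumes "a \<in> carrier (Zp p)" "of_nat p ^ m * x \<in> Zl"
  shows "a \<odot>\<^sub>Q cls p x = cls p (of_int (a m) * x)"
proof -
  have *: "cls p (of_int (a k) * y) = cls p (of_int (a l) * x)"
    if "y - x \<in> Zl \<and> of_nat p ^ k * y \<in> Zl" and kl: "k \<le> l" for k l x y
  proof -
    obtain c where c: "a l = a k + int p ^ k * c"
      using Zp_dvd_diff[OF assms(1) kl] by (metis dvdE add.commute diff_add_cancel)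
    have "of_int (a k) * y - of_int (a l) * x = of_int (a l) * (y - x) - of_int c * (of_nat p ^ k * y)"
      unfolding c by (simp add: algebra_simps)
    also have "\<dots> \<in> Zl" using that by (intro Zl_diff[OF Zl_int_mult Zl_int_mult]) auto
    finally show ?thesis by (simp add: cls_eq_iff)
  qed
  have eq: "cls p (of_int (a k) * y) = cls p (of_int (a m) * x)"
    if "y \<in> cls p x" "of_nat p ^ k * y \<in> Zl" for y k
  proof (cases "k \<le> m")
    case True
    then show ?thesis using * that assms(2) by (simp add: mem_cls)
  next
    case False
    have "x - y \<in> Zl" using Zl_uminus[of "y - x"] that by (simp add: mem_cls)
    then show ?thesis using *[of x y m k] that assms(2) False by simp
  qed
  have "x \<in> cls p x" by (simp add: mem_cls)
  then have "(\<Union>y\<in>cls p x. \<Union>k\<in>{k. of_nat p ^ k * y \<in> Zl}. cls p (of_int (a k) * y)) = cls p (of_int (a m) * x)"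
    using eq assms(2) by blast
  then show ?thesis by (simp add: QpZp_def cls_def)
qed

lemma cls_mod:
  assumes "of_nat p ^ m * x \<in> Zl"
  shows "cls p (of_int (z mod int p ^ m) * x) = cls p (of_int z * x)"
proof -
  define q where "q = z div int p ^ m"
  have "z = int p ^ m * q + z mod int p ^ m" by (simp add: q_def)
  then have "(of_int z :: rat) = of_int (int p ^ m * q + z mod int p ^ m)" by (rule arg_cong)
  then have "of_int (z mod int p ^ m) * x - of_int z * x = of_int (- q) * (of_nat p ^ m * x)"
    by (simp add: algebra_simps)
  also have "\<dots> \<in> Zl" by (rule Zl_int_mult[OF assms])
  finally show ?thesis by (simp only: cls_eq_iff)
qed

lemma QpZp_smult_Zint: "Zint p z \<odot>\<^sub>Q cls p x = cls p (of_int z * x)"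
proof -
  obtain m where m: "of_nat p ^ m * x \<in> Zl" using ex_denominator by blast
  show ?thesis unfolding QpZp_smult[OF Zint_closed m] using cls_mod[OF m] by (simp add: Zint_def)
qed

lemma QpZp_module: "module (Zp p) (QpZp p)"
proof (rule moduleI[OF Zp_cring QpZp_abelian_group])
  fix a X assume a: "a \<in> carrier (Zp p)" and "X \<in> carrier (QpZp p)"
  then obtain x where x: "X = cls p x" by (auto elim: QpZp_E)
  obtain m where m: "of_nat p ^ m * x \<in> Zl" using ex_denominator by blast
  show "a \<odot>\<^sub>Q X \<in> carrier (QpZp p)" unfolding x QpZp_smult[OF a m] by simp
  fix b assume b: "b \<in> carrier (Zp p)"
  have m': "of_nat p ^ m * (of_int z * x) \<in> Zl" for z using Zl_int_mult[OF m, of z] by (simp add: mult_ac)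
  note mm = cls_mod[OF m]
  show "(a \<oplus>\<^sub>Z b) \<odot>\<^sub>Q X = a \<odot>\<^sub>Q X \<oplus>\<^sub>Q b \<odot>\<^sub>Q X"
    unfolding x using a b m
    by (simp add: QpZp_smult[of _ m] Zp_closed QpZp_add Zp_add mm) (simp add: algebra_simps)
  show "(a \<otimes>\<^sub>Z b) \<odot>\<^sub>Q X = a \<odot>\<^sub>Q (b \<odot>\<^sub>Q X)"
    unfolding x using a b m m'
    by (simp add: QpZp_smult[of _ m] Zp_closed Zp_mult mm) (simp add: algebra_simps)
next
  fix a X Y assume a: "a \<in> carrier (Zp p)" and "X \<in> carrier (QpZp p)" "Y \<in> carrier (QpZp p)"
  then obtain x y where x: "X = cls p x" "Y = cls p y" by (auto elim!: QpZp_E)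
  obtain m k where m: "of_nat p ^ m * x \<in> Zl" "of_nat p ^ k * y \<in> Zl" using ex_denominator by blast
  define n where "n = max m k"
  have n: "of_nat p ^ n * x \<in> Zl" "of_nat p ^ n * y \<in> Zl"
    using m denominator_mono by (auto simp: n_def)
  then have "of_nat p ^ n * (x + y) \<in> Zl" using Zl_add by (simp add: algebra_simps)
  then show "a \<odot>\<^sub>Q (X \<oplus>\<^sub>Q Y) = a \<odot>\<^sub>Q X \<oplus>\<^sub>Q a \<odot>\<^sub>Q Y"
    unfolding x using a n by (simp add: QpZp_smult[of _ n] QpZp_add) (simp add: algebra_simps)
next
  fix X assume "X \<in> carrier (QpZp p)"
  then obtain x where x: "X = cls p x" by (auto elim: QpZp_E)
  show "\<one>\<^sub>Z \<odot>\<^sub>Q X = X" using QpZp_smult_Zint[of 1 x] by (simp add: x Zint_1)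
qed

end

section \<open>The graded ring J\<close>

locale odd_prime = prime_num +
  assumes odd_p: "odd p"
begin

lemma p_ge_3: "3 \<le> int p"
  using p_gt_1 odd_p by (cases "p = 2") auto

lemma alpha_deg_inj [simp]: "alpha_deg p j = alpha_deg p k \<longleftrightarrow> j = k"
  using p_gt_1 by (simp add: alpha_deg_def)

lemma odd_alpha_deg [simp]: "odd (alpha_deg p k)"
  by (simp add: alpha_deg_def)

lemma alpha_deg_neq [simp]: "alpha_deg p k \<noteq> 0" "alpha_deg p k \<noteq> - 2"
    "0 \<noteq> alpha_deg p k" "- 2 \<noteq> alpha_deg p k"
  using odd_alpha_deg[of k] by (metis even_zero, metis even_minus even_numeral)+

lemma alpha_deg_add: "alpha_deg p j + alpha_deg p k = 2 * ((int p - 1) * (j + k)) - 2"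
  by (simp add: alpha_deg_def algebra_simps)

lemma alpha_deg_add_eq_m2 [simp]: "alpha_deg p j + alpha_deg p k = - 2 \<longleftrightarrow> j + k = 0"
  unfolding alpha_deg_add using p_gt_1 by simp

text \<open>
  For odd \<open>p\<close> the number \<open>p - 1\<close> is not a unit, so no product \<open>\<alpha>\<^sub>j \<alpha>\<^sub>k\<close> has degree \<open>0\<close>.
\<close>

lemma p_minus_1_mult_neq_1: "(int p - 1) * k \<noteq> 1"
  using p_ge_3 by (auto simp: zmult_eq_1_iff)

lemma alpha_deg_add_neq_0 [simp]: "alpha_deg p j + alpha_deg p k \<noteq> 0"
  unfolding alpha_deg_add using p_minus_1_mult_neq_1[of "j + k"] by simp

lemma alpha_exp_minus: "alpha_exp p (- k) = alpha_exp p k"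
  using multiplicity_times_unit_right[of "-1" "int p" k] by (simp add: alpha_exp_def)

definition null_deg :: "int \<Rightarrow> bool"
  where "null_deg n \<longleftrightarrow> n \<noteq> 0 \<and> n \<noteq> - 2 \<and> (\<forall>k. k \<noteq> 0 \<longrightarrow> n \<noteq> alpha_deg p k)"

lemma J_simps [simp]:
  "gcar (J p) n = J_carrier p n" "x \<otimes>\<^bsub>ggrp (J p) n\<^esub> y = J_add p x y"
  "\<one>\<^bsub>ggrp (J p) n\<^esub> = J_zero p n" "gmult (J p) = J_mult p" "gone (J p) = Eta 1"
  by (auto simp: J_def)

lemma J_carrier_iff:
  "Eta a \<in> J_carrier p n \<longleftrightarrow> n = 0 \<and> a \<in> Zl"
  "Zeta_inv X \<in> J_carrier p n \<longleftrightarrow> n = - 2 \<and> X \<in> carrier (QpZp p)"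
  "Alpha k c \<in> J_carrier p n \<longleftrightarrow> k \<noteq> 0 \<and> n = alpha_deg p k \<and> 0 \<le> c \<and> c < int p ^ alpha_exp p k"
  "Null \<in> J_carrier p n \<longleftrightarrow> null_deg n"
  by (auto simp: J_carrier_def null_deg_def)

lemma J_cases:
  assumes "x \<in> J_carrier p n"
  obtains (Eta) a where "n = 0" "x = Eta a" "a \<in> Zl"
    | (Zeta) z where "n = - 2" "x = Zeta_inv (cls p z)"
    | (Alpha) k c where "n = alpha_deg p k" "x = Alpha k c" "k \<noteq> 0" "0 \<le> c" "c < int p ^ alpha_exp p k"
    | (Null) "x = Null" "null_deg n"
  using assms by (cases x) (auto simp: J_carrier_iff carrier_QpZp)

lemma J_zero_simps:
  "J_zero p 0 = Eta 0" "J_zero p (- 2) = Zeta_inv (cls p 0)"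
  "k \<noteq> 0 \<Longrightarrow> J_zero p (alpha_deg p k) = Alpha k 0"
  "null_deg n \<Longrightarrow> J_zero p n = Null"
  by (auto simp: J_zero_def null_deg_def QpZp_zero)

lemma deg_cases:
  obtains (Eta) "n = 0" | (Zeta) "n = - 2" | (Alpha) k where "k \<noteq> 0" "n = alpha_deg p k" | (Null) "null_deg n"
  unfolding null_deg_def by blast

lemma J_zero_closed [simp]: "J_zero p n \<in> J_carrier p n"
  by (cases n rule: deg_cases) (auto simp: J_zero_simps J_carrier_iff)

lemma J_add_zero: "x \<in> J_carrier p n \<Longrightarrow> J_add p (J_zero p n) x = x"
  by (erule J_cases) (auto simp: J_zero_simps QpZp_add)

lemma J_comm_group: "comm_group (ggrp (J p) n)"
proof (rule comm_groupI)
  fix x y z assume "x \<in> gcar (J p) n" "y \<in> gcar (J p) n" "z \<in> gcar (J p) n"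
  then have xyz: "x \<in> J_carrier p n" "y \<in> J_carrier p n" "z \<in> J_carrier p n" by simp_all
  show "x \<otimes>\<^bsub>ggrp (J p) n\<^esub> y \<in> gcar (J p) n"
    using xyz(1,2) by (elim J_cases) (auto simp: J_carrier_iff Zl_add QpZp_add null_deg_def)
  show "x \<otimes>\<^bsub>ggrp (J p) n\<^esub> y \<otimes>\<^bsub>ggrp (J p) n\<^esub> z = x \<otimes>\<^bsub>ggrp (J p) n\<^esub> (y \<otimes>\<^bsub>ggrp (J p) n\<^esub> z)"
    using xyz by (elim J_cases) (auto simp: QpZp_add mod_simps null_deg_def add_ac)
  show "x \<otimes>\<^bsub>ggrp (J p) n\<^esub> y = y \<otimes>\<^bsub>ggrp (J p) n\<^esub> x"
    using xyz(1,2) by (elim J_cases) (auto simp: QpZp_add null_deg_def add_ac)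
  show "\<one>\<^bsub>ggrp (J p) n\<^esub> \<otimes>\<^bsub>ggrp (J p) n\<^esub> x = x" using xyz by (simp add: J_add_zero)
  show "\<exists>y\<in>gcar (J p) n. y \<otimes>\<^bsub>ggrp (J p) n\<^esub> x = \<one>\<^bsub>ggrp (J p) n\<^esub>"
    using xyz(1)
  proof (cases rule: J_cases)
    case (Eta a)
    then show ?thesis by (intro bexI[of _ "Eta (- a)"]) (auto simp: J_zero_simps J_carrier_iff Zl_uminus)
  next
    case (Zeta a)
    then show ?thesis
      by (intro bexI[of _ "Zeta_inv (cls p (- a))"]) (auto simp: J_zero_simps J_carrier_iff QpZp_add)
  next
    case (Alpha k c)
    then show ?thesis
      by (intro bexI[of _ "Alpha k ((- c) mod int p ^ alpha_exp p k)"])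
        (auto simp: J_zero_simps J_carrier_iff mod_simps)
  next
    case Null
    then show ?thesis by (intro bexI[of _ Null]) (auto simp: J_zero_simps J_carrier_iff)
  qed
qed simp

lemma J_add_zero_zero [simp]: "J_add p (J_zero p n) (J_zero p n) = J_zero p n"
  by (rule J_add_zero) simp

lemma J_mult_closed:
  assumes "x \<in> J_carrier p m" "y \<in> J_carrier p n"
  shows "J_mult p m n x y \<in> J_carrier p (m + n)"
proof -
  have "Null \<in> J_carrier p n \<Longrightarrow> J_zero p n = Null" for n by (simp add: J_carrier_iff J_zero_simps)
  then show ?thesis
    using assms by (elim J_cases)
      (auto simp: Zl_mult Zloc_act_cls Zloc_act_alpha_def J_carrier_iff simp flip: cls_def)
qed

lemma cls_mod_div: "cls p (of_int ((z mod int p ^ n) * d) / of_nat p ^ n) = cls p (of_int (z * d) / of_nat p ^ n)"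
  using cls_mod[of n "of_int d / of_nat p ^ n" z] by simp

lemma cls_residue_div:
  assumes "a \<in> Zl"
  shows "cls p (of_int (Zloc_to_Zp p a n * d) / of_nat p ^ n) = cls p (a * (of_int d / of_nat p ^ n))"
proof -
  have "of_int (Zloc_to_Zp p a n * d) / of_nat p ^ n - a * (of_int d / of_nat p ^ n)
      = of_int (- d) * ((a - of_int (Zloc_to_Zp p a n)) / of_nat p ^ n)"
    by (simp add: diff_divide_distrib algebra_simps)
  then show ?thesis using Zl_int_mult[OF Zloc_to_Zp_spec(2)[OF assms]] by (simp only: cls_eq_iff)
qed

text \<open>
  The case of two \<open>\<alpha>\<close>'s is separate: their coefficients are reduced modulo \<open>p\<^sup>e\<close> before they are divided
  by \<open>p\<^sup>e\<close>, which does not change the class of the quotient.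
\<close>

lemma J_l_distr:
  assumes "x \<in> J_carrier p m" "x' \<in> J_carrier p m" "y \<in> J_carrier p n"
  shows "J_mult p m n (J_add p x x') y = J_add p (J_mult p m n x y) (J_mult p m n x' y)"
proof -
  have Z: "Zloc_to_Zp p (a + b) k = (Zloc_to_Zp p a k + Zloc_to_Zp p b k) mod int p ^ k"
    if "a \<in> Zl" "b \<in> Zl" for a b k
    using that by (simp add: Zloc_to_Zp_add Zp_add)
  have A: "cls p (of_int (s * ((c + c') mod int p ^ k) * d) / of_nat p ^ k)
      = cls p (of_int (s * c * d) / of_nat p ^ k + of_int (s * c' * d) / of_nat p ^ k)" for s c c' d k
    using cls_mod_div[of "c + c'" k "s * d"]
    by (simp add: algebra_simps add_divide_distrib)
  show ?thesis
  proof (cases "\<exists>j c k d. x = Alpha j c \<and> y = Alpha k d")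
    case True
    then obtain j c c' k d where "x = Alpha j c" "x' = Alpha j c'" "y = Alpha k d"
      using assms(1,2) by (auto elim!: J_cases simp: null_deg_def)
    then show ?thesis using A[of "sgn j" c c' "alpha_exp p j" d] by (simp add: QpZp_add flip: cls_def)
  next
    case False
    have B: "r * ((c + c') mod k) mod k = (r * c mod k + r * c' mod k) mod k"
      "((r + r') mod k * c) mod k = (r * c mod k + r' * c mod k) mod k" for r r' c c' k :: int
      by (simp_all add: mod_simps algebra_simps)
    show ?thesis
      using assms False by (elim J_cases)
        (auto simp: distrib_left distrib_right Zloc_act_cls Zl_add QpZp_add Zloc_act_alpha_def Z B null_deg_def)
  qed
qed

lemma J_comm:
  assumes "x \<in> J_carrier p m" "y \<in> J_carrier p n"
  shows "J_mult p n m y x =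
    (if even (m * n) then J_mult p m n x y else inv\<^bsub>ggrp (J p) (m + n)\<^esub> J_mult p m n x y)"
proof -
  interpret G: comm_group "ggrp (J p) k" for k by (rule J_comm_group)
  have iz: "inv\<^bsub>ggrp (J p) k\<^esub> J_zero p k = J_zero p k" for k using G.inv_one[of k] by simp
  have ic: "inv\<^bsub>ggrp (J p) (- 2)\<^esub> Zeta_inv (cls p z) = Zeta_inv (cls p (- z))" for z
    by (rule G.inv_equality) (simp_all add: QpZp_add J_zero_simps J_carrier_iff)
  show ?thesis
    using assms
  proof (elim J_cases)
    fix j c k d
    assume *: "m = alpha_deg p j" "x = Alpha j c" "n = alpha_deg p k" "y = Alpha k d" "j \<noteq> 0" "k \<noteq> 0"
    show ?thesis
    proof (cases "j + k = 0")
      case True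
      then have k: "k = - j" by simp
      have "alpha_deg p j + alpha_deg p (- j) = - 2" by simp
      note ic' = ic[folded this]
      show ?thesis
        using * by (simp add: k alpha_exp_minus sgn_minus mult_ac ic' flip: cls_def)
    next
      case False
      then show ?thesis using * by (simp add: iz add.commute)
    qed
  qed (auto simp: mult.commute add.commute iz)
qed

lemma J_r_distr:
  assumes "x \<in> J_carrier p m" "y \<in> J_carrier p n" "y' \<in> J_carrier p n"
  shows "J_mult p m n x (J_add p y y') = J_add p (J_mult p m n x y) (J_mult p m n x y')"
proof -
  interpret G: comm_group "ggrp (J p) k" for k by (rule J_comm_group)
  have yy: "J_add p y y' \<in> J_carrier p n" using G.m_closed[of y n y'] assms by simp
  have cl: "J_mult p n m y x \<in> J_carrier p (n + m)" "J_mult p n m y' x \<in> J_carrier p (n + m)"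
    using assms J_mult_closed by auto
  have "inv\<^bsub>ggrp (J p) (n + m)\<^esub> (J_add p (J_mult p n m y x) (J_mult p n m y' x)) =
    J_add p (inv\<^bsub>ggrp (J p) (n + m)\<^esub> J_mult p n m y x) (inv\<^bsub>ggrp (J p) (n + m)\<^esub> J_mult p n m y' x)"
    using G.inv_mult[of "J_mult p n m y x" "n + m" "J_mult p n m y' x"] cl by simp
  then show ?thesis
    using J_comm[OF yy assms(1)] J_comm[OF assms(2,1)] J_comm[OF assms(3,1)] J_l_distr[OF assms(2,3,1)]
    by (simp split: if_splits)
qed

lemma J_zero_mult:
  assumes "y \<in> J_carrier p n"
  shows "J_mult p m n (J_zero p m) y = J_zero p (m + n)" "J_mult p n m y (J_zero p m) = J_zero p (n + m)"
proof -
  interpret G: comm_group "ggrp (J p) k" for k by (rule J_comm_group)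
  have idem: "z = J_zero p k" if "z \<in> J_carrier p k" "z = J_add p z z" for z k
    using that G.r_cancel_one[of z k z] by simp
  show "J_mult p m n (J_zero p m) y = J_zero p (m + n)"
    using J_l_distr[of "J_zero p m" m "J_zero p m" y n] assms by (intro idem J_mult_closed) auto
  show "J_mult p n m y (J_zero p m) = J_zero p (n + m)"
    using J_r_distr[of y n "J_zero p m" m "J_zero p m"] assms by (intro idem J_mult_closed) auto
qed

lemma J_Eta_comm: "x \<in> J_carrier p n \<Longrightarrow> J_mult p n 0 x (Eta a) = J_mult p 0 n (Eta a) x"
  by (elim J_cases) (auto simp: mult_ac)

lemma J_Eta_zero: "a \<in> Zl \<Longrightarrow> J_mult p 0 n (Eta a) (J_zero p n) = J_zero p n"
  using J_zero_mult(2)[of "Eta a" 0 n] by (simp add: J_carrier_iff)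

lemma Zloc_to_Zp_mult_nth:
  "a \<in> Zl \<Longrightarrow> b \<in> Zl \<Longrightarrow> Zloc_to_Zp p (a * b) k = (Zloc_to_Zp p a k * Zloc_to_Zp p b k) mod int p ^ k"
  by (simp add: Zloc_to_Zp_mult Zp_mult)

lemma J_Eta_assoc_l:
  assumes "a \<in> Zl" "x \<in> J_carrier p m" "y \<in> J_carrier p n"
  shows "J_mult p m n (J_mult p 0 m (Eta a) x) y = J_mult p 0 (m + n) (Eta a) (J_mult p m n x y)"
proof -
  have A: "cls p (of_int (s * (Zloc_to_Zp p a k * c mod int p ^ k) * d) / of_nat p ^ k)
      = cls p (a * (of_int (s * c * d) / of_nat p ^ k))" for s k c d
    using cls_mod_div[of "Zloc_to_Zp p a k * c" k "s * d"] cls_residue_div[OF assms(1), of k "s * c * d"]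
    by (simp add: mult_ac)
  show ?thesis
  proof (cases "\<exists>j c k d. x = Alpha j c \<and> y = Alpha k d")
    case True
    then obtain j c k d where "x = Alpha j c" "y = Alpha k d" by blast
    then show ?thesis using A assms
      by (auto simp: Zloc_act_alpha_def Zloc_act_cls J_Eta_zero simp flip: cls_def)
  next
    case False
    have B: "(r * r' mod k * c) mod k = (r * (r' * c mod k)) mod k"
      "(r' * (r * c mod k)) mod k = (r * (r' * c mod k)) mod k" for r r' c k :: int
      by (simp_all add: mod_simps mult_ac)
    show ?thesis
      using assms False by (elim J_cases)
        (auto simp: mult.assoc mult.left_commute Zloc_act_cls Zloc_act_alpha_def Zloc_to_Zp_mult_nth Zl_mult B J_Eta_zero
            J_zero_simps(4) add.commute)
  qed
qed

lemma J_Eta_assoc_r: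
  assumes "a \<in> Zl" "x \<in> J_carrier p m" "y \<in> J_carrier p n"
  shows "J_mult p m n x (J_mult p 0 n (Eta a) y) = J_mult p 0 (m + n) (Eta a) (J_mult p m n x y)"
proof -
  have A: "cls p (of_int (s * c * (Zloc_to_Zp p a k * d mod int p ^ k)) / of_nat p ^ k)
      = cls p (a * (of_int (s * c * d) / of_nat p ^ k))" for s k c d
    using cls_mod_div[of "Zloc_to_Zp p a k * d" k "s * c"] cls_residue_div[OF assms(1), of k "s * c * d"]
    by (simp add: mult_ac)
  have e: "alpha_exp p j = alpha_exp p k" if "j + k = 0" for j k
    using that alpha_exp_minus[of j] by (metis add.inverse_unique)
  show ?thesis
  proof (cases "\<exists>j c k d. x = Alpha j c \<and> y = Alpha k d")
    case True
    then obtain j c k d where "x = Alpha j c" "y = Alpha k d" by blast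
    then show ?thesis using A assms e[of j k]
      by (auto simp: Zloc_act_alpha_def Zloc_act_cls J_Eta_zero simp flip: cls_def)
  next
    case False
    have B: "(r * r' mod k * c) mod k = (r * (r' * c mod k)) mod k"
      "(r' * (r * c mod k)) mod k = (r * (r' * c mod k)) mod k" for r r' c k :: int
      by (simp_all add: mod_simps mult_ac)
    show ?thesis
      using assms False by (elim J_cases)
        (auto simp: mult.assoc mult.left_commute mult.commute[of _ a] Zloc_act_cls Zloc_act_alpha_def Zloc_to_Zp_mult_nth Zl_mult B J_Eta_zero
            J_zero_simps(4) add.commute)
  qed
qed

text \<open>
  The products \<open>\<alpha>\<^sub>j \<alpha>\<^bsub>-j\<^esub>\<close> are the only ones that may be nonzero. Therefore all products of three factors of nonzero degrees vanish, and
  associativity only has to be checked when a factor has degree \<open>0\<close>.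
\<close>

lemma J_non_Eta_mult:
  assumes "x \<in> J_carrier p l" "y \<in> J_carrier p m" "l \<noteq> 0" "m \<noteq> 0"
  shows "J_mult p l m x y = J_zero p (l + m) \<or> l + m = - 2 \<and> (\<exists>z. J_mult p l m x y = Zeta_inv (cls p z))"
  using assms by (elim J_cases) (auto simp: simp flip: cls_def)

lemma J_assoc:
  assumes "x \<in> J_carrier p l" "y \<in> J_carrier p m" "z \<in> J_carrier p n"
  shows "J_mult p (l + m) n (J_mult p l m x y) z = J_mult p l (m + n) x (J_mult p m n y z)"
proof -
  consider (x) a where "l = 0" "x = Eta a" "a \<in> Zl" | (y) a where "m = 0" "y = Eta a" "a \<in> Zl"
    | (z) a where "n = 0" "z = Eta a" "a \<in> Zl" | (n) "l \<noteq> 0" "m \<noteq> 0" "n \<noteq> 0"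
    using assms by (auto elim!: J_cases simp: null_deg_def)
  then show ?thesis
  proof cases
    case x
    then show ?thesis using J_Eta_assoc_l assms by simp
  next
    case y
    then show ?thesis using J_Eta_assoc_l J_Eta_assoc_r assms by (simp add: J_Eta_comm)
  next
    case z
    then show ?thesis using J_Eta_assoc_r assms by (simp add: J_Eta_comm J_mult_closed)
  next
    case n
    have Z: "J_mult p (- 2) k (Zeta_inv X) w = J_zero p (- 2 + k)" "J_mult p k (- 2) w (Zeta_inv X) = J_zero p (k + - 2)"
      if "w \<in> J_carrier p k" "k \<noteq> 0" for w k X
      using that by (auto elim!: J_cases)
    have 1: "J_mult p (l + m) n (J_mult p l m x y) z = J_zero p (l + m + n)"
      using J_non_Eta_mult[OF assms(1,2) n(1,2)] assms(3) n J_zero_mult Z(1) by auto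
    have 2: "J_mult p l (m + n) x (J_mult p m n y z) = J_zero p (l + (m + n))"
      using J_non_Eta_mult[OF assms(2,3) n(2,3)] assms(1) n J_zero_mult Z(2)[OF assms(1)] by auto
    show ?thesis unfolding 1 2 by (simp add: add.assoc)
  qed
qed

lemma J_one: assumes "x \<in> J_carrier p n" shows "J_mult p 0 n (Eta 1) x = x"
proof -
  have "Zloc_to_Zp p 1 k = 1 mod int p ^ k" for k
    using Zloc_to_Zp_of_int[of 1] by (simp add: Zint_def)
  then show ?thesis using assms
    by (elim J_cases) (auto simp: Zloc_act_cls Zloc_act_alpha_def J_zero_simps mod_simps)
qed

lemma J_graded_comm_ring: "graded_comm_ring (J p)"
proof -
  have "J_mult p n 0 x (Eta 1) = x" if "x \<in> J_carrier p n" for x n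
    using that by (simp add: J_Eta_comm J_one)
  moreover have "Eta 1 \<in> J_carrier p 0" by (simp add: J_carrier_iff)
  ultimately show ?thesis
    by (intro graded_comm_ring.intro J_comm_group; unfold J_simps)
      (assumption | rule J_mult_closed J_l_distr J_r_distr J_assoc J_one J_comm[unfolded J_simps])+
qed

lemma J_graded_algebra: "graded_algebra (Zloc p) (J p) Eta"
proof -
  interpret graded_comm_ring "J p" by (rule J_graded_comm_ring)
  interpret cring "Zloc p" by (rule Zloc_cring)
  show ?thesis
    by unfold_locales (auto simp: hom_def J_carrier_iff Zloc_ops)
qed

end

section \<open>Base change of graded algebras\<close>

text \<open>
  The free abelian group has the universal property by the explicit formula that also defines
  \<^const>\<open>zeta_hat\<close>; an abstract extension would have to be identified with that formula afterwards.
\<close>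

lemma (in comm_group) frag_eval_hom:
  assumes "f ` S \<subseteq> carrier G"
  shows "(\<lambda>c. finprod G (\<lambda>t. f t [^] Poly_Mapping.lookup c t) (Poly_Mapping.keys c)) \<in> hom (free_Abelian_group S) G"
    (is "?h \<in> _")
proof (rule homI)
  fix c assume "c \<in> carrier (free_Abelian_group S)"
  then show "?h c \<in> carrier G" using assms by (force intro!: finprod_closed)
next
  fix c d assume "c \<in> carrier (free_Abelian_group S)" "d \<in> carrier (free_Abelian_group S)"
  then have cd: "Poly_Mapping.keys c \<subseteq> S" "Poly_Mapping.keys d \<subseteq> S" by simp_all
  define K where "K = Poly_Mapping.keys c \<union> Poly_Mapping.keys d"
  have K: "finite K" "f t \<in> carrier G" if "t \<in> K" for t using cd assms that by (auto simp: K_def)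
  have finK: "finite K" by (simp add: K_def)
  have ext: "?h e = finprod G (\<lambda>t. f t [^] Poly_Mapping.lookup e t) K" if "Poly_Mapping.keys e \<subseteq> K" for e
    using that K(2) finK by (intro finprod_mono_neutral_cong_left) (auto simp: in_keys_iff)
  have "?h (c + d) = finprod G (\<lambda>t. f t [^] Poly_Mapping.lookup (c + d) t) K"
    by (rule ext) (use keys_add[of c d] in \<open>simp add: K_def\<close>)
  also have "\<dots> = finprod G (\<lambda>t. f t [^] Poly_Mapping.lookup c t \<otimes> f t [^] Poly_Mapping.lookup d t) K"
    using K(2) by (intro finprod_cong') (auto simp: lookup_add int_pow_mult)
  also have "\<dots> = ?h c \<otimes> ?h d"
    using K(2) by (subst (1 2) ext) (auto simp: K_def intro!: finprod_multf)
  finally show "?h (c \<otimes>\<^bsub>free_Abelian_group S\<^esub> d) = ?h c \<otimes> ?h d" by simp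
qed

lemma (in comm_group) frag_eval_of:
  "f t \<in> carrier G \<Longrightarrow> finprod G (\<lambda>s. f s [^] Poly_Mapping.lookup (frag_of t) s) (Poly_Mapping.keys (frag_of t)) = f t"
  by (simp add: finprod_singleton)

lemma frag_cmul_diff: "frag_cmul c (a - b) = frag_cmul c a - frag_cmul c b"
  by (rule poly_mapping_eqI) (simp add: lookup_minus algebra_simps)

lemma frag_extend_fun_diff: "frag_extend (\<lambda>t. g t - h t) c = frag_extend g c - frag_extend h c"
  by (simp add: frag_extend_def frag_cmul_diff sum_subtractf)

lemma tensor_frag_mult_diff_l:
  "tensor_frag_mult B R m n (f - f') g = tensor_frag_mult B R m n f g - tensor_frag_mult B R m n f' g"
  by (simp add: tensor_frag_mult_def frag_extend_diff)

lemma tensor_frag_mult_diff_r: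
  "tensor_frag_mult B R m n f (g - g') = tensor_frag_mult B R m n f g - tensor_frag_mult B R m n f g'"
  by (simp add: tensor_frag_mult_def frag_extend_diff frag_extend_fun_diff split_def)

lemma tensor_frag_mult_0 [simp]: "tensor_frag_mult B R m n 0 g = 0" "tensor_frag_mult B R m n f 0 = 0"
  using tensor_frag_mult_diff_l[of B R m n 0 0 g] tensor_frag_mult_diff_r[of B R m n f 0 0] by simp_all

lemma tensor_frag_mult_uminus:
  "tensor_frag_mult B R m n (- f) g = - tensor_frag_mult B R m n f g"
  "tensor_frag_mult B R m n f (- g) = - tensor_frag_mult B R m n f g"
  using tensor_frag_mult_diff_l[of B R m n 0 f g] tensor_frag_mult_diff_r[of B R m n f 0 g] by simp_all

lemma tensor_frag_mult_add:
  "tensor_frag_mult B R m n (f + f') g = tensor_frag_mult B R m n f g + tensor_frag_mult B R m n f' g"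
  "tensor_frag_mult B R m n f (g + g') = tensor_frag_mult B R m n f g + tensor_frag_mult B R m n f g'"
  using tensor_frag_mult_diff_l[of B R m n f "- f'" g] tensor_frag_mult_diff_r[of B R m n f g "- g'"]
  by (simp_all add: tensor_frag_mult_uminus)

lemma tensor_frag_mult_of:
  "tensor_frag_mult B R m n (frag_of (b, x)) (frag_of (c, y)) = frag_of (b \<otimes>\<^bsub>B\<^esub> c, gmult R m n x y)"
  by (simp add: tensor_frag_mult_def)

context graded_algebra
begin

sublocale G: comm_group "ggrp R n" for n by (rule R.comm_group)

lemma unit_closed: "a \<in> carrier A \<Longrightarrow> u a \<in> gcar R 0"
  using unit_hom by (auto simp: hom_def)

lemma unit_comm: "a \<in> carrier A \<Longrightarrow> x \<in> gcar R n \<Longrightarrow> gmult R n 0 x (u a) = gmult R 0 n (u a) x"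
  using R.graded_comm[of "u a" 0 x n] unit_closed by simp

end

locale algebra_base_change = graded_algebra A R u + B: cring B
  for A :: "'c ring" and R :: "'a gring" and u :: "'c \<Rightarrow> 'a" and B :: "'b ring" +
  fixes i :: "'c \<Rightarrow> 'b"
  assumes i_hom: "i \<in> ring_hom A B"
begin

abbreviation "F \<equiv> tensor_free B R"
abbreviation "Q \<equiv> tensor_rel A B i R u"
abbreviation "T \<equiv> base_change A B i R u"
abbreviation "M \<equiv> tensor_frag_mult B R"
abbreviation "tcls n f \<equiv> Q n #>\<^bsub>F n\<^esub> f"
abbreviation "pt \<equiv> pure_tensor A B i R u"

lemma i_closed: "a \<in> carrier A \<Longrightarrow> i a \<in> carrier B"
  using i_hom by (rule ring_hom_closed)

lemma act_closed: "a \<in> carrier A \<Longrightarrow> x \<in> gcar R n \<Longrightarrow> gmult R 0 n (u a) x \<in> gcar R n"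
  using R.mult_closed[of "u a" 0 x n] unit_closed by simp

lemma F_simps [simp]:
  "f \<in> carrier (F n) \<longleftrightarrow> Poly_Mapping.keys f \<subseteq> carrier B \<times> gcar R n"
  "f \<otimes>\<^bsub>F n\<^esub> g = f + g" "\<one>\<^bsub>F n\<^esub> = 0"
  by (simp_all add: tensor_free_def)

lemma F_comm_group: "comm_group (F n)"
  by (simp add: tensor_free_def abelian_free_Abelian_group)

sublocale F: comm_group "F n" for n by (rule F_comm_group)

lemma F_inv [simp]: "f \<in> carrier (F n) \<Longrightarrow> inv\<^bsub>F n\<^esub> f = - f"
  by (simp add: tensor_free_def)

lemma F_induct [consumes 1, case_names zero diff of]:
  assumes "f \<in> carrier (F n)" "P 0"
    "\<And>f g. f \<in> carrier (F n) \<Longrightarrow> g \<in> carrier (F n) \<Longrightarrow> P f \<Longrightarrow> P g \<Longrightarrow> P (f - g)"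
    "\<And>b x. b \<in> carrier B \<Longrightarrow> x \<in> gcar R n \<Longrightarrow> P (frag_of (b, x))"
  shows "P f"
  by (rule free_Abelian_group_induct[of f "carrier B \<times> gcar R n"]) (use assms in auto)

definition rels :: "int \<Rightarrow> ('b \<times> 'a \<Rightarrow>\<^sub>0 int) set" where
  "rels n = {frag_of (b \<oplus>\<^bsub>B\<^esub> b', x) - frag_of (b, x) - frag_of (b', x) | b b' x.
        b \<in> carrier B \<and> b' \<in> carrier B \<and> x \<in> gcar R n} \<union>
     {frag_of (b, x \<otimes>\<^bsub>ggrp R n\<^esub> x') - frag_of (b, x) - frag_of (b, x') | b x x'.
        b \<in> carrier B \<and> x \<in> gcar R n \<and> x' \<in> gcar R n} \<union>
     {frag_of (b \<otimes>\<^bsub>B\<^esub> i a, x) - frag_of (b, gmult R 0 n (u a) x) | a b x.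
        a \<in> carrier A \<and> b \<in> carrier B \<and> x \<in> gcar R n}"

lemma Q_eq: "Q n = generate (F n) (rels n)"
  by (simp add: tensor_rel_def rels_def)

lemma F_closed [intro]:
  "f \<in> carrier (F n) \<Longrightarrow> g \<in> carrier (F n) \<Longrightarrow> f - g \<in> carrier (F n)"
  "f \<in> carrier (F n) \<Longrightarrow> g \<in> carrier (F n) \<Longrightarrow> f + g \<in> carrier (F n)"
  "b \<in> carrier B \<Longrightarrow> x \<in> gcar R n \<Longrightarrow> frag_of (b, x) \<in> carrier (F n)"
  "f \<in> carrier (F n) \<Longrightarrow> - f \<in> carrier (F n)"
  "0 \<in> carrier (F n)"
  using keys_diff[of f g] keys_add[of f g] by auto

lemma rels_cases [consumes 1, case_names add_l add_r balance]:
  assumes "r \<in> rels n"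
  obtains b b' x where "b \<in> carrier B" "b' \<in> carrier B" "x \<in> gcar R n"
      "r = frag_of (b \<oplus>\<^bsub>B\<^esub> b', x) - frag_of (b, x) - frag_of (b', x)"
    | b x x' where "b \<in> carrier B" "x \<in> gcar R n" "x' \<in> gcar R n"
      "r = frag_of (b, x \<otimes>\<^bsub>ggrp R n\<^esub> x') - frag_of (b, x) - frag_of (b, x')"
    | a b x where "a \<in> carrier A" "b \<in> carrier B" "x \<in> gcar R n"
      "r = frag_of (b \<otimes>\<^bsub>B\<^esub> i a, x) - frag_of (b, gmult R 0 n (u a) x)"
  using assms unfolding rels_def by (elim UnE CollectE exE conjE) (rule that, assumption+)+

lemma rels_subset: "rels n \<subseteq> carrier (F n)"
proof
  fix r assume "r \<in> rels n"
  then show "r \<in> carrier (F n)"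
    by (cases rule: rels_cases) (auto intro!: F_closed(1,3) act_closed i_closed simp del: F_simps)
qed

lemma Q_subgroup: "subgroup (Q n) (F n)"
  unfolding Q_eq using rels_subset by (rule F.generate_is_subgroup)

lemma Q_normal: "Q n \<lhd> F n"
  using Q_subgroup F.normal_iff_subgroup by blast

lemma Q_subset: "f \<in> Q n \<Longrightarrow> f \<in> carrier (F n)"
  using subgroup.subset[OF Q_subgroup] by blast

lemma Q_0 [simp]: "0 \<in> Q n"
  using subgroup.one_closed[OF Q_subgroup, of n] by simp

lemma Q_add: "f \<in> Q n \<Longrightarrow> g \<in> Q n \<Longrightarrow> f + g \<in> Q n"
  using subgroup.m_closed[OF Q_subgroup, of f n g] by simp

lemma Q_uminus: "f \<in> Q n \<Longrightarrow> - f \<in> Q n"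
  using subgroup.m_inv_closed[OF Q_subgroup, of f n] Q_subset by (simp del: F_simps)

lemma Q_diff: "f \<in> Q n \<Longrightarrow> g \<in> Q n \<Longrightarrow> f - g \<in> Q n"
  using Q_add[of f n "- g"] Q_uminus by simp

lemma Q_rels: "f \<in> rels n \<Longrightarrow> f \<in> Q n"
  unfolding Q_eq by (rule generate.incl)

lemma Q_induct [consumes 1, case_names rel diff]:
  assumes "q \<in> Q n" "\<And>r. r \<in> rels n \<Longrightarrow> P r" "P 0"
    "\<And>q q'. P q \<Longrightarrow> P q' \<Longrightarrow> P (q - q')"
  shows "P q"
  using assms(1) unfolding Q_eq
proof (induction q rule: generate.induct)
  case one
  then show ?case using assms(3) by simp
next
  case (incl h)
  then show ?case by (rule assms(2))
next
  case (inv h)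
  then have "h \<in> carrier (F n)" using rels_subset by blast
  then show ?case using assms(4)[OF assms(3) assms(2)[OF inv]] by simp
next
  case (eng h1 h2)
  have "P (h1 - (0 - h2))" using eng by (intro assms(4) assms(3))
  then show ?case by simp
qed

lemma mem_tcls: "g \<in> tcls n f \<longleftrightarrow> g - f \<in> Q n"
proof -
  have "(\<exists>h\<in>Q n. g = h + f) \<longleftrightarrow> g - f \<in> Q n"
    by (metis add_diff_cancel diff_add_cancel)
  then show ?thesis by (simp add: r_coset_def)
qed

lemma tcls_eq_iff: "tcls n f = tcls n g \<longleftrightarrow> f - g \<in> Q n"
proof
  assume "tcls n f = tcls n g"
  moreover have "f \<in> tcls n f" by (simp add: mem_tcls)
  ultimately show "f - g \<in> Q n" by (metis mem_tcls)
next
  assume *: "f - g \<in> Q n"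
  have "h - f \<in> Q n \<longleftrightarrow> h - g \<in> Q n" for h
    using Q_add[OF _ *, of "h - f"] Q_diff[OF _ *, of "h - g"] by auto
  then show "tcls n f = tcls n g" by (auto simp: mem_tcls)
qed

lemma T_carrier: "gcar T n = tcls n ` carrier (F n)"
  by (simp add: base_change_def carrier_FactGroup)

lemma T_closed: "f \<in> carrier (F n) \<Longrightarrow> tcls n f \<in> gcar T n"
  unfolding T_carrier by blast

lemma T_E: assumes "X \<in> gcar T n" obtains f where "f \<in> carrier (F n)" "X = tcls n f"
  using assms unfolding T_carrier by blast

lemma T_one: "\<one>\<^bsub>ggrp T n\<^esub> = tcls n 0"
  using Q_subset[of _ n] by (auto simp: base_change_def mem_tcls)

lemma T_add: "f \<in> carrier (F n) \<Longrightarrow> g \<in> carrier (F n) \<Longrightarrow> tcls n f \<otimes>\<^bsub>ggrp T n\<^esub> tcls n g = tcls n (f + g)"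
  using normal.rcos_sum[OF Q_normal, of f n g] by (simp add: base_change_def)

lemma T_comm_group: "comm_group (ggrp T n)"
  using F.abelian_FactGroup[OF Q_subgroup, of n] by (simp add: base_change_def)

sublocale T: comm_group "ggrp T n" for n by (rule T_comm_group)

lemma T_inv: "f \<in> carrier (F n) \<Longrightarrow> inv\<^bsub>ggrp T n\<^esub> tcls n f = tcls n (- f)"
  using T_add[of "- f" n f] F_closed(4)[of f n]
  by (intro T.inv_equality) (auto simp: T_one T_closed simp del: F_simps)

lemma M_closed: "f \<in> carrier (F m) \<Longrightarrow> g \<in> carrier (F n) \<Longrightarrow> M m n f g \<in> carrier (F (m + n))"
proof (induction f rule: F_induct)
  case (of b x)
  from of(3) show ?case
  proof (induction g rule: F_induct)
    case (of c y)
    then show ?case using \<open>b \<in> carrier B\<close> \<open>x \<in> gcar R m\<close>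
      by (simp add: tensor_frag_mult_of R.mult_closed)
  qed (auto simp: tensor_frag_mult_diff_r simp del: F_simps)
qed (auto simp: tensor_frag_mult_diff_l simp del: F_simps)

text \<open>
  The product of a defining relation with a pure tensor is again a defining relation. So the relations
  form an ideal, on this side and in the next lemma on the other, and the product descends to classes.
\<close>

lemma M_Q_l: "q \<in> Q m \<Longrightarrow> g \<in> carrier (F n) \<Longrightarrow> M m n q g \<in> Q (m + n)"
proof (induction q rule: Q_induct)
  case (rel r)
  from rel(2) show ?case
  proof (induction g rule: F_induct)
    case (of c y)
    note cl = of R.mult_closed
    from rel(1) have "M m n r (frag_of (c, y)) \<in> rels (m + n)"
    proof (cases rule: rels_cases)
      case (add_l b b' x)
      then show ?thesis unfolding rels_def using cl
        by (intro UnI1 CollectI exI[of _ "b \<otimes>\<^bsub>B\<^esub> c"] exI[of _ "b' \<otimes>\<^bsub>B\<^esub> c"] exI[of _ "gmult R m n x y"])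
          (simp add: tensor_frag_mult_diff_l tensor_frag_mult_of B.l_distr)
    next
      case (add_r b x x')
      then show ?thesis unfolding rels_def using cl
        by (intro UnI1 UnI2 CollectI exI[of _ "b \<otimes>\<^bsub>B\<^esub> c"] exI[of _ "gmult R m n x y"] exI[of _ "gmult R m n x' y"])
          (simp add: tensor_frag_mult_diff_l tensor_frag_mult_of R.l_distr)
    next
      case (balance a b x)
      moreover have "(b \<otimes>\<^bsub>B\<^esub> i a) \<otimes>\<^bsub>B\<^esub> c = (b \<otimes>\<^bsub>B\<^esub> c) \<otimes>\<^bsub>B\<^esub> i a"
        using balance of(1) i_closed by (simp add: B.m_ac)
      moreover have "gmult R m n (gmult R 0 m (u a) x) y = gmult R 0 (m + n) (u a) (gmult R m n x y)"
        using R.assoc[of "u a" 0 x m y n] balance of unit_closed by simp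
      ultimately show ?thesis unfolding rels_def using cl
        by (intro UnI2 CollectI exI[of _ a] exI[of _ "b \<otimes>\<^bsub>B\<^esub> c"] exI[of _ "gmult R m n x y"])
          (simp add: tensor_frag_mult_diff_l tensor_frag_mult_of)
    qed
    then show ?case by (rule Q_rels)
  qed (auto simp: tensor_frag_mult_diff_r Q_diff)
qed (auto simp: tensor_frag_mult_diff_l Q_diff)

lemma M_Q_r: "q \<in> Q n \<Longrightarrow> f \<in> carrier (F m) \<Longrightarrow> M m n f q \<in> Q (m + n)"
proof (induction q rule: Q_induct)
  case (rel r)
  from rel(2) show ?case
  proof (induction f rule: F_induct)
    case (of c y)
    note cl = of R.mult_closed
    from rel(1) have "M m n (frag_of (c, y)) r \<in> rels (m + n)"
    proof (cases rule: rels_cases)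
      case (add_l b b' x)
      then show ?thesis unfolding rels_def using cl
        by (intro UnI1 CollectI exI[of _ "c \<otimes>\<^bsub>B\<^esub> b"] exI[of _ "c \<otimes>\<^bsub>B\<^esub> b'"] exI[of _ "gmult R m n y x"])
          (simp add: tensor_frag_mult_diff_r tensor_frag_mult_of B.r_distr)
    next
      case (add_r b x x')
      then show ?thesis unfolding rels_def using cl
        by (intro UnI1 UnI2 CollectI exI[of _ "c \<otimes>\<^bsub>B\<^esub> b"] exI[of _ "gmult R m n y x"] exI[of _ "gmult R m n y x'"])
          (simp add: tensor_frag_mult_diff_r tensor_frag_mult_of R.r_distr)
    next
      case (balance a b x)
      moreover have "c \<otimes>\<^bsub>B\<^esub> (b \<otimes>\<^bsub>B\<^esub> i a) = (c \<otimes>\<^bsub>B\<^esub> b) \<otimes>\<^bsub>B\<^esub> i a"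
        using balance of(1) i_closed by (simp add: B.m_ac)
      moreover have "gmult R m n y (gmult R 0 n (u a) x) = gmult R 0 (m + n) (u a) (gmult R m n y x)"
        using R.assoc[of y m "u a" 0 x n] R.assoc[of "u a" 0 y m x n] balance of unit_closed
        by (simp add: unit_comm)
      ultimately show ?thesis unfolding rels_def using cl
        by (intro UnI2 CollectI exI[of _ a] exI[of _ "c \<otimes>\<^bsub>B\<^esub> b"] exI[of _ "gmult R m n y x"])
          (simp add: tensor_frag_mult_diff_r tensor_frag_mult_of)
    qed
    then show ?case by (rule Q_rels)
  qed (auto simp: tensor_frag_mult_diff_l Q_diff)
qed (auto simp: tensor_frag_mult_diff_r Q_diff)

lemma T_mult:
  assumes "f \<in> carrier (F m)" "g \<in> carrier (F n)"
  shows "gmult T m n (tcls m f) (tcls n g) = tcls (m + n) (M m n f g)"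
proof -
  have "tcls (m + n) (M m n f' g') = tcls (m + n) (M m n f g)" if "f' \<in> tcls m f" "g' \<in> tcls n g" for f' g'
  proof -
    have q: "f' - f \<in> Q m" "g' - g \<in> Q n" using that by (simp_all add: mem_tcls)
    then have "g' - g + g \<in> carrier (F n)" using F_closed(2) Q_subset assms(2) by blast
    then have g': "g' \<in> carrier (F n)" by (simp del: F_simps)
    have "M m n f' g' - M m n f g = M m n (f' - f) g' + M m n f (g' - g)"
      by (simp add: tensor_frag_mult_diff_l tensor_frag_mult_diff_r)
    also have "\<dots> \<in> Q (m + n)" using Q_add[OF M_Q_l[OF q(1) g'] M_Q_r[OF q(2) assms(1)]] .
    finally show ?thesis by (simp only: tcls_eq_iff)
  qed
  moreover have "f \<in> tcls m f" "g \<in> tcls n g" by (simp_all add: mem_tcls)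
  ultimately have "(\<Union>f'\<in>tcls m f. \<Union>g'\<in>tcls n g. tcls (m + n) (M m n f' g')) = tcls (m + n) (M m n f g)"
    by blast
  then show ?thesis by (simp add: base_change_def)
qed

lemma M_assoc:
  assumes "f \<in> carrier (F l)" "g \<in> carrier (F m)" "h \<in> carrier (F n)"
  shows "M (l + m) n (M l m f g) h = M l (m + n) f (M m n g h)"
  using assms
proof (induction f rule: F_induct)
  case (of b x)
  note bx = of(1,2)
  from of(3,4) show ?case
  proof (induction g rule: F_induct)
    case (of c y)
    note cy = of(1,2)
    from of(3) show ?case
    proof (induction h rule: F_induct)
      case (of d z)
      then show ?case using bx cy by (simp add: tensor_frag_mult_of B.m_assoc R.assoc)
    qed (auto simp: tensor_frag_mult_diff_r)
  qed (auto simp: tensor_frag_mult_diff_r tensor_frag_mult_diff_l)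
qed (auto simp: tensor_frag_mult_diff_l)

text \<open>
  The relation for \<open>b \<otimes> (0 + 0)\<close> is \<open>- (b \<otimes> 0)\<close>.
\<close>

lemma Q_frag_of_one: assumes "b \<in> carrier B" shows "frag_of (b, \<one>\<^bsub>ggrp R n\<^esub>) \<in> Q n"
proof -
  have "frag_of (b, \<one>\<^bsub>ggrp R n\<^esub> \<otimes>\<^bsub>ggrp R n\<^esub> \<one>\<^bsub>ggrp R n\<^esub>) - frag_of (b, \<one>\<^bsub>ggrp R n\<^esub>) - frag_of (b, \<one>\<^bsub>ggrp R n\<^esub>) \<in> rels n"
    unfolding rels_def using assms by blast
  from Q_uminus[OF Q_rels[OF this]] show ?thesis by simp
qed

text \<open>
  In odd degrees \<open>y x = - x y\<close> holds in \<open>R\<close>, and \<open>b \<otimes> (- x y)\<close> is \<open>- (b \<otimes> x y)\<close> only modulo the relations.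
\<close>

lemma M_comm:
  assumes "f \<in> carrier (F m)" "g \<in> carrier (F n)"
  shows "(if even (m * n) then M n m g f - M m n f g else M n m g f + M m n f g) \<in> Q (m + n)"
    (is "?E f g \<in> _")
proof -
  have E_diff: "?E (f - f') g = ?E f g - ?E f' g" "?E f (g - g') = ?E f g - ?E f g'" for f f' g g'
    by (simp_all add: tensor_frag_mult_diff_l tensor_frag_mult_diff_r)
  show ?thesis
    using assms
  proof (induction f rule: F_induct)
    case (of b x)
    note bx = of(1,2)
    from of(3) show ?case
    proof (induction g rule: F_induct)
      case (of c y)
      have bc: "c \<otimes>\<^bsub>B\<^esub> b = b \<otimes>\<^bsub>B\<^esub> c" using of bx by (simp add: B.m_comm)
      show ?case
      proof (cases "even (m * n)")
        case True
        then show ?thesis using R.graded_comm[OF bx(2) of(2)] by (simp add: tensor_frag_mult_of bc)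
      next
        case False
        let ?z = "gmult R m n x y" and ?b = "b \<otimes>\<^bsub>B\<^esub> c"
        have z: "?z \<in> gcar R (m + n)" "?b \<in> carrier B" using R.mult_closed bx of by auto
        have "frag_of (?b, inv\<^bsub>ggrp R (m + n)\<^esub> ?z \<otimes>\<^bsub>ggrp R (m + n)\<^esub> ?z)
            - frag_of (?b, inv\<^bsub>ggrp R (m + n)\<^esub> ?z) - frag_of (?b, ?z) \<in> rels (m + n)"
          unfolding rels_def using z by blast
        from Q_diff[OF Q_frag_of_one[OF z(2)] Q_rels[OF this]]
        have "frag_of (?b, inv\<^bsub>ggrp R (m + n)\<^esub> ?z) + frag_of (?b, ?z) \<in> Q (m + n)"
          using z by (simp add: add.commute)
        then show ?thesis using False R.graded_comm[OF bx(2) of(2)] by (simp add: tensor_frag_mult_of bc add.commute)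
      qed
    next
      case (diff g g')
      then show ?case using E_diff(2) Q_diff by presburger
    qed simp
  next
    case (diff f f')
    then show ?case using E_diff(1) Q_diff by presburger
  qed simp
qed

lemma M_one:
  assumes "f \<in> carrier (F n)"
  shows "M 0 n (frag_of (\<one>\<^bsub>B\<^esub>, gone R)) f = f" "M n 0 f (frag_of (\<one>\<^bsub>B\<^esub>, gone R)) = f"
  using assms by (induction f rule: F_induct)
    (auto simp: tensor_frag_mult_diff_l tensor_frag_mult_diff_r tensor_frag_mult_of R.l_one R.r_one)

lemma T_gone: "gone T = tcls 0 (frag_of (\<one>\<^bsub>B\<^esub>, gone R))"
  by (simp add: base_change_def pure_tensor_def)

lemma gone_frag: "frag_of (\<one>\<^bsub>B\<^esub>, gone R) \<in> carrier (F 0)"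
  using R.one_closed by simp

lemma T_graded_comm_ring: "graded_comm_ring T"
proof (rule graded_comm_ring.intro)
  show "comm_group (ggrp T n)" for n by (rule T_comm_group)
  show "gone T \<in> gcar T 0" unfolding T_gone using T_closed gone_frag by blast
  fix l m n
  fix X Y Z
  {
    assume "X \<in> gcar T m" "Y \<in> gcar T n"
    then obtain f g where *: "f \<in> carrier (F m)" "X = tcls m f" "g \<in> carrier (F n)" "Y = tcls n g"
      by (metis T_E)
    show "gmult T m n X Y \<in> gcar T (m + n)"
      using * M_closed by (simp add: T_mult T_closed del: F_simps)
    have mn: "n + m = m + n" by simp
    show "gmult T n m Y X = (if even (m * n) then gmult T m n X Y else inv\<^bsub>ggrp T (m + n)\<^esub> gmult T m n X Y)"
      using * M_comm[OF *(1,3)] M_closed[OF *(1,3)]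
      by (auto simp: T_mult T_inv mn tcls_eq_iff simp del: F_simps split: if_splits)
  }
  {
    assume "X \<in> gcar T m" "Y \<in> gcar T m" "Z \<in> gcar T n"
    then obtain f g h where *: "f \<in> carrier (F m)" "X = tcls m f" "g \<in> carrier (F m)" "Y = tcls m g"
      "h \<in> carrier (F n)" "Z = tcls n h" by (metis T_E)
    then show "gmult T m n (X \<otimes>\<^bsub>ggrp T m\<^esub> Y) Z = gmult T m n X Z \<otimes>\<^bsub>ggrp T (m + n)\<^esub> gmult T m n Y Z"
      using F_closed(2) by (simp add: T_mult T_add M_closed tensor_frag_mult_add del: F_simps)
  }
  {
    assume "X \<in> gcar T m" "Y \<in> gcar T n" "Z \<in> gcar T n"
    then obtain f g h where *: "f \<in> carrier (F m)" "X = tcls m f" "g \<in> carrier (F n)" "Y = tcls n g"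
      "h \<in> carrier (F n)" "Z = tcls n h" by (metis T_E)
    then show "gmult T m n X (Y \<otimes>\<^bsub>ggrp T n\<^esub> Z) = gmult T m n X Y \<otimes>\<^bsub>ggrp T (m + n)\<^esub> gmult T m n X Z"
      using F_closed(2) by (simp add: T_mult T_add M_closed tensor_frag_mult_add del: F_simps)
  }
  {
    assume "X \<in> gcar T l" "Y \<in> gcar T m" "Z \<in> gcar T n"
    then obtain f g h where *: "f \<in> carrier (F l)" "X = tcls l f" "g \<in> carrier (F m)" "Y = tcls m g"
      "h \<in> carrier (F n)" "Z = tcls n h" by (metis T_E)
    then show "gmult T (l + m) n (gmult T l m X Y) Z = gmult T l (m + n) X (gmult T m n Y Z)"
      by (simp add: T_mult M_closed M_assoc add.assoc del: F_simps)
  }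
  {
    assume "X \<in> gcar T n"
    then obtain f where *: "f \<in> carrier (F n)" "X = tcls n f" by (metis T_E)
    show "gmult T 0 n (gone T) X = X"
      using * T_mult[OF gone_frag *(1)] M_one[OF *(1)] by (simp add: T_gone)
    show "gmult T n 0 X (gone T) = X"
      using * T_mult[OF *(1) gone_frag] M_one[OF *(1)] by (simp add: T_gone)
  }
qed

subsection \<open>Pure tensors\<close>

lemma pt_closed: "b \<in> carrier B \<Longrightarrow> x \<in> gcar R n \<Longrightarrow> pt n b x \<in> gcar T n"
  unfolding pure_tensor_def by (intro T_closed F_closed(3))

lemma pt_add_l:
  assumes "b \<in> carrier B" "b' \<in> carrier B" "x \<in> gcar R n"
  shows "pt n (b \<oplus>\<^bsub>B\<^esub> b') x = pt n b x \<otimes>\<^bsub>ggrp T n\<^esub> pt n b' x"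
proof -
  have "frag_of (b \<oplus>\<^bsub>B\<^esub> b', x) - frag_of (b, x) - frag_of (b', x) \<in> rels n"
    unfolding rels_def using assms by blast
  then show ?thesis using assms Q_rels
    by (simp add: pure_tensor_def T_add tcls_eq_iff diff_diff_eq)
qed

lemma pt_add_r:
  assumes "b \<in> carrier B" "x \<in> gcar R n" "x' \<in> gcar R n"
  shows "pt n b (x \<otimes>\<^bsub>ggrp R n\<^esub> x') = pt n b x \<otimes>\<^bsub>ggrp T n\<^esub> pt n b x'"
proof -
  have "frag_of (b, x \<otimes>\<^bsub>ggrp R n\<^esub> x') - frag_of (b, x) - frag_of (b, x') \<in> rels n"
    unfolding rels_def using assms by blast
  then show ?thesis using assms Q_rels
    by (simp add: pure_tensor_def T_add tcls_eq_iff diff_diff_eq)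
qed

lemma pt_balanced:
  assumes "a \<in> carrier A" "b \<in> carrier B" "x \<in> gcar R n"
  shows "pt n (b \<otimes>\<^bsub>B\<^esub> i a) x = pt n b (gmult R 0 n (u a) x)"
proof -
  have "frag_of (b \<otimes>\<^bsub>B\<^esub> i a, x) - frag_of (b, gmult R 0 n (u a) x) \<in> rels n"
    unfolding rels_def using assms by blast
  then show ?thesis using Q_rels by (simp add: pure_tensor_def tcls_eq_iff)
qed

lemma pt_mult:
  assumes "b \<in> carrier B" "x \<in> gcar R m" "c \<in> carrier B" "y \<in> gcar R n"
  shows "gmult T m n (pt m b x) (pt n c y) = pt (m + n) (b \<otimes>\<^bsub>B\<^esub> c) (gmult R m n x y)"
  using assms by (simp add: pure_tensor_def T_mult tensor_frag_mult_of)

lemma T_induct [consumes 1, case_names pure diff]: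
  assumes "X \<in> gcar T n"
    "\<And>b x. b \<in> carrier B \<Longrightarrow> x \<in> gcar R n \<Longrightarrow> P (pt n b x)"
    "\<And>X Y. X \<in> gcar T n \<Longrightarrow> Y \<in> gcar T n \<Longrightarrow> P X \<Longrightarrow> P Y \<Longrightarrow> P (X \<otimes>\<^bsub>ggrp T n\<^esub> inv\<^bsub>ggrp T n\<^esub> Y)"
  shows "P X"
proof -
  obtain f where f: "f \<in> carrier (F n)" "X = tcls n f" using assms(1) by (rule T_E)
  from f(1) have "P (tcls n f)"
  proof (induction f rule: F_induct)
    case zero
    have "P (pt n \<zero>\<^bsub>B\<^esub> \<one>\<^bsub>ggrp R n\<^esub>)" by (rule assms(2)) auto
    moreover have "pt n \<zero>\<^bsub>B\<^esub> \<one>\<^bsub>ggrp R n\<^esub> = tcls n 0"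
      using Q_frag_of_one by (simp add: pure_tensor_def tcls_eq_iff)
    ultimately show ?case by simp
  next
    case (diff f g)
    have "P (tcls n f \<otimes>\<^bsub>ggrp T n\<^esub> inv\<^bsub>ggrp T n\<^esub> tcls n g)"
      using diff T_closed by (intro assms(3)) auto
    also have "tcls n f \<otimes>\<^bsub>ggrp T n\<^esub> inv\<^bsub>ggrp T n\<^esub> tcls n g = tcls n (f - g)"
      using diff F_closed(4) by (simp add: T_inv T_add del: F_simps)
    finally show ?case .
  next
    case (of b x)
    then show ?case using assms(2) by (simp add: pure_tensor_def)
  qed
  then show ?thesis using f by simp
qed

text \<open>
  The universal property of the tensor product. The induced map is given by evaluation at the
  representatives of a class, because that is the form of \<^const>\<open>zeta_hat\<close>.
\<close>

lemma T_universal: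
  assumes "comm_group G"
    and cl: "\<And>b x. b \<in> carrier B \<Longrightarrow> x \<in> gcar R n \<Longrightarrow> \<phi> (b, x) \<in> carrier G"
    and al: "\<And>b b' x. b \<in> carrier B \<Longrightarrow> b' \<in> carrier B \<Longrightarrow> x \<in> gcar R n \<Longrightarrow>
      \<phi> (b \<oplus>\<^bsub>B\<^esub> b', x) = \<phi> (b, x) \<otimes>\<^bsub>G\<^esub> \<phi> (b', x)"
    and ar: "\<And>b x x'. b \<in> carrier B \<Longrightarrow> x \<in> gcar R n \<Longrightarrow> x' \<in> gcar R n \<Longrightarrow>
      \<phi> (b, x \<otimes>\<^bsub>ggrp R n\<^esub> x') = \<phi> (b, x) \<otimes>\<^bsub>G\<^esub> \<phi> (b, x')"
    and bal: "\<And>a b x. a \<in> carrier A \<Longrightarrow> b \<in> carrier B \<Longrightarrow> x \<in> gcar R n \<Longrightarrow>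
      \<phi> (b \<otimes>\<^bsub>B\<^esub> i a, x) = \<phi> (b, gmult R 0 n (u a) x)"
  defines "h \<equiv> \<lambda>f. finprod G (\<lambda>t. \<phi> t [^]\<^bsub>G\<^esub> Poly_Mapping.lookup f t) (Poly_Mapping.keys f)"
  defines "\<Phi> \<equiv> \<lambda>X. the_elem (h ` X)"
  shows "\<Phi> \<in> hom (ggrp T n) G" "\<And>b x. b \<in> carrier B \<Longrightarrow> x \<in> gcar R n \<Longrightarrow> \<Phi> (pt n b x) = \<phi> (b, x)"
proof -
  interpret H: comm_group G by fact
  have im: "\<phi> ` (carrier B \<times> gcar R n) \<subseteq> carrier G" using cl by auto
  have hh: "h \<in> hom (F n) G" unfolding h_def tensor_free_def by (rule H.frag_eval_hom[OF im])
  interpret h: group_hom "F n" G h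
    by (intro group_hom.intro group_hom_axioms.intro F.is_group H.is_group hh)
  have h_of: "h (frag_of (b, x)) = \<phi> (b, x)" if "b \<in> carrier B" "x \<in> gcar R n" for b x
    unfolding h_def by (rule H.frag_eval_of) (rule cl[OF that])
  have h_diff: "h (f - g) = h f \<otimes>\<^bsub>G\<^esub> inv\<^bsub>G\<^esub> h g" if "f \<in> carrier (F n)" "g \<in> carrier (F n)" for f g
    using h.hom_mult[of f "- g"] h.hom_inv[of g] that F_closed(4) by (simp del: F_simps add: F_simps(2,3))
  have rel: "h r = \<one>\<^bsub>G\<^esub>" if "r \<in> rels n" for r
    using that
  proof (cases rule: rels_cases)
    case (add_l b b' x)
    then have "h r = (\<phi> (b, x) \<otimes>\<^bsub>G\<^esub> \<phi> (b', x)) \<otimes>\<^bsub>G\<^esub> inv\<^bsub>G\<^esub> \<phi> (b, x) \<otimes>\<^bsub>G\<^esub> inv\<^bsub>G\<^esub> \<phi> (b', x)"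
      by (simp add: h_diff h_of al F_closed del: F_simps)
    then show ?thesis using cl add_l by (simp add: H.m_ac)
  next
    case (add_r b x x')
    then have "h r = (\<phi> (b, x) \<otimes>\<^bsub>G\<^esub> \<phi> (b, x')) \<otimes>\<^bsub>G\<^esub> inv\<^bsub>G\<^esub> \<phi> (b, x) \<otimes>\<^bsub>G\<^esub> inv\<^bsub>G\<^esub> \<phi> (b, x')"
      by (simp add: h_diff h_of ar F_closed del: F_simps)
    then show ?thesis using cl add_r by (simp add: H.m_ac)
  next
    case (balance a b x)
    then show ?thesis
      using cl act_closed i_closed by (simp add: h_diff h_of bal F_closed del: F_simps)
  qed
  have Q1: "q \<in> carrier (F n) \<and> h q = \<one>\<^bsub>G\<^esub>" if "q \<in> Q n" for q
    using that
  proof (induction q rule: Q_induct)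
    case (rel r)
    then show ?case using rels_subset \<open>\<And>r. r \<in> rels n \<Longrightarrow> h r = \<one>\<^bsub>G\<^esub>\<close> by blast
  next
    case diff
    then show ?case by (simp add: h.hom_one[unfolded F_simps])
  next
    fix q q' assume "q \<in> carrier (F n) \<and> h q = \<one>\<^bsub>G\<^esub>" "q' \<in> carrier (F n) \<and> h q' = \<one>\<^bsub>G\<^esub>"
    then show "q - q' \<in> carrier (F n) \<and> h (q - q') = \<one>\<^bsub>G\<^esub>"
      using F_closed(1) by (simp add: h_diff del: F_simps)
  qed
  have \<Phi>: "\<Phi> (tcls n f) = h f" if "f \<in> carrier (F n)" for f
  proof -
    have "h g = h f" if "g \<in> tcls n f" for g
    proof -
      have "g - f \<in> Q n" using that by (simp add: mem_tcls)
      then have "g - f \<in> carrier (F n)" "h (g - f) = \<one>\<^bsub>G\<^esub>" using Q1 by blast+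
      then show ?thesis using h.hom_mult[of "g - f" f] \<open>f \<in> carrier (F n)\<close> h.hom_closed[of f] by (simp del: F_simps add: F_simps(2))
    qed
    moreover have "f \<in> tcls n f" by (simp add: mem_tcls)
    ultimately have "h ` tcls n f = {h f}" by blast
    then show ?thesis by (simp add: \<Phi>_def)
  qed
  show "\<Phi> \<in> hom (ggrp T n) G"
  proof (rule homI)
    fix X assume "X \<in> gcar T n"
    then obtain f where "f \<in> carrier (F n)" "X = tcls n f" by (rule T_E)
    then show "\<Phi> X \<in> carrier G" using \<Phi> h.hom_closed by simp
  next
    fix X Y assume "X \<in> gcar T n" "Y \<in> gcar T n"
    then obtain f g where "f \<in> carrier (F n)" "X = tcls n f" "g \<in> carrier (F n)" "Y = tcls n g" by (metis T_E)
    then show "\<Phi> (X \<otimes>\<^bsub>ggrp T n\<^esub> Y) = \<Phi> X \<otimes>\<^bsub>G\<^esub> \<Phi> Y"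
      using \<Phi> F_closed(2) h.hom_mult[of f g] by (simp add: T_add del: F_simps add: F_simps(2))
  qed
  show "\<Phi> (pt n b x) = \<phi> (b, x)" if "b \<in> carrier B" "x \<in> gcar R n" for b x
    unfolding pure_tensor_def using that by (simp add: \<Phi> h_of)
qed

lemma T_graded_algebra: "graded_algebra B T (\<lambda>b. pt 0 b (gone R))"
proof -
  interpret T: graded_comm_ring T by (rule T_graded_comm_ring)
  show ?thesis
  proof unfold_locales
    show "(\<lambda>b. pt 0 b (gone R)) \<in> hom (add_monoid B) (ggrp T 0)"
      using R.one_closed by (auto simp: hom_def pt_closed pt_add_l)
    show "pt 0 \<one>\<^bsub>B\<^esub> (gone R) = gone T" by (simp add: base_change_def)
    fix a b assume "a \<in> carrier B" "b \<in> carrier B"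
    then show "pt 0 (a \<otimes>\<^bsub>B\<^esub> b) (gone R) = gmult T 0 0 (pt 0 a (gone R)) (pt 0 b (gone R))"
      using R.one_closed by (simp add: pt_mult R.l_one)
  qed
qed

end

section \<open>The components of the p-adic base change of J\<close>

text \<open>
  On the torsion components a \<open>p\<close>-adic integer acts already before tensoring, through its residues.
\<close>

fun tors_act :: "nat \<Rightarrow> (nat \<Rightarrow> int) \<Rightarrow> J_elt \<Rightarrow> J_elt" where
  "tors_act p b (Zeta_inv X) = Zeta_inv (b \<odot>\<^bsub>QpZp p\<^esub> X)"
| "tors_act p b (Alpha k c) = Alpha k ((b (alpha_exp p k) * c) mod int p ^ alpha_exp p k)"
| "tors_act p b x = x"

context odd_prime
begin

lemma act_Zloc_to_Zp:
  assumes "a \<in> Zl" shows "Zloc_to_Zp p a \<odot>\<^sub>Q cls p x = cls p (a * x)"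
proof -
  obtain m where m: "of_nat p ^ m * x \<in> Zl" using ex_denominator by blast
  have "a * x - of_int (Zloc_to_Zp p a m) * x = ((a - of_int (Zloc_to_Zp p a m)) / of_nat p ^ m) * (of_nat p ^ m * x)"
    by (simp add: field_simps)
  also have "\<dots> \<in> Zl" using Zl_mult[OF Zloc_to_Zp_spec(2)[OF assms] m] .
  finally show ?thesis using QpZp_smult[OF Zloc_to_Zp_closed[OF assms] m] by (metis cls_eq_iff)
qed

lemma alpha_deg_uminus: "alpha_deg p (- j) = - 2 - alpha_deg p j"
  by (simp add: alpha_deg_def)

lemma null_deg_dual: "null_deg k \<Longrightarrow> null_deg (- 2 - k)"
  unfolding null_deg_def
  by (metis alpha_deg_uminus add.inverse_inverse diff_diff_eq2 diff_add_cancel add_diff_cancel_left'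
      neg_equal_0_iff_equal add.commute diff_eq_eq diff_zero eq_iff_diff_eq_0)

lemma QpZp_torsion_E:
  assumes "of_nat p ^ m * x \<in> Zl"
  obtains r where "0 \<le> r" "r < int p ^ m" "cls p x = cls p (of_int r / of_nat p ^ m)"
proof -
  let ?r = "Zloc_to_Zp p (of_nat p ^ m * x) m"
  have "x - of_int ?r / of_nat p ^ m = (of_nat p ^ m * x - of_int ?r) / of_nat p ^ m"
    by (simp add: diff_divide_distrib)
  then have "x - of_int ?r / of_nat p ^ m \<in> Zl" using Zloc_to_Zp_spec(2)[OF assms, of m] by simp
  then show ?thesis using that[of ?r] Zloc_to_Zp_spec(1)[OF assms, of m] by (simp add: cls_eq_iff)
qed

sublocale Zp: cring "Zp p" by (rule Zp_cring)

sublocale bc: algebra_base_change "Zloc p" "J p" Eta "Zp p" "Zloc_to_Zp p"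
  by (intro algebra_base_change.intro algebra_base_change_axioms.intro J_graded_algebra Zp_cring Zloc_to_Zp_hom)

sublocale QZ: module "Zp p" "QpZp p" by (rule QpZp_module)

abbreviation "JH \<equiv> J_hat p"
abbreviation "\<upsilon> \<equiv> J_hat_unit p"
abbreviation "\<tau> \<equiv> J_hat_tensor p"

definition jhat :: "int \<Rightarrow> J_elt \<Rightarrow> ((nat \<Rightarrow> int) \<times> J_elt \<Rightarrow>\<^sub>0 int) set"
  where "jhat n x = \<tau> n \<one>\<^sub>Z x"

lemma JH_T: "JH = bc.T" by (rule J_hat_def)

lemma tau_pt: "\<tau> = bc.pt" by (rule J_hat_tensor_def)

lemma unit_pt: "\<upsilon> b = \<tau> 0 b (Eta 1)" by (simp add: J_hat_unit_def)

lemma JH_graded_algebra: "graded_algebra (Zp p) JH \<upsilon>"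
  using bc.T_graded_algebra by (simp add: JH_T J_hat_unit_def[abs_def] tau_pt)

sublocale JH: graded_algebra "Zp p" JH \<upsilon> by (rule JH_graded_algebra)

lemma tau_mult:
  assumes "b \<in> carrier (Zp p)" "x \<in> J_carrier p m" "c \<in> carrier (Zp p)" "y \<in> J_carrier p n"
  shows "gmult JH m n (\<tau> m b x) (\<tau> n c y) = \<tau> (m + n) (b \<otimes>\<^sub>Z c) (J_mult p m n x y)"
  using bc.pt_mult[of b x m c y n] assms by (simp add: JH_T tau_pt)

lemma tau_closed: "b \<in> carrier (Zp p) \<Longrightarrow> x \<in> J_carrier p n \<Longrightarrow> \<tau> n b x \<in> gcar JH n"
  using bc.pt_closed[of b x n] by (simp add: JH_T tau_pt)

lemma Eta_closed [simp]: "Eta a \<in> J_carrier p 0 \<longleftrightarrow> a \<in> Zl"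
  by (simp add: J_carrier_iff)

lemma jhat_closed: "x \<in> J_carrier p n \<Longrightarrow> jhat n x \<in> gcar JH n"
  by (simp add: jhat_def tau_closed)

lemma unit_mult_jhat:
  "b \<in> carrier (Zp p) \<Longrightarrow> x \<in> J_carrier p n \<Longrightarrow> gmult JH 0 n (\<upsilon> b) (jhat n x) = \<tau> n b x"
  by (simp add: unit_pt jhat_def tau_mult J_one)

lemma jhat_mult:
  "x \<in> J_carrier p m \<Longrightarrow> y \<in> J_carrier p n \<Longrightarrow> gmult JH m n (jhat m x) (jhat n y) = jhat (m + n) (J_mult p m n x y)"
  by (simp add: jhat_def tau_mult)

lemma jhat_hom: "jhat n \<in> hom (ggrp (J p) n) (ggrp JH n)"
proof (rule homI)
  fix x y assume "x \<in> gcar (J p) n" "y \<in> gcar (J p) n"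
  then show "jhat n (x \<otimes>\<^bsub>ggrp (J p) n\<^esub> y) = jhat n x \<otimes>\<^bsub>ggrp JH n\<^esub> jhat n y"
    using bc.pt_add_r[of "\<one>\<^sub>Z" x n y] by (simp add: jhat_def tau_pt JH_T)
qed (simp add: jhat_closed)

lemma jhat_zero: "jhat n (J_zero p n) = \<one>\<^bsub>ggrp JH n\<^esub>"
proof -
  interpret h: group_hom "ggrp (J p) n" "ggrp JH n" "jhat n"
    by (intro group_hom.intro group_hom_axioms.intro bc.G.is_group JH.G.is_group jhat_hom)
  show ?thesis using h.hom_one by simp
qed

subsection \<open>Degree zero\<close>

text \<open>
  The tensor product is balanced, so \<open>b \<otimes> a = b a \<otimes> 1\<close> for \<open>a\<close> in the local ring.
\<close>

lemma unit_surj: assumes "X \<in> gcar JH 0" shows "\<exists>b\<in>carrier (Zp p). X = \<upsilon> b"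
  using assms unfolding JH_T
proof (induction X rule: bc.T_induct)
  case (pure b x)
  then obtain a where a: "x = Eta a" "a \<in> Zl" by (auto elim!: J_cases simp: null_deg_def)
  have "bc.pt 0 (b \<otimes>\<^sub>Z Zloc_to_Zp p a) (Eta 1) = bc.pt 0 b (gmult (J p) 0 0 (Eta a) (Eta 1))"
    using pure a by (intro bc.pt_balanced) auto
  then have "bc.pt 0 b x = \<upsilon> (b \<otimes>\<^sub>Z Zloc_to_Zp p a)" by (simp add: unit_pt tau_pt a)
  then show ?case using pure a by (metis Zp.m_closed Zloc_to_Zp_closed)
next
  case (diff X Y)
  then obtain b c where bc: "b \<in> carrier (Zp p)" "c \<in> carrier (Zp p)" "X = \<upsilon> b" "Y = \<upsilon> c" by blast
  interpret h: group_hom "add_monoid (Zp p)" "ggrp JH 0" \<upsilon>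
    by (intro group_hom.intro group_hom_axioms.intro Zp.a_group JH.G.is_group JH.unit_hom)
  have "\<upsilon> (b \<ominus>\<^sub>Z c) = \<upsilon> b \<otimes>\<^bsub>ggrp JH 0\<^esub> inv\<^bsub>ggrp JH 0\<^esub> \<upsilon> c"
    using bc h.hom_mult[of b "\<ominus>\<^bsub>Zp p\<^esub> c"] h.hom_inv[of c] Zp.a_inv_closed[OF bc(2)] by (simp add: a_minus_def a_inv_def)
  then show ?case using bc by (metis JH_T Zp.minus_closed)
qed

text \<open>
  The map \<open>b \<otimes> a \<mapsto> b a\<close> is a left inverse.
\<close>

lemma unit_inj: "inj_on \<upsilon> (carrier (Zp p))"
proof -
  define v where "v x = (case x of Eta a \<Rightarrow> Zloc_to_Zp p a | _ \<Rightarrow> undefined)" for x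
  have E: "\<exists>a\<in>Zl. x = Eta a" if "x \<in> J_carrier p 0" for x
    using that by (auto elim!: J_cases simp: null_deg_def)
  let ?\<phi> = "\<lambda>t. fst t \<otimes>\<^sub>Z v (snd t)"
  have "\<exists>\<Phi>. \<forall>b\<in>carrier (Zp p). \<forall>x\<in>gcar (J p) 0. \<Phi> (bc.pt 0 b x) = ?\<phi> (b, x)"
    by (rule exI, intro ballI, rule bc.T_universal(2)[OF Zp.a_comm_group])
      (auto dest!: E simp: v_def Zloc_to_Zp_closed Zloc_to_Zp_add Zloc_to_Zp_mult Zp.l_distr Zp.r_distr Zp.m_assoc)
  then obtain \<Phi> where \<Phi>: "\<And>b x. b \<in> carrier (Zp p) \<Longrightarrow> x \<in> J_carrier p 0 \<Longrightarrow> \<Phi> (bc.pt 0 b x) = ?\<phi> (b, x)"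
    by auto
  have "\<Phi> (\<upsilon> b) = b" if "b \<in> carrier (Zp p)" for b
    using \<Phi>[OF that, of "Eta 1"] that Zloc_to_Zp_of_int[of 1] by (simp add: unit_pt tau_pt v_def Zint_1)
  then show ?thesis by (metis inj_onI)
qed

lemma unit_zero_iff: "b \<in> carrier (Zp p) \<Longrightarrow> \<upsilon> b = \<one>\<^bsub>ggrp JH 0\<^esub> \<longleftrightarrow> b = \<zero>\<^sub>Z"
proof -
  interpret h: group_hom "add_monoid (Zp p)" "ggrp JH 0" \<upsilon>
    by (intro group_hom.intro group_hom_axioms.intro Zp.a_group JH.G.is_group JH.unit_hom)
  show "b \<in> carrier (Zp p) \<Longrightarrow> ?thesis"
    using inj_onD[OF unit_inj, of b "\<zero>\<^sub>Z"] h.hom_one by auto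
qed

subsection \<open>The torsion components\<close>

lemma tors_act_eq:
  assumes "x \<in> J_carrier p n" "n \<noteq> 0"
  obtains m where "J_mult p 0 n (Eta (of_nat p ^ m)) x = J_zero p n"
    "\<And>b. b \<in> carrier (Zp p) \<Longrightarrow> tors_act p b x = J_mult p 0 n (Eta (of_int (b m))) x"
  using assms(1)
proof (cases rule: J_cases)
  case (Zeta z)
  obtain m where m: "of_nat p ^ m * z \<in> Zl" using ex_denominator by blast
  show ?thesis
    by (rule that[of m]) (use Zeta m in \<open>auto simp: Zloc_act_cls QpZp_smult J_zero_simps cls_eq_iff\<close>)
next
  case (Alpha k c)
  have "Zloc_to_Zp p (of_nat p ^ alpha_exp p k) (alpha_exp p k) = 0"
    using Zloc_to_Zp_of_int[of "int p ^ alpha_exp p k"] by (simp add: Zint_def)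
  then show ?thesis
    by (intro that[of "alpha_exp p k"])
      (use Alpha in \<open>auto simp: Zloc_act_alpha_def J_zero_simps Zloc_to_Zp_of_int Zint_def mod_simps\<close>)
next
  case Null
  then show ?thesis by (intro that) (auto simp: J_zero_simps)
qed (use assms in auto)

lemma tors_act_closed:
  assumes "x \<in> J_carrier p n" "n \<noteq> 0" "b \<in> carrier (Zp p)"
  shows "tors_act p b x \<in> J_carrier p n"
proof -
  obtain m where "tors_act p b x = J_mult p 0 n (Eta (of_int (b m))) x"
    using tors_act_eq assms by metis
  then show ?thesis using J_mult_closed[of "Eta (of_int (b m))" 0 x n] assms by simp
qed

text \<open>
  Write \<open>b = r + p\<^sup>m c\<close> with the residue \<open>r\<close> of \<open>b\<close> modulo \<open>p\<^sup>m\<close>, where \<open>p\<^sup>m x = 0\<close>. Then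
  \<open>b \<otimes> x = 1 \<otimes> r x + c \<otimes> p\<^sup>m x\<close>, and the second summand vanishes.
\<close>

lemma tau_eq_jhat:
  assumes "x \<in> J_carrier p n" "n \<noteq> 0" "b \<in> carrier (Zp p)"
  shows "\<tau> n b x = jhat n (tors_act p b x)"
proof -
  obtain m where m: "J_mult p 0 n (Eta (of_nat p ^ m)) x = J_zero p n"
    "tors_act p b x = J_mult p 0 n (Eta (of_int (b m))) x"
    using tors_act_eq[OF assms(1,2)] assms(3) by metis
  let ?z = "Zint p (b m)" and ?P = "Zint p (int p ^ m)"
  have "(b \<ominus>\<^sub>Z ?z) m = 0"
  proof -
    have "b \<ominus>\<^sub>Z ?z \<oplus>\<^sub>Z ?z = b" using assms by (simp add: a_minus_def Zp.a_assoc Zp.l_neg)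
    then have "((b \<ominus>\<^sub>Z ?z) m + ?z m) mod int p ^ m = b m" by (metis Zp_add)
    then have "[(b \<ominus>\<^sub>Z ?z) m + b m = 0 + b m] (mod int p ^ m)"
      using Zp_range[OF assms(3), of m] by (simp add: Zint_def cong_def mod_simps)
    then have "[(b \<ominus>\<^sub>Z ?z) m = 0] (mod int p ^ m)" by (simp only: cong_add_rcancel)
    then show ?thesis using Zp_range[OF Zp.minus_closed[OF assms(3) Zint_closed], of "b m" m] by (simp add: cong_def)
  qed
  then obtain c where c: "c \<in> carrier (Zp p)" "b \<ominus>\<^sub>Z ?z = ?P \<otimes>\<^sub>Z c"
    using Zp_divisible[of "b \<ominus>\<^sub>Z ?z" m] assms by auto
  have b: "b = \<one>\<^sub>Z \<otimes>\<^sub>Z Zloc_to_Zp p (of_int (b m)) \<oplus>\<^sub>Z c \<otimes>\<^sub>Z Zloc_to_Zp p (of_nat p ^ m)"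
  proof -
    have "b = ?z \<oplus>\<^sub>Z (b \<ominus>\<^sub>Z ?z)" using assms by (simp add: a_minus_def Zp.a_ac Zp.r_neg)
    then show ?thesis using c Zloc_to_Zp_of_int[of "int p ^ m"]
      by (simp add: Zloc_to_Zp_of_int Zp.m_comm)
  qed
  have "\<tau> n b x = bc.pt n (\<one>\<^sub>Z \<otimes>\<^sub>Z Zloc_to_Zp p (of_int (b m))) x
      \<otimes>\<^bsub>ggrp JH n\<^esub> bc.pt n (c \<otimes>\<^sub>Z Zloc_to_Zp p (of_nat p ^ m)) x"
    unfolding tau_pt JH_T using c assms Zloc_to_Zp_closed by (subst b, subst bc.pt_add_l) auto
  also have "\<dots> = \<tau> n \<one>\<^sub>Z (J_mult p 0 n (Eta (of_int (b m))) x) \<otimes>\<^bsub>ggrp JH n\<^esub> \<tau> n c (J_mult p 0 n (Eta (of_nat p ^ m)) x)"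
    using bc.pt_balanced[of "of_int (b m)" "\<one>\<^sub>Z" x n] bc.pt_balanced[of "of_nat p ^ m" c x n] c assms
    by (simp add: tau_pt)
  also have "\<tau> n c (J_mult p 0 n (Eta (of_nat p ^ m)) x) = gmult JH 0 n (\<upsilon> c) (jhat n (J_zero p n))"
    using c by (simp add: m unit_mult_jhat)
  also have "\<dots> = \<one>\<^bsub>ggrp JH n\<^esub>"
  proof -
    have "gmult JH 0 n (\<upsilon> c) \<one>\<^bsub>ggrp JH n\<^esub> = gmult JH 0 n (\<upsilon> c) \<one>\<^bsub>ggrp JH n\<^esub> \<otimes>\<^bsub>ggrp JH n\<^esub> gmult JH 0 n (\<upsilon> c) \<one>\<^bsub>ggrp JH n\<^esub>"
      using JH.R.r_distr[of "\<upsilon> c" 0 "\<one>\<^bsub>ggrp JH n\<^esub>" n "\<one>\<^bsub>ggrp JH n\<^esub>"] c JH.unit_closed by simp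
    moreover have "gmult JH 0 n (\<upsilon> c) \<one>\<^bsub>ggrp JH n\<^esub> \<in> gcar JH n"
      using JH.R.mult_closed[of "\<upsilon> c" 0 "\<one>\<^bsub>ggrp JH n\<^esub>" n] c JH.unit_closed by simp
    ultimately show ?thesis by (simp add: jhat_zero)
  qed
  finally show ?thesis using jhat_closed[OF tors_act_closed[OF assms]] by (simp add: m(2) jhat_def)
qed

lemma jhat_surj: assumes "X \<in> gcar JH n" "n \<noteq> 0" shows "\<exists>x\<in>J_carrier p n. X = jhat n x"
  using assms(1) unfolding JH_T
proof (induction X rule: bc.T_induct)
  case (pure b x)
  then show ?case using tau_eq_jhat[of x n b] tors_act_closed[of x n b] assms(2) by (auto simp: tau_pt)
next
  case (diff X Y)
  then obtain x y where xy: "x \<in> J_carrier p n" "y \<in> J_carrier p n" "X = jhat n x" "Y = jhat n y" by blast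
  interpret h: group_hom "ggrp (J p) n" "ggrp JH n" "jhat n"
    by (intro group_hom.intro group_hom_axioms.intro bc.G.is_group JH.G.is_group jhat_hom)
  let ?z = "x \<otimes>\<^bsub>ggrp (J p) n\<^esub> inv\<^bsub>ggrp (J p) n\<^esub> y"
  have z: "?z \<in> gcar (J p) n" using xy by (intro bc.G.m_closed bc.G.inv_closed) auto
  have "jhat n ?z = X \<otimes>\<^bsub>ggrp JH n\<^esub> inv\<^bsub>ggrp JH n\<^esub> Y"
    using xy h.hom_mult[of x "inv\<^bsub>ggrp (J p) n\<^esub> y"] h.hom_inv[of y] bc.G.inv_closed[of y n] by simp
  then show ?case using z unfolding JH_T by (metis J_simps(1))
qed

lemma tors_act_bilinear:
  assumes "n \<noteq> 0" "b \<in> carrier (Zp p)" "x \<in> J_carrier p n"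
  shows "b' \<in> carrier (Zp p) \<Longrightarrow> tors_act p (b \<oplus>\<^sub>Z b') x = J_add p (tors_act p b x) (tors_act p b' x)"
    "x' \<in> J_carrier p n \<Longrightarrow> tors_act p b (J_add p x x') = J_add p (tors_act p b x) (tors_act p b x')"
    "a \<in> Zl \<Longrightarrow> tors_act p (b \<otimes>\<^sub>Z Zloc_to_Zp p a) x = tors_act p b (J_mult p 0 n (Eta a) x)"
proof -
  show "tors_act p (b \<oplus>\<^sub>Z b') x = J_add p (tors_act p b x) (tors_act p b' x)" if "b' \<in> carrier (Zp p)"
    using assms(3)
  proof (cases rule: J_cases)
    case (Alpha k c)
    then show ?thesis by (simp add: Zp_add mod_simps distrib_right)
  qed (use assms that in \<open>auto simp: QZ.smult_l_distr\<close>)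
  show "tors_act p b (J_add p x x') = J_add p (tors_act p b x) (tors_act p b x')" if x': "x' \<in> J_carrier p n"
    using assms(3)
  proof (cases rule: J_cases)
    case (Alpha k c)
    then obtain c' where "x' = Alpha k c'" using x' Alpha by (auto elim!: J_cases simp: null_deg_def)
    then show ?thesis using Alpha by (simp add: mod_simps distrib_left)
  next
    case (Zeta z)
    then obtain z' where "x' = Zeta_inv (cls p z')" using x' Zeta by (auto elim!: J_cases simp: null_deg_def)
    then show ?thesis using Zeta assms by (simp add: QZ.smult_r_distr)
  qed (use assms that in \<open>auto elim!: J_cases simp: null_deg_def\<close>)
  show "tors_act p (b \<otimes>\<^sub>Z Zloc_to_Zp p a) x = tors_act p b (J_mult p 0 n (Eta a) x)" if "a \<in> Zl"
    using assms(3)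
  proof (cases rule: J_cases)
    case (Alpha k c)
    then show ?thesis by (simp add: Zp_mult Zloc_act_alpha_def mod_simps mult.assoc)
  next
    case (Zeta z)
    then show ?thesis using assms that
      by (simp add: QZ.smult_assoc1 Zloc_to_Zp_closed act_Zloc_to_Zp Zloc_act_cls)
  qed (use assms that in \<open>auto simp: J_zero_simps\<close>)
qed

text \<open>
  The map \<open>b \<otimes> x \<mapsto> b x\<close> to the torsion component of \<open>J\<close> itself is a left inverse.
\<close>

lemma jhat_inj: assumes "n \<noteq> 0" shows "inj_on (jhat n) (J_carrier p n)"
proof -
  let ?\<phi> = "\<lambda>t. tors_act p (fst t) (snd t)"
  have "\<exists>\<Phi>. \<forall>b\<in>carrier (Zp p). \<forall>x\<in>gcar (J p) n. \<Phi> (bc.pt n b x) = ?\<phi> (b, x)"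
    by (rule exI, intro ballI, rule bc.T_universal(2)[OF bc.G.comm_group_axioms[of n]])
      (use assms in \<open>auto simp: tors_act_bilinear tors_act_closed\<close>)
  then obtain \<Phi> where \<Phi>: "\<And>b x. b \<in> carrier (Zp p) \<Longrightarrow> x \<in> J_carrier p n \<Longrightarrow> \<Phi> (bc.pt n b x) = ?\<phi> (b, x)"
    by auto
  have "\<Phi> (jhat n x) = x" if "x \<in> J_carrier p n" for x
  proof -
    have "\<Phi> (jhat n x) = tors_act p \<one>\<^sub>Z x" using \<Phi>[OF _ that, of "\<one>\<^sub>Z"] by (simp add: jhat_def tau_pt)
    also have "\<dots> = x" using that
    proof (cases rule: J_cases)
      case (Alpha k c)
      then show ?thesis by (simp add: Zp_one mod_simps)
    qed auto
    finally show ?thesis .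
  qed
  then show ?thesis by (metis inj_onI)
qed

lemma jhat_eq_one_iff: "n \<noteq> 0 \<Longrightarrow> x \<in> J_carrier p n \<Longrightarrow> jhat n x = \<one>\<^bsub>ggrp JH n\<^esub> \<longleftrightarrow> x = J_zero p n"
  using inj_onD[OF jhat_inj, of n x "J_zero p n"] jhat_zero[of n] by auto

lemma unit_jhat:
  "b \<in> carrier (Zp p) \<Longrightarrow> x \<in> J_carrier p n \<Longrightarrow> n \<noteq> 0 \<Longrightarrow> gmult JH 0 n (\<upsilon> b) (jhat n x) = jhat n (tors_act p b x)"
  by (simp add: unit_mult_jhat tau_eq_jhat)

subsection \<open>The trace map\<close>

lemma zeta_hat_props:
  shows "zeta_hat p \<in> hom (ggrp JH (- 2)) (add_monoid (QpZp p))"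
    and "\<And>b X. b \<in> carrier (Zp p) \<Longrightarrow> X \<in> carrier (QpZp p) \<Longrightarrow>
      zeta_hat p (\<tau> (- 2) b (Zeta_inv X)) = b \<odot>\<^sub>Q X"
proof -
  let ?\<phi> = "\<lambda>t. fst t \<odot>\<^sub>Q zeta (snd t)"
  have E: "\<exists>z. x = Zeta_inv (cls p z)" if "x \<in> J_carrier p (- 2)" for x
    using that by (auto elim!: J_cases simp: null_deg_def)
  have zh: "zeta_hat p = (\<lambda>X. the_elem ((\<lambda>f. finprod (add_monoid (QpZp p))
      (\<lambda>t. ?\<phi> t [^]\<^bsub>add_monoid (QpZp p)\<^esub> Poly_Mapping.lookup f t) (Poly_Mapping.keys f)) ` X))"
    by (simp add: zeta_hat_def[abs_def] finsum_def add_pow_def)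
  have cl: "?\<phi> (b, x) \<in> carrier (add_monoid (QpZp p))"
    if "b \<in> carrier (Zp p)" "x \<in> gcar (J p) (- 2)" for b x
  proof -
    from E[of x] that obtain z where "x = Zeta_inv (cls p z)" by auto
    then show ?thesis using that by simp
  qed
  have al: "?\<phi> (b \<oplus>\<^sub>Z b', x) = ?\<phi> (b, x) \<otimes>\<^bsub>add_monoid (QpZp p)\<^esub> ?\<phi> (b', x)"
    if "b \<in> carrier (Zp p)" "b' \<in> carrier (Zp p)" "x \<in> gcar (J p) (- 2)" for b b' x
  proof -
    from E[of x] that obtain z where "x = Zeta_inv (cls p z)" by auto
    then show ?thesis using that by (simp add: QZ.smult_l_distr)
  qed
  have ar: "?\<phi> (b, x \<otimes>\<^bsub>ggrp (J p) (- 2)\<^esub> x') = ?\<phi> (b, x) \<otimes>\<^bsub>add_monoid (QpZp p)\<^esub> ?\<phi> (b, x')"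
    if "b \<in> carrier (Zp p)" "x \<in> gcar (J p) (- 2)" "x' \<in> gcar (J p) (- 2)" for b x x'
  proof -
    from E[of x] E[of x'] that obtain z z' where "x = Zeta_inv (cls p z)" "x' = Zeta_inv (cls p z')" by auto
    then show ?thesis using that by (simp add: QZ.smult_r_distr)
  qed
  have bal: "?\<phi> (b \<otimes>\<^sub>Z Zloc_to_Zp p a, x) = ?\<phi> (b, gmult (J p) 0 (- 2) (Eta a) x)"
    if "a \<in> Zl" "b \<in> carrier (Zp p)" "x \<in> gcar (J p) (- 2)" for a b x
  proof -
    from E[of x] that obtain z where "x = Zeta_inv (cls p z)" by auto
    then show ?thesis using that
      by (simp add: QZ.smult_assoc1 Zloc_to_Zp_closed act_Zloc_to_Zp Zloc_act_cls)
  qed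
  have *: "zeta_hat p \<in> hom (ggrp bc.T (- 2)) (add_monoid (QpZp p))"
    unfolding zh by (rule bc.T_universal(1)[OF QpZp_comm_group]) (rule cl al ar bal; assumption)+
  have **: "zeta_hat p (bc.pt (- 2) b x) = ?\<phi> (b, x)" if "b \<in> carrier (Zp p)" "x \<in> gcar (J p) (- 2)" for b x
    unfolding zh by (rule bc.T_universal(2)[OF QpZp_comm_group]) (rule cl al ar bal that; assumption?)+
  show "zeta_hat p \<in> hom (ggrp JH (- 2)) (add_monoid (QpZp p))" using * by (simp add: JH_T)
  show "zeta_hat p (\<tau> (- 2) b (Zeta_inv X)) = b \<odot>\<^sub>Q X" if "b \<in> carrier (Zp p)" "X \<in> carrier (QpZp p)" for b X
    using ** that by (simp add: tau_pt J_carrier_iff)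
qed

lemma zeta_hat_jhat: "X \<in> carrier (QpZp p) \<Longrightarrow> zeta_hat p (jhat (- 2) (Zeta_inv X)) = X"
  by (simp add: jhat_def zeta_hat_props)

lemma zeta_hat_unit: "b \<in> carrier (Zp p) \<Longrightarrow> X \<in> carrier (QpZp p) \<Longrightarrow>
    zeta_hat p (gmult JH 0 (- 2) (\<upsilon> b) (jhat (- 2) (Zeta_inv X))) = b \<odot>\<^sub>Q X"
  by (simp add: unit_mult_jhat J_carrier_iff zeta_hat_props)

end

section \<open>Pontrjagin self-duality\<close>

context graded_comm_ring
begin

lemma mult_group_hom_l:
  "y \<in> gcar R n \<Longrightarrow> group_hom (ggrp R m) (ggrp R (m + n)) (\<lambda>x. gmult R m n x y)"
  using comm_group[THEN comm_group.axioms(2)]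
  by (intro group_hom.intro group_hom_axioms.intro homI) (auto simp: mult_closed l_distr)

lemma mult_group_hom_r:
  "x \<in> gcar R m \<Longrightarrow> group_hom (ggrp R n) (ggrp R (m + n)) (gmult R m n x)"
  using comm_group[THEN comm_group.axioms(2)]
  by (intro group_hom.intro group_hom_axioms.intro homI) (auto simp: mult_closed r_distr)

lemma zero_mult:
  "y \<in> gcar R n \<Longrightarrow> gmult R m n \<one>\<^bsub>ggrp R m\<^esub> y = \<one>\<^bsub>ggrp R (m + n)\<^esub>"
  using group_hom.hom_one[OF mult_group_hom_l] by blast

lemma mult_zero:
  "x \<in> gcar R m \<Longrightarrow> gmult R m n x \<one>\<^bsub>ggrp R n\<^esub> = \<one>\<^bsub>ggrp R (m + n)\<^esub>"
  using group_hom.hom_one[OF mult_group_hom_r] by blast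

lemma inv_mult_l:
  "x \<in> gcar R m \<Longrightarrow> y \<in> gcar R n \<Longrightarrow>
    gmult R m n (inv\<^bsub>ggrp R m\<^esub> x) y = inv\<^bsub>ggrp R (m + n)\<^esub> gmult R m n x y"
  using group_hom.hom_inv[OF mult_group_hom_l] by blast

lemma mult_inv_r:
  "x \<in> gcar R m \<Longrightarrow> y \<in> gcar R n \<Longrightarrow>
    gmult R m n x (inv\<^bsub>ggrp R n\<^esub> y) = inv\<^bsub>ggrp R (m + n)\<^esub> gmult R m n x y"
  using group_hom.hom_inv[OF mult_group_hom_r] by blast

end

lemma component_simps [simp]:
  "carrier (component R u n) = gcar R n" "x \<oplus>\<^bsub>component R u n\<^esub> y = x \<otimes>\<^bsub>ggrp R n\<^esub> y"
  "\<zero>\<^bsub>component R u n\<^esub> = \<one>\<^bsub>ggrp R n\<^esub>" "a \<odot>\<^bsub>component R u n\<^esub> x = gmult R 0 n (u a) x"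
  by (simp_all add: component_def)

lemma hom_add_monoid_iff:
  "f \<in> hom (add_monoid M) (add_monoid N) \<longleftrightarrow>
    f \<in> carrier M \<rightarrow> carrier N \<and> (\<forall>x\<in>carrier M. \<forall>y\<in>carrier M. f (x \<oplus>\<^bsub>M\<^esub> y) = f x \<oplus>\<^bsub>N\<^esub> f y)"
  by (simp add: hom_def)

lemma mod_iso_iff:
  "f \<in> mod_iso A M N \<longleftrightarrow> f \<in> hom (add_monoid M) (add_monoid N) \<and> bij_betw f (carrier M) (carrier N) \<and>
    (\<forall>a\<in>carrier A. \<forall>x\<in>carrier M. f (a \<odot>\<^bsub>M\<^esub> x) = a \<odot>\<^bsub>N\<^esub> f x)"
  by (auto simp: mod_iso_def iso_def)

lemma pontrjagin_dual_iff:
  "\<phi> \<in> carrier (pontrjagin_dual p M) \<longleftrightarrow> \<phi> \<in> extensional (carrier M) \<and> \<phi> \<in> hom (add_monoid M) (add_monoid (QpZp p)) \<and>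
     (\<forall>a\<in>carrier (Zp p). \<forall>x\<in>carrier M. \<phi> (a \<odot>\<^bsub>M\<^esub> x) = a \<odot>\<^bsub>QpZp p\<^esub> \<phi> x)"
  by (simp add: pontrjagin_dual_def)

locale traced_algebra = prime_num p + graded_algebra "Zp p" R u
  for p and R :: "'a gring" and u +
  fixes d :: int and \<zeta> :: "'a \<Rightarrow> rat set"
  assumes zeta_iso: "\<zeta> \<in> mod_iso (Zp p) (component R u d) (QpZp p)"
begin

sublocale QZ: module "Zp p" "QpZp p" by (rule QpZp_module)

lemma zeta_closed: "x \<in> gcar R d \<Longrightarrow> \<zeta> x \<in> carrier (QpZp p)"
  using zeta_iso by (auto simp: mod_iso_iff hom_def)

lemma zeta_add: "x \<in> gcar R d \<Longrightarrow> y \<in> gcar R d \<Longrightarrow> \<zeta> (x \<otimes>\<^bsub>ggrp R d\<^esub> y) = \<zeta> x \<oplus>\<^sub>Q \<zeta> y"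
  using zeta_iso by (auto simp: mod_iso_iff hom_def)

lemma zeta_smult: "a \<in> carrier (Zp p) \<Longrightarrow> x \<in> gcar R d \<Longrightarrow> \<zeta> (gmult R 0 d (u a) x) = a \<odot>\<^sub>Q \<zeta> x"
  using zeta_iso by (auto simp: mod_iso_iff)

lemma zeta_one: "\<zeta> \<one>\<^bsub>ggrp R d\<^esub> = \<zero>\<^sub>Q"
  using zeta_add[of "\<one>\<^bsub>ggrp R d\<^esub>" "\<one>\<^bsub>ggrp R d\<^esub>"] zeta_closed[of "\<one>\<^bsub>ggrp R d\<^esub>"]
  by (simp add: QZ.add.r_cancel_one)

lemma zeta_inv: assumes "x \<in> gcar R d" shows "\<zeta> (inv\<^bsub>ggrp R d\<^esub> x) = \<ominus>\<^sub>Q \<zeta> x"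
  using zeta_add[of "inv\<^bsub>ggrp R d\<^esub> x" x] zeta_closed assms zeta_one
  by (intro QZ.minus_equality[symmetric]) auto

definition pairing :: "int \<Rightarrow> 'a \<Rightarrow> 'a \<Rightarrow> rat set"
  where "pairing k a b = \<zeta> (gmult R (d - k) k a b)"

lemma mult_in_d: "a \<in> gcar R (d - k) \<Longrightarrow> b \<in> gcar R k \<Longrightarrow> gmult R (d - k) k a b \<in> gcar R d"
  using R.mult_closed[of a "d - k" b k] by simp

lemma pairing_closed: "a \<in> gcar R (d - k) \<Longrightarrow> b \<in> gcar R k \<Longrightarrow> pairing k a b \<in> carrier (QpZp p)"
  by (simp add: pairing_def zeta_closed mult_in_d)

lemma pairing_add_l:
  "a \<in> gcar R (d - k) \<Longrightarrow> a' \<in> gcar R (d - k) \<Longrightarrow> b \<in> gcar R k \<Longrightarrow>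
    pairing k (a \<otimes>\<^bsub>ggrp R (d - k)\<^esub> a') b = pairing k a b \<oplus>\<^sub>Q pairing k a' b"
  using R.l_distr[of a "d - k" a' b k] by (simp add: pairing_def zeta_add mult_in_d)

lemma pairing_add_r:
  "a \<in> gcar R (d - k) \<Longrightarrow> b \<in> gcar R k \<Longrightarrow> b' \<in> gcar R k \<Longrightarrow>
    pairing k a (b \<otimes>\<^bsub>ggrp R k\<^esub> b') = pairing k a b \<oplus>\<^sub>Q pairing k a b'"
  using R.r_distr[of a "d - k" b k b'] by (simp add: pairing_def zeta_add mult_in_d)

lemma pairing_smult_l:
  assumes "c \<in> carrier (Zp p)" "a \<in> gcar R (d - k)" "b \<in> gcar R k"
  shows "pairing k (gmult R 0 (d - k) (u c) a) b = c \<odot>\<^sub>Q pairing k a b"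
  using R.assoc[of "u c" 0 a "d - k" b k] assms unit_closed mult_in_d
  by (simp add: pairing_def zeta_smult)

lemma pairing_smult_r:
  assumes "c \<in> carrier (Zp p)" "a \<in> gcar R (d - k)" "b \<in> gcar R k"
  shows "pairing k a (gmult R 0 k (u c) b) = c \<odot>\<^sub>Q pairing k a b"
  using R.assoc[of a "d - k" "u c" 0 b k] assms unit_closed pairing_smult_l[OF assms]
  by (simp add: pairing_def unit_comm)

lemma pairing_inv_l:
  assumes "a \<in> gcar R (d - k)" "b \<in> gcar R k"
  shows "pairing k (inv\<^bsub>ggrp R (d - k)\<^esub> a) b = \<ominus>\<^sub>Q pairing k a b"
  using R.inv_mult_l[of a "d - k" b k] assms by (simp add: pairing_def zeta_inv mult_in_d)

text \<open>
  The map to the dual is linear because the pairing is bilinear. So duality only asks for a perfect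
  pairing.
\<close>

lemma pontrjagin_self_dualI:
  assumes inj: "\<And>k a. a \<in> gcar R (d - k) \<Longrightarrow> (\<And>b. b \<in> gcar R k \<Longrightarrow> pairing k a b = \<zero>\<^sub>Q) \<Longrightarrow>
      a = \<one>\<^bsub>ggrp R (d - k)\<^esub>"
    and surj: "\<And>k \<phi>. \<phi> \<in> carrier (pontrjagin_dual p (component R u k)) \<Longrightarrow>
      \<exists>a\<in>gcar R (d - k). \<forall>b\<in>gcar R k. pairing k a b = \<phi> b"
  shows "pontrjagin_self_dual p R u d \<zeta>"
  unfolding pontrjagin_self_dual_def pairing_def[symmetric]
proof (intro conjI allI)
  show "graded_algebra (Zp p) R u" by (rule graded_algebra_axioms)
  show "\<zeta> \<in> mod_iso (Zp p) (component R u d) (QpZp p)" by (rule zeta_iso)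
  fix k
  let ?f = "\<lambda>a. \<lambda>b\<in>gcar R k. pairing k a b"
  have dual: "?f a \<in> carrier (pontrjagin_dual p (component R u k))" if "a \<in> gcar R (d - k)" for a
    unfolding pontrjagin_dual_iff using that
    by (auto simp: hom_def pairing_closed pairing_add_r pairing_smult_r R.mult_closed[of _ 0 _ k, simplified] unit_closed)
  show "?f \<in> mod_iso (Zp p) (component R u (d - k)) (pontrjagin_dual p (component R u k))"
    unfolding mod_iso_iff
  proof (intro conjI ballI)
    show "?f \<in> hom (add_monoid (component R u (d - k))) (add_monoid (pontrjagin_dual p (component R u k)))"
      unfolding hom_add_monoid_iff using dual
      by (auto simp: pontrjagin_dual_def pairing_add_l fun_eq_iff)
    show "?f (c \<odot>\<^bsub>component R u (d - k)\<^esub> a) = c \<odot>\<^bsub>pontrjagin_dual p (component R u k)\<^esub> ?f a"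
      if "c \<in> carrier (Zp p)" "a \<in> carrier (component R u (d - k))" for c a
      using that by (auto simp: pontrjagin_dual_def pairing_smult_l fun_eq_iff)
    show "bij_betw ?f (carrier (component R u (d - k))) (carrier (pontrjagin_dual p (component R u k)))"
    proof (rule bij_betw_imageI)
      show "inj_on ?f (carrier (component R u (d - k)))"
      proof (rule inj_onI; simp only: component_simps)
        fix a a' assume a: "a \<in> gcar R (d - k)" "a' \<in> gcar R (d - k)" and eq: "?f a = ?f a'"
        have "pairing k a b = pairing k a' b" if "b \<in> gcar R k" for b
          using fun_cong[OF eq, of b] that by simp
        then have "a \<otimes>\<^bsub>ggrp R (d - k)\<^esub> inv\<^bsub>ggrp R (d - k)\<^esub> a' = \<one>\<^bsub>ggrp R (d - k)\<^esub>"
          using a by (intro inj) (auto simp: pairing_add_l pairing_inv_l pairing_closed QZ.r_neg)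
        then show "a = a'" using a by (metis G.inv_closed G.inv_equality G.inv_inv)
      qed
      show "?f ` carrier (component R u (d - k)) = carrier (pontrjagin_dual p (component R u k))"
      proof (intro equalityI subsetI)
        fix \<phi> assume *: "\<phi> \<in> carrier (pontrjagin_dual p (component R u k))"
        then obtain a where a: "a \<in> gcar R (d - k)" "\<forall>b\<in>gcar R k. pairing k a b = \<phi> b" using surj by blast
        have "\<phi> = ?f a"
          by (rule extensionalityI[of _ "gcar R k"]) (use * a in \<open>auto simp: pontrjagin_dual_iff\<close>)
        then show "\<phi> \<in> ?f ` carrier (component R u (d - k))" using a by auto
      qed (use dual in auto)
    qed
  qed
qed

end

context odd_prime
begin

lemma zeta_hat_bij: "bij_betw (zeta_hat p) (gcar JH (- 2)) (carrier (QpZp p))"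
proof (rule bij_betwI[where g = "\<lambda>X. jhat (- 2) (Zeta_inv X)"])
  have E: "\<exists>X\<in>carrier (QpZp p). y = jhat (- 2) (Zeta_inv X)" if "y \<in> gcar JH (- 2)" for y
    using jhat_surj[OF that] by (auto elim!: J_cases simp: null_deg_def)
  show "jhat (- 2) (Zeta_inv (zeta_hat p y)) = y" if "y \<in> gcar JH (- 2)" for y
    using E[OF that] by (auto simp: zeta_hat_jhat)
  show "zeta_hat p \<in> gcar JH (- 2) \<rightarrow> carrier (QpZp p)"
    using zeta_hat_props(1) by (auto simp: hom_def)
qed (auto simp: zeta_hat_jhat jhat_closed J_carrier_iff)

sublocale JHT: traced_algebra p JH \<upsilon> "- 2" "zeta_hat p"
proof unfold_locales
  have E: "\<exists>X\<in>carrier (QpZp p). y = jhat (- 2) (Zeta_inv X)" if "y \<in> gcar JH (- 2)" for y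
    using jhat_surj[OF that] by (auto elim!: J_cases simp: null_deg_def)
  have lin: "zeta_hat p (gmult JH 0 (- 2) (\<upsilon> a) x) = a \<odot>\<^sub>Q zeta_hat p x"
    if a: "a \<in> carrier (Zp p)" and x: "x \<in> gcar JH (- 2)" for a x
  proof -
    from E[OF x] obtain X where "X \<in> carrier (QpZp p)" "x = jhat (- 2) (Zeta_inv X)" by auto
    then show ?thesis using a by (simp add: zeta_hat_unit zeta_hat_jhat)
  qed
  show "zeta_hat p \<in> mod_iso (Zp p) (component JH \<upsilon> (- 2)) (QpZp p)"
    unfolding mod_iso_iff using zeta_hat_props(1) zeta_hat_bij lin
    by (simp add: hom_def)
qed

lemma cls_power_eq_0_iff: "cls p (of_int r / of_nat p ^ m) = \<zero>\<^sub>Q \<longleftrightarrow> int p ^ m dvd r"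
  by (simp only: QpZp_zero cls_eq_0_iff Zl_div_iff)

lemma smult_cls_power:
  "b \<in> carrier (Zp p) \<Longrightarrow> b \<odot>\<^sub>Q cls p (of_int r / of_nat p ^ m) = cls p (of_int (b m * r) / of_nat p ^ m)"
  by (subst QpZp_smult[of b m]) auto

lemma pairing_0:
  assumes "X \<in> carrier (QpZp p)" "b \<in> carrier (Zp p)"
  shows "JHT.pairing 0 (jhat (- 2) (Zeta_inv X)) (\<upsilon> b) = b \<odot>\<^sub>Q X"
  using assms JH.unit_comm[of b "jhat (- 2) (Zeta_inv X)" "- 2"] jhat_closed[of "Zeta_inv X" "- 2"]
  by (simp add: JHT.pairing_def zeta_hat_unit J_carrier_iff)

lemma pairing_m2:
  assumes "X \<in> carrier (QpZp p)" "b \<in> carrier (Zp p)"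
  shows "JHT.pairing (- 2) (\<upsilon> b) (jhat (- 2) (Zeta_inv X)) = b \<odot>\<^sub>Q X"
  using assms by (simp add: JHT.pairing_def zeta_hat_unit)

lemma pairing_alpha:
  assumes "Alpha (- j) c \<in> J_carrier p (alpha_deg p (- j))" "Alpha j e \<in> J_carrier p (alpha_deg p j)"
  shows "JHT.pairing (alpha_deg p j) (jhat (alpha_deg p (- j)) (Alpha (- j) c)) (jhat (alpha_deg p j) (Alpha j e))
    = cls p (of_int (- sgn j * c * e) / of_nat p ^ alpha_exp p j)"
proof -
  have 1: "gmult JH (alpha_deg p (- j)) (alpha_deg p j) (jhat (alpha_deg p (- j)) (Alpha (- j) c)) (jhat (alpha_deg p j) (Alpha j e))
    = jhat (alpha_deg p (- j) + alpha_deg p j) (Zeta_inv (cls p (of_int (- sgn j * c * e) / of_nat p ^ alpha_exp p j)))"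
    using jhat_mult[OF assms] by (simp add: alpha_exp_minus sgn_minus flip: cls_def)
  have "alpha_deg p (- j) + alpha_deg p j = - 2" by simp
  note 1 = 1[unfolded this]
  show ?thesis using 1 by (simp add: JHT.pairing_def zeta_hat_jhat alpha_deg_uminus[symmetric])
qed

lemma JH_null: "null_deg n \<Longrightarrow> x \<in> gcar JH n \<Longrightarrow> x = \<one>\<^bsub>ggrp JH n\<^esub>"
  using jhat_surj[of x n] jhat_zero[of n] by (auto elim!: J_cases simp: null_deg_def J_zero_simps)

lemma JH_alpha_E:
  assumes "x \<in> gcar JH (alpha_deg p k)"  "k \<noteq> 0"
  obtains c where "Alpha k c \<in> J_carrier p (alpha_deg p k)" "x = jhat (alpha_deg p k) (Alpha k c)"
proof -
  obtain y where "y \<in> J_carrier p (alpha_deg p k)" "x = jhat (alpha_deg p k) y" using jhat_surj[OF assms(1)] by auto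
  then show ?thesis using that assms(2) by (cases y) (auto simp: J_carrier_iff null_deg_def)
qed

lemma one_less_p_alpha_exp: "1 < int p ^ alpha_exp p k"
  using p_gt_1 by (intro one_less_power) (auto simp: alpha_exp_def)

lemma JH_m2_E:
  assumes "x \<in> gcar JH (- 2)"
  obtains X where "X \<in> carrier (QpZp p)" "x = jhat (- 2) (Zeta_inv X)"
proof -
  obtain y where "y \<in> J_carrier p (- 2)" "x = jhat (- 2) y" using jhat_surj[OF assms] by auto
  then show ?thesis using that by (cases y) (auto simp: J_carrier_iff null_deg_def)
qed

text \<open>
  An element that is orthogonal to \<open>1\<close>, to all classes of \<open>1/p\<^sup>m\<close>, or to \<open>\<alpha>\<^sub>j\<close>, respectively, is zero.
\<close>

lemma pairing_nondegenerate:
  assumes a: "a \<in> gcar JH (- 2 - k)" and z: "\<And>b. b \<in> gcar JH k \<Longrightarrow> JHT.pairing k a b = \<zero>\<^sub>Q"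
  shows "a = \<one>\<^bsub>ggrp JH (- 2 - k)\<^esub>"
proof (cases k rule: deg_cases)
  case Eta
  then obtain X where X: "X \<in> carrier (QpZp p)" "a = jhat (- 2) (Zeta_inv X)" using a by (auto elim: JH_m2_E)
  then have "X = \<zero>\<^sub>Q" using pairing_0[of X "\<one>\<^sub>Z"] z[of "\<upsilon> \<one>\<^sub>Z"] Eta by (simp add: JH.unit_closed)
  then show ?thesis using X Eta jhat_zero[of "- 2"] by (simp add: J_zero_simps QpZp_zero)
next
  case Zeta
  then obtain b where b: "b \<in> carrier (Zp p)" "a = \<upsilon> b" using unit_surj a by auto
  have "b n = 0" for n
  proof -
    have "b \<odot>\<^sub>Q cls p (of_int 1 / of_nat p ^ n) = \<zero>\<^sub>Q"
      using z[of "jhat (- 2) (Zeta_inv (cls p (of_int 1 / of_nat p ^ n)))"] b Zeta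
      by (simp add: pairing_m2 jhat_closed J_carrier_iff)
    then have "int p ^ n dvd b n"
      by (simp only: smult_cls_power[OF b(1)] cls_power_eq_0_iff) simp
    then show ?thesis using Zp_range[OF b(1), of n] by (metis zdvd_not_zless less_le)
  qed
  then have "b = \<zero>\<^sub>Z" by (simp add: fun_eq_iff Zp_zero)
  then show ?thesis using b Zeta unit_zero_iff[of b] by simp
next
  case (Alpha j)
  have k: "- 2 - k = alpha_deg p (- j)" using Alpha by (simp add: alpha_deg_uminus)
  obtain c where c: "Alpha (- j) c \<in> J_carrier p (alpha_deg p (- j))" "a = jhat (alpha_deg p (- j)) (Alpha (- j) c)"
    using a Alpha JH_alpha_E[of a "- j"] unfolding k by auto
  have "1 < int p ^ alpha_exp p j" by (rule one_less_p_alpha_exp)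
  then have 1: "Alpha j 1 \<in> J_carrier p (alpha_deg p j)" using Alpha by (simp add: J_carrier_iff)
  have "cls p (of_int (- sgn j * c * 1) / of_nat p ^ alpha_exp p j) = \<zero>\<^sub>Q"
    using pairing_alpha[OF c(1) 1] z[of "jhat (alpha_deg p j) (Alpha j 1)"] 1 c(2) Alpha
    by (simp add: jhat_closed)
  then have "int p ^ alpha_exp p j dvd - sgn j * c * 1" by (simp only: cls_power_eq_0_iff)
  then have "int p ^ alpha_exp p j dvd c" using Alpha by (auto simp: sgn_if split: if_splits)
  then have "c = 0" using c(1) by (auto simp: J_carrier_iff alpha_exp_minus dest: zdvd_imp_le)
  then show ?thesis using c jhat_zero[of "alpha_deg p (- j)"] Alpha unfolding k by (simp add: J_zero_simps)
next
  case Null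
  then show ?thesis using JH_null[OF null_deg_dual] a by blast
qed

text \<open>
  A functional is represented by its value at \<open>1\<close> in degree \<open>0\<close>, and by its value at \<open>\<alpha>\<^sub>j\<close>, a class killed by
  the order of \<open>\<alpha>\<^sub>j\<close>, in the degree of \<open>\<alpha>\<^sub>j\<close>. In degree \<open>-2\<close> the values \<open>c m / p\<^sup>m\<close> at the classes of \<open>1/p\<^sup>m\<close>
  satisfy \<open>c (m + 1) \<equiv> c m\<close> modulo \<open>p\<^sup>m\<close>, and the \<open>p\<close>-adic integer \<open>c\<close> represents the functional.
\<close>

lemma pairing_surjective:
  assumes "\<phi> \<in> carrier (pontrjagin_dual p (component JH \<upsilon> k))"
  shows "\<exists>a\<in>gcar JH (- 2 - k). \<forall>b\<in>gcar JH k. JHT.pairing k a b = \<phi> b"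
proof -
  have hom: "x \<in> gcar JH k \<Longrightarrow> y \<in> gcar JH k \<Longrightarrow> \<phi> (x \<otimes>\<^bsub>ggrp JH k\<^esub> y) = \<phi> x \<oplus>\<^sub>Q \<phi> y"
    "x \<in> gcar JH k \<Longrightarrow> \<phi> x \<in> carrier (QpZp p)" for x y
    using assms by (auto simp: pontrjagin_dual_iff hom_def)
  have lin: "\<phi> (gmult JH 0 k (\<upsilon> c) x) = c \<odot>\<^sub>Q \<phi> x" if "c \<in> carrier (Zp p)" "x \<in> gcar JH k" for c x
    using assms that by (auto simp: pontrjagin_dual_iff)
  show ?thesis
  proof (cases k rule: deg_cases)
    case Eta
    let ?X = "\<phi> (\<upsilon> \<one>\<^sub>Z)"
    have X: "?X \<in> carrier (QpZp p)" using hom(2)[of "\<upsilon> \<one>\<^sub>Z"] Eta by (simp add: JH.unit_closed)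
    have "JHT.pairing 0 (jhat (- 2) (Zeta_inv ?X)) b = \<phi> b" if b: "b \<in> gcar JH 0" for b
    proof -
      obtain c where c: "c \<in> carrier (Zp p)" "b = \<upsilon> c" using unit_surj[OF b] by blast
      have "b = gmult JH 0 0 (\<upsilon> c) (\<upsilon> \<one>\<^sub>Z)" using JH.unit_mult[of c "\<one>\<^sub>Z"] c by simp
      then show ?thesis using lin[of c "\<upsilon> \<one>\<^sub>Z"] c Eta X by (simp add: pairing_0 JH.unit_closed)
    qed
    then show ?thesis using X Eta by (intro bexI[of _ "jhat (- 2) (Zeta_inv ?X)"]) (auto simp: jhat_closed J_carrier_iff)
  next
    case Zeta
    define \<psi> where "\<psi> X = \<phi> (jhat (- 2) (Zeta_inv X))" for X
    have psi_lin: "\<psi> (c \<odot>\<^sub>Q X) = c \<odot>\<^sub>Q \<psi> X" if "c \<in> carrier (Zp p)" "X \<in> carrier (QpZp p)" for c X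
      using lin[of c "jhat (- 2) (Zeta_inv X)"] unit_jhat[of c "Zeta_inv X" "- 2"] that Zeta
      by (simp add: \<psi>_def jhat_closed J_carrier_iff)
    have psi_cl: "\<psi> X \<in> carrier (QpZp p)" if "X \<in> carrier (QpZp p)" for X
      using hom(2)[of "jhat (- 2) (Zeta_inv X)"] that Zeta by (simp add: \<psi>_def jhat_closed J_carrier_iff)
    have psi_Z: "\<psi> (cls p (of_int r * x)) = Zint p r \<odot>\<^sub>Q \<psi> (cls p x)" for r x
      using psi_lin[of "Zint p r" "cls p x"] by (simp add: QpZp_smult_Zint)
    let ?g = "\<lambda>m. cls p (1 / of_nat p ^ m)"
    have "\<exists>c. 0 \<le> c \<and> c < int p ^ m \<and> \<psi> (?g m) = cls p (of_int c / of_nat p ^ m)" for m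
    proof -
      obtain y where y: "\<psi> (?g m) = cls p y" using psi_cl[of "?g m"] by (auto elim: QpZp_E)
      have "cls p (of_nat p ^ m * y) = \<psi> (cls p (of_int (int p ^ m) * (1 / of_nat p ^ m)))"
        by (simp only: psi_Z y QpZp_smult_Zint) simp
      also have "\<dots> = \<psi> (cls p (of_int 0 * 1))"
        by (rule arg_cong[of _ _ \<psi>]) (simp add: cls_eq_iff)
      also have "\<dots> = cls p 0"
      proof -
        obtain z where "\<psi> (cls p 1) = cls p z" using psi_cl[of "cls p 1"] by (auto elim: QpZp_E)
        then show ?thesis unfolding psi_Z by (simp add: QpZp_smult_Zint)
      qed
      finally have "of_nat p ^ m * y \<in> Zl" by (simp only: cls_eq_0_iff)
      from QpZp_torsion_E[OF this] show ?thesis unfolding y by metis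
    qed
    then obtain c where c: "0 \<le> c m" "c m < int p ^ m" "\<psi> (?g m) = cls p (of_int (c m) / of_nat p ^ m)" for m by metis
    have cZ: "c \<in> carrier (Zp p)"
    proof (rule Zp_memI)
      fix n
      have "cls p (of_int (c n) / of_nat p ^ n) = \<psi> (cls p (of_int (int p) * (1 / of_nat p ^ Suc n)))"
        by (simp add: c)
      also have "\<dots> = cls p (of_int (int p) * (of_int (c (Suc n)) / of_nat p ^ Suc n))"
        by (simp only: psi_Z c QpZp_smult_Zint)
      finally have "of_int (c n - c (Suc n)) / of_nat p ^ n \<in> Zl"
        by (simp add: cls_eq_iff diff_divide_distrib)
      then have "int p ^ n dvd c n - c (Suc n)" by (simp only: Zl_div_iff)
      then show "int p ^ n dvd c (Suc n) - c n" by (simp add: dvd_diff_commute)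
    qed (use c in auto)
    have "JHT.pairing (- 2) (\<upsilon> c) b = \<phi> b" if b: "b \<in> gcar JH (- 2)" for b
    proof -
      obtain X where X: "X \<in> carrier (QpZp p)" "b = jhat (- 2) (Zeta_inv X)" using b by (rule JH_m2_E)
      obtain x where x: "X = cls p x" using X(1) by (rule QpZp_E)
      obtain m where "of_nat p ^ m * x \<in> Zl" using ex_denominator by blast
      then obtain r where r: "cls p x = cls p (of_int r / of_nat p ^ m)" by (rule QpZp_torsion_E)
      have "\<psi> X = \<psi> (cls p (of_int r * (1 / of_nat p ^ m)))" by (simp add: x r)
      also have "\<dots> = cls p (of_int r * (of_int (c m) / of_nat p ^ m))" by (simp only: psi_Z c QpZp_smult_Zint)
      also have "\<dots> = c \<odot>\<^sub>Q X" unfolding x r by (simp add: smult_cls_power[OF cZ] mult.commute)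
      finally show ?thesis using X cZ by (simp add: pairing_m2 \<psi>_def)
    qed
    then show ?thesis using cZ Zeta by (intro bexI[of _ "\<upsilon> c"]) (auto simp: JH.unit_closed)
  next
    case (Alpha j)
    have k: "- 2 - k = alpha_deg p (- j)" using Alpha by (simp add: alpha_deg_uminus)
    let ?e = "alpha_exp p j"
    have e: "1 < int p ^ ?e" by (rule one_less_p_alpha_exp)
    then have 1: "Alpha j 1 \<in> J_carrier p (alpha_deg p j)" using Alpha by (simp add: J_carrier_iff)
    let ?a = "jhat (alpha_deg p j) (Alpha j 1)"
    have mul: "gmult JH 0 k (\<upsilon> (Zint p c)) ?a = jhat (alpha_deg p j) (Alpha j (c mod int p ^ ?e))" for c
    proof -
      have "tors_act p (Zint p c) (Alpha j 1) = Alpha j (c mod int p ^ ?e)" by (simp add: Zint_def)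
      then show ?thesis using unit_jhat[of "Zint p c" "Alpha j 1" "alpha_deg p j"] 1 Alpha by simp
    qed
    obtain y where y: "\<phi> ?a = cls p y" using hom(2)[of ?a] jhat_closed[OF 1] Alpha by (auto elim: QpZp_E)
    have mul_phi: "\<phi> (jhat (alpha_deg p j) (Alpha j (c mod int p ^ ?e))) = cls p (of_int c * y)" for c
      using lin[of "Zint p c" ?a] jhat_closed[OF 1] Alpha y mul by (simp add: QpZp_smult_Zint)
    have "cls p (of_int (int p ^ ?e) * y) = cls p (of_int 0 * y)"
      using mul_phi[of "int p ^ ?e"] mul_phi[of 0] by simp
    then have "of_nat p ^ ?e * y \<in> Zl" by (simp add: cls_eq_iff)
    then obtain r where r: "cls p y = cls p (of_int r / of_nat p ^ ?e)" by (rule QpZp_torsion_E)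
    let ?c = "(- sgn j * r) mod int p ^ ?e"
    have c: "Alpha (- j) ?c \<in> J_carrier p (alpha_deg p (- j))"
      using Alpha by (simp add: J_carrier_iff alpha_exp_minus)
    have "JHT.pairing k (jhat (alpha_deg p (- j)) (Alpha (- j) ?c)) b = \<phi> b" if b: "b \<in> gcar JH k" for b
    proof -
      obtain f where f: "Alpha j f \<in> J_carrier p (alpha_deg p j)" "b = jhat (alpha_deg p j) (Alpha j f)"
        using b Alpha by (auto elim: JH_alpha_E)
      have "f mod int p ^ ?e = f" using f by (simp add: J_carrier_iff)
      then have "\<phi> b = cls p (of_int f * y)" using mul_phi[of f] f by simp
      also have "\<dots> = Zint p f \<odot>\<^sub>Q cls p (of_int r / of_nat p ^ ?e)" by (simp add: QpZp_smult_Zint r[symmetric])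
      also have "\<dots> = cls p (of_int (r * f) / of_nat p ^ ?e)" by (simp add: QpZp_smult_Zint mult.commute)
      also have "\<dots> = cls p (of_int (- sgn j * r * (- sgn j * f)) / of_nat p ^ ?e)"
        using Alpha by (simp add: sgn_if)
      also have "\<dots> = cls p (of_int (?c * (- sgn j * f)) / of_nat p ^ ?e)" by (rule cls_mod_div[symmetric])
      also have "\<dots> = JHT.pairing k (jhat (alpha_deg p (- j)) (Alpha (- j) ?c)) b"
        using pairing_alpha[OF c f(1)] f(2) Alpha(2) by (simp add: mult_ac)
      finally show ?thesis by simp
    qed
    then show ?thesis unfolding k using jhat_closed[OF c] by blast
  next
    case Null
    have one: "\<phi> \<one>\<^bsub>ggrp JH k\<^esub> = \<zero>\<^sub>Q"
      using hom(1)[of "\<one>\<^bsub>ggrp JH k\<^esub>" "\<one>\<^bsub>ggrp JH k\<^esub>"] hom(2)[of "\<one>\<^bsub>ggrp JH k\<^esub>"] by (simp add: QZ.add.r_cancel_one)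
    have "JHT.pairing k \<one>\<^bsub>ggrp JH (- 2 - k)\<^esub> b = \<phi> b" if "b \<in> gcar JH k" for b
      using JH.R.zero_mult[OF that, of "- 2 - k"] JH_null[OF Null that] one
      by (simp add: JHT.pairing_def JHT.zeta_one)
    then show ?thesis by (intro bexI[of _ "\<one>\<^bsub>ggrp JH (- 2 - k)\<^esub>"]) auto
  qed
qed

theorem J_hat_self_dual: "pontrjagin_self_dual p JH \<upsilon> (- 2) (zeta_hat p)"
  using pairing_nondegenerate pairing_surjective by (rule JHT.pontrjagin_self_dualI)

lemma J_hat_mult_zero:
  assumes "x \<in> gcar JH m" "y \<in> gcar JH n" "m \<noteq> 0" "n \<noteq> 0" "m + n \<noteq> - 2"
  shows "gmult JH m n x y = \<one>\<^bsub>ggrp JH (m + n)\<^esub>"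
proof -
  obtain a b where "a \<in> J_carrier p m" "b \<in> J_carrier p n" "x = jhat m a" "y = jhat n b"
    using jhat_surj assms by meson
  then show ?thesis using J_non_Eta_mult[of a m b n] assms jhat_zero by (auto simp: jhat_mult)
qed

lemma J_hat_torsion:
  assumes "x \<in> gcar JH n" "n \<noteq> 0"
  shows "\<exists>m. gmult JH 0 n (\<upsilon> (Zint p (int p ^ m))) x = \<one>\<^bsub>ggrp JH n\<^esub>"
proof -
  obtain a where a: "a \<in> J_carrier p n" "x = jhat n a" using jhat_surj assms by meson
  obtain m where m: "J_mult p 0 n (Eta (of_nat p ^ m)) a = J_zero p n" using tors_act_eq[OF a(1) assms(2)] by metis
  have "\<upsilon> (Zint p (int p ^ m)) = jhat 0 (Eta (of_nat p ^ m))"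
    using bc.pt_balanced[of "of_nat p ^ m" "\<one>\<^sub>Z" "Eta 1" 0] Zloc_to_Zp_of_int[of "int p ^ m"]
    by (simp add: unit_pt jhat_def tau_pt)
  then have "gmult JH 0 n (\<upsilon> (Zint p (int p ^ m))) x = jhat n (J_zero p n)"
    using a m jhat_mult[of "Eta (of_nat p ^ m)" 0 a n] by simp
  then show ?thesis using jhat_zero by auto
qed

text \<open>
  These are the degrees used for total incoherence: for \<open>k\<close> prime to \<open>p\<close> the generator \<open>\<alpha>\<^sub>k\<close> has order \<open>p\<close>.
\<close>

lemma J_hat_socle:
  assumes "\<not> int p dvd k"
  obtains a where "a \<in> gcar JH (alpha_deg p k)" "a \<noteq> \<one>\<^bsub>ggrp JH (alpha_deg p k)\<^esub>"
    "gmult JH 0 (alpha_deg p k) (\<upsilon> (Zint p (int p))) a = \<one>\<^bsub>ggrp JH (alpha_deg p k)\<^esub>"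
    "\<And>x. x \<in> gcar JH (alpha_deg p k) \<Longrightarrow> \<exists>c\<in>carrier (Zp p). x = gmult JH 0 (alpha_deg p k) (\<upsilon> c) a"
proof -
  have k: "k \<noteq> 0" "alpha_exp p k = 1" using assms by (auto simp: alpha_exp_def not_dvd_imp_multiplicity_0)
  have 1: "Alpha k 1 \<in> J_carrier p (alpha_deg p k)" using p_gt_1 k by (simp add: J_carrier_iff)
  have mul: "gmult JH 0 (alpha_deg p k) (\<upsilon> (Zint p c)) (jhat (alpha_deg p k) (Alpha k 1)) = jhat (alpha_deg p k) (Alpha k (c mod int p))" for c
  proof -
    have "tors_act p (Zint p c) (Alpha k 1) = Alpha k (c mod int p)" using k by (simp add: Zint_def)
    then show ?thesis using unit_jhat[of "Zint p c" "Alpha k 1" "alpha_deg p k"] 1 by simp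
  qed
  show ?thesis
  proof (rule that[of "jhat (alpha_deg p k) (Alpha k 1)"])
    show "jhat (alpha_deg p k) (Alpha k 1) \<noteq> \<one>\<^bsub>ggrp JH (alpha_deg p k)\<^esub>"
      using jhat_eq_one_iff[of "alpha_deg p k" "Alpha k 1"] 1 k by (simp add: J_zero_simps)
    show "gmult JH 0 (alpha_deg p k) (\<upsilon> (Zint p (int p))) (jhat (alpha_deg p k) (Alpha k 1)) = \<one>\<^bsub>ggrp JH (alpha_deg p k)\<^esub>"
      using mul[of "int p"] jhat_zero[of "alpha_deg p k"] k by (simp add: J_zero_simps)
    fix x assume "x \<in> gcar JH (alpha_deg p k)"
    then obtain c where "Alpha k c \<in> J_carrier p (alpha_deg p k)" "x = jhat (alpha_deg p k) (Alpha k c)"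
      using k JH_alpha_E by metis
    then show "\<exists>c\<in>carrier (Zp p). x = gmult JH 0 (alpha_deg p k) (\<upsilon> c) (jhat (alpha_deg p k) (Alpha k 1))"
      using mul[of c] k by (intro bexI[of _ "Zint p c"]) (auto simp: J_carrier_iff)
  qed (rule jhat_closed[OF 1])
qed

end

section \<open>Self-injectivity\<close>

text \<open>
  Graphs of linear maps from submodules of \<open>N\<close> to \<open>\<rat>\<^sub>p/\<int>\<^sub>p\<close>: as sets they are ordered by inclusion,
  which is the order of extension needed for Zorn's lemma. The last condition makes a graph
  single-valued, since the others make it a submodule.
\<close>

definition linear_graph :: "nat \<Rightarrow> (nat \<Rightarrow> int, 'm) module \<Rightarrow> ('m \<times> rat set) set \<Rightarrow> bool"
  where "linear_graph p N G \<longleftrightarrow>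
    G \<subseteq> carrier N \<times> carrier (QpZp p) \<and> (\<zero>\<^bsub>N\<^esub>, \<zero>\<^bsub>QpZp p\<^esub>) \<in> G \<and>
    (\<forall>x y x' y'. (x, y) \<in> G \<longrightarrow> (x', y') \<in> G \<longrightarrow> (x \<oplus>\<^bsub>N\<^esub> x', y \<oplus>\<^bsub>QpZp p\<^esub> y') \<in> G) \<and>
    (\<forall>a x y. a \<in> carrier (Zp p) \<longrightarrow> (x, y) \<in> G \<longrightarrow> (a \<odot>\<^bsub>N\<^esub> x, a \<odot>\<^bsub>QpZp p\<^esub> y) \<in> G) \<and>
    (\<forall>y. (\<zero>\<^bsub>N\<^esub>, y) \<in> G \<longrightarrow> y = \<zero>\<^bsub>QpZp p\<^esub>)"

locale Zp_module = prime_num p + N: module "Zp p" N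
  for p and N :: "(nat \<Rightarrow> int, 'm) module"
begin

sublocale QZ: module "Zp p" "QpZp p" by (rule QpZp_module)

lemma linear_graphD:
  assumes "linear_graph p N G"
  shows "(x, y) \<in> G \<Longrightarrow> x \<in> carrier N" "(x, y) \<in> G \<Longrightarrow> y \<in> carrier (QpZp p)"
    "(x, y) \<in> G \<Longrightarrow> (x', y') \<in> G \<Longrightarrow> (x \<oplus>\<^bsub>N\<^esub> x', y \<oplus>\<^sub>Q y') \<in> G"
    "a \<in> carrier (Zp p) \<Longrightarrow> (x, y) \<in> G \<Longrightarrow> (a \<odot>\<^bsub>N\<^esub> x, a \<odot>\<^sub>Q y) \<in> G"
    "(\<zero>\<^bsub>N\<^esub>, y) \<in> G \<Longrightarrow> y = \<zero>\<^sub>Q" "(\<zero>\<^bsub>N\<^esub>, \<zero>\<^sub>Q) \<in> G"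
proof -
  note c = assms[unfolded linear_graph_def]
  note c1 = c[THEN conjunct1] and c2 = c[THEN conjunct2]
  note c3 = c2[THEN conjunct2] note c4 = c3[THEN conjunct2] note c5 = c4[THEN conjunct2]
  show "(x, y) \<in> G \<Longrightarrow> x \<in> carrier N" "(x, y) \<in> G \<Longrightarrow> y \<in> carrier (QpZp p)" using c1 by auto
  show "(\<zero>\<^bsub>N\<^esub>, \<zero>\<^sub>Q) \<in> G" by (rule c2[THEN conjunct1])
  show "(x, y) \<in> G \<Longrightarrow> (x', y') \<in> G \<Longrightarrow> (x \<oplus>\<^bsub>N\<^esub> x', y \<oplus>\<^sub>Q y') \<in> G"
    using c3[THEN conjunct1] by simp
  show "a \<in> carrier (Zp p) \<Longrightarrow> (x, y) \<in> G \<Longrightarrow> (a \<odot>\<^bsub>N\<^esub> x, a \<odot>\<^sub>Q y) \<in> G"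
    using c4[THEN conjunct1] by simp
  show "(\<zero>\<^bsub>N\<^esub>, y) \<in> G \<Longrightarrow> y = \<zero>\<^sub>Q" using c5 by simp
qed

lemma linear_graph_minus:
  assumes "linear_graph p N G" "(x, y) \<in> G" shows "(\<ominus>\<^bsub>N\<^esub> x, \<ominus>\<^sub>Q y) \<in> G"
proof -
  note D = linear_graphD[OF assms(1)]
  have "(\<ominus>\<^bsub>Zp p\<^esub> \<one>\<^sub>Z) \<odot>\<^bsub>N\<^esub> x = \<ominus>\<^bsub>N\<^esub> x" "(\<ominus>\<^bsub>Zp p\<^esub> \<one>\<^sub>Z) \<odot>\<^sub>Q y = \<ominus>\<^sub>Q y"
    using D(1,2)[OF assms(2)] by (simp_all add: N.smult_l_minus QZ.smult_l_minus)
  then show ?thesis using D(4)[OF _ assms(2), of "\<ominus>\<^bsub>Zp p\<^esub> \<one>\<^sub>Z"] by simp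
qed

lemma linear_graph_unique:
  assumes "linear_graph p N G" "(x, y) \<in> G" "(x, y') \<in> G" shows "y = y'"
proof -
  note D = linear_graphD[OF assms(1)]
  have "(x \<oplus>\<^bsub>N\<^esub> \<ominus>\<^bsub>N\<^esub> x, y \<oplus>\<^sub>Q \<ominus>\<^sub>Q y') \<in> G"
    using D(3)[OF assms(2) linear_graph_minus[OF assms(1,3)]] .
  then have "y \<oplus>\<^sub>Q \<ominus>\<^sub>Q y' = \<zero>\<^sub>Q" using D(1)[OF assms(2)] by (simp add: N.r_neg D(5))
  then show ?thesis using D(2) assms by (metis QZ.a_inv_closed QZ.minus_equality QZ.minus_minus)
qed

text \<open>
  The scalars that map \<open>x\<close> into the domain of \<open>G\<close> form the ideal of a power of \<open>p\<close>, or zero. Since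
  \<open>\<rat>\<^sub>p/\<int>\<^sub>p\<close> is divisible, a value for \<open>x\<close> that agrees with \<open>G\<close> on these multiples exists.
\<close>

lemma linear_graph_compatible_value:
  assumes G: "linear_graph p N G" and x: "x \<in> carrier N"
  obtains y where "y \<in> carrier (QpZp p)"
    "\<And>a w. a \<in> carrier (Zp p) \<Longrightarrow> (a \<odot>\<^bsub>N\<^esub> x, w) \<in> G \<Longrightarrow> w = a \<odot>\<^sub>Q y"
proof -
  note D = linear_graphD[OF G]
  let ?P = "\<lambda>n. \<exists>w. (Zint p (int p ^ n) \<odot>\<^bsub>N\<^esub> x, w) \<in> G"
  have pow: "?P m" if a: "a \<in> carrier (Zp p)" "a = Zint p (int p ^ m) \<otimes>\<^sub>Z u" "u \<in> carrier (Zp p)"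
      "v \<in> carrier (Zp p)" "u \<otimes>\<^sub>Z v = \<one>\<^sub>Z" "(a \<odot>\<^bsub>N\<^esub> x, w) \<in> G" for a m u v w
  proof -
    have "v \<otimes>\<^sub>Z (Zint p (int p ^ m) \<otimes>\<^sub>Z u) = Zint p (int p ^ m) \<otimes>\<^sub>Z (u \<otimes>\<^sub>Z v)"
      using a(3,4) by (simp add: N.m_ac)
    then have "v \<otimes>\<^sub>Z a = Zint p (int p ^ m)" using a(2,5) by simp
    then have "v \<odot>\<^bsub>N\<^esub> (a \<odot>\<^bsub>N\<^esub> x) = Zint p (int p ^ m) \<odot>\<^bsub>N\<^esub> x"
      using a x by (simp add: N.smult_assoc1[symmetric])
    then show ?thesis using D(4)[OF a(4,6)] by auto
  qed
  show ?thesis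
  proof (cases "\<exists>n. ?P n")
    case True
    then obtain n where n: "?P n" and least: "\<And>m. m < n \<Longrightarrow> \<not> ?P m" using exists_least_iff[of ?P] by blast
    obtain w where w: "(Zint p (int p ^ n) \<odot>\<^bsub>N\<^esub> x, w) \<in> G" using n by blast
    obtain c where c: "w = cls p c" using D(2)[OF w] by (rule QpZp_E)
    let ?y = "cls p (c / of_nat p ^ n)"
    have y: "Zint p (int p ^ n) \<odot>\<^sub>Q ?y = w" by (simp add: c QpZp_smult_Zint)
    show ?thesis
    proof (rule that[of ?y])
      fix a w' assume a: "a \<in> carrier (Zp p)" and w': "(a \<odot>\<^bsub>N\<^esub> x, w') \<in> G"
      have an: "a n = 0"
      proof (rule ccontr)
        assume an: "a n \<noteq> 0"
        then have "a \<noteq> \<zero>\<^sub>Z" by (auto simp: Zp_zero)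
        then obtain m u v where m: "u \<in> carrier (Zp p)" "v \<in> carrier (Zp p)" "u \<otimes>\<^sub>Z v = \<one>\<^sub>Z"
          "a = Zint p (int p ^ m) \<otimes>\<^sub>Z u" "a m = 0" using Zp_decompose[OF a] by metis
        have "m < n" using Zp_mod[OF a, of n m] m(5) an by (cases "m < n") auto
        then show False using least pow[OF a m(4,1,2,3) w'] by blast
      qed
      obtain b where b: "b \<in> carrier (Zp p)" "a = Zint p (int p ^ n) \<otimes>\<^sub>Z b" using Zp_divisible[OF a an] by blast
      have "a \<odot>\<^bsub>N\<^esub> x = b \<odot>\<^bsub>N\<^esub> (Zint p (int p ^ n) \<odot>\<^bsub>N\<^esub> x)" "a \<odot>\<^sub>Q ?y = b \<odot>\<^sub>Q w"
        unfolding y[symmetric] using b x by (simp_all add: N.smult_assoc1[symmetric] QZ.smult_assoc1[symmetric] N.m_comm)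
      then show "w' = a \<odot>\<^sub>Q ?y" using linear_graph_unique[OF G w'] D(4)[OF b(1) w] by simp
    qed simp
  next
    case False
    show ?thesis
    proof (rule that[of "\<zero>\<^sub>Q"])
      fix a w' assume a: "a \<in> carrier (Zp p)" and w': "(a \<odot>\<^bsub>N\<^esub> x, w') \<in> G"
      have "a = \<zero>\<^sub>Z"
      proof (rule ccontr)
        assume "a \<noteq> \<zero>\<^sub>Z"
        then obtain m u v where m: "u \<in> carrier (Zp p)" "v \<in> carrier (Zp p)" "u \<otimes>\<^sub>Z v = \<one>\<^sub>Z"
          "a = Zint p (int p ^ m) \<otimes>\<^sub>Z u" using Zp_decompose[OF a] by metis
        then show False using False pow[OF a m(4,1,2,3) w'] by blast
      qed
      then show "w' = a \<odot>\<^sub>Q \<zero>\<^sub>Q" using w' x D(5)[of w'] by simp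
    qed simp
  qed
qed

lemma linear_graph_extend:
  assumes G: "linear_graph p N G" and x: "x \<in> carrier N"
  shows "\<exists>G'. linear_graph p N G' \<and> G \<subseteq> G' \<and> x \<in> Domain G'"
proof -
  note D = linear_graphD[OF G]
  obtain y where y: "y \<in> carrier (QpZp p)"
    and comp: "\<And>a w. a \<in> carrier (Zp p) \<Longrightarrow> (a \<odot>\<^bsub>N\<^esub> x, w) \<in> G \<Longrightarrow> w = a \<odot>\<^sub>Q y"
    using linear_graph_compatible_value[OF G x] by metis
  define G' where "G' = {(g \<oplus>\<^bsub>N\<^esub> a \<odot>\<^bsub>N\<^esub> x, h \<oplus>\<^sub>Q a \<odot>\<^sub>Q y) | g h a. (g, h) \<in> G \<and> a \<in> carrier (Zp p)}"
  have I: "(g \<oplus>\<^bsub>N\<^esub> a \<odot>\<^bsub>N\<^esub> x, h \<oplus>\<^sub>Q a \<odot>\<^sub>Q y) \<in> G'" if "(g, h) \<in> G" "a \<in> carrier (Zp p)" for g h a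
    using that unfolding G'_def by blast
  have E: "\<exists>g h a. (g, h) \<in> G \<and> a \<in> carrier (Zp p) \<and> s = g \<oplus>\<^bsub>N\<^esub> a \<odot>\<^bsub>N\<^esub> x \<and> t = h \<oplus>\<^sub>Q a \<odot>\<^sub>Q y"
    if "(s, t) \<in> G'" for s t
    using that unfolding G'_def by blast
  have sub: "(g, h) \<in> G'" if "(g, h) \<in> G" for g h
    using I[OF that N.R.zero_closed] x y D(1,2)[OF that] by simp
  have "linear_graph p N G'"
    unfolding linear_graph_def
  proof (intro conjI allI impI)
    show "G' \<subseteq> carrier N \<times> carrier (QpZp p)" using x y D(1,2) by (auto simp: G'_def)
    show "(\<zero>\<^bsub>N\<^esub>, \<zero>\<^sub>Q) \<in> G'" using sub D(6) by blast
  next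
    fix s t s' t' assume "(s, t) \<in> G'" "(s', t') \<in> G'"
    then obtain g h a g' h' a' where *: "(g, h) \<in> G" "a \<in> carrier (Zp p)" "s = g \<oplus>\<^bsub>N\<^esub> a \<odot>\<^bsub>N\<^esub> x" "t = h \<oplus>\<^sub>Q a \<odot>\<^sub>Q y"
      "(g', h') \<in> G" "a' \<in> carrier (Zp p)" "s' = g' \<oplus>\<^bsub>N\<^esub> a' \<odot>\<^bsub>N\<^esub> x" "t' = h' \<oplus>\<^sub>Q a' \<odot>\<^sub>Q y"
      using E by metis
    have "s \<oplus>\<^bsub>N\<^esub> s' = (g \<oplus>\<^bsub>N\<^esub> g') \<oplus>\<^bsub>N\<^esub> (a \<oplus>\<^sub>Z a') \<odot>\<^bsub>N\<^esub> x"
      "t \<oplus>\<^sub>Q t' = (h \<oplus>\<^sub>Q h') \<oplus>\<^sub>Q (a \<oplus>\<^sub>Z a') \<odot>\<^sub>Q y"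
      using * x y D(1)[OF *(1)] D(1)[OF *(5)] D(2)[OF *(1)] D(2)[OF *(5)]
      by (simp_all add: N.smult_l_distr QZ.smult_l_distr N.M.a_ac QZ.M.a_ac)
    then show "(s \<oplus>\<^bsub>N\<^esub> s', t \<oplus>\<^sub>Q t') \<in> G'"
      using I[OF D(3)[OF *(1,5)], of "a \<oplus>\<^sub>Z a'"] * by simp
  next
    fix b s t assume b: "b \<in> carrier (Zp p)" and "(s, t) \<in> G'"
    then obtain g h a where *: "(g, h) \<in> G" "a \<in> carrier (Zp p)" "s = g \<oplus>\<^bsub>N\<^esub> a \<odot>\<^bsub>N\<^esub> x" "t = h \<oplus>\<^sub>Q a \<odot>\<^sub>Q y"
      using E by metis
    have "b \<odot>\<^bsub>N\<^esub> s = b \<odot>\<^bsub>N\<^esub> g \<oplus>\<^bsub>N\<^esub> (b \<otimes>\<^sub>Z a) \<odot>\<^bsub>N\<^esub> x"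
      "b \<odot>\<^sub>Q t = b \<odot>\<^sub>Q h \<oplus>\<^sub>Q (b \<otimes>\<^sub>Z a) \<odot>\<^sub>Q y"
      using * b x y D(1,2)[OF *(1)]
      by (simp_all add: N.smult_r_distr QZ.smult_r_distr N.smult_assoc1 QZ.smult_assoc1)
    then show "(b \<odot>\<^bsub>N\<^esub> s, b \<odot>\<^sub>Q t) \<in> G'"
      using I[OF D(4)[OF b *(1)], of "b \<otimes>\<^sub>Z a"] * b by simp
  next
    fix t assume "(\<zero>\<^bsub>N\<^esub>, t) \<in> G'"
    then obtain g h a where *: "(g, h) \<in> G" "a \<in> carrier (Zp p)" "\<zero>\<^bsub>N\<^esub> = g \<oplus>\<^bsub>N\<^esub> a \<odot>\<^bsub>N\<^esub> x" "t = h \<oplus>\<^sub>Q a \<odot>\<^sub>Q y"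
      using E by metis
    have cl: "g \<in> carrier N" "h \<in> carrier (QpZp p)" using D(1,2)[OF *(1)] .
    have "\<ominus>\<^bsub>N\<^esub> g = a \<odot>\<^bsub>N\<^esub> x"
      using *(2,3) cl x by (intro N.minus_equality) (auto simp: N.M.a_comm)
    then have "\<ominus>\<^sub>Q h = a \<odot>\<^sub>Q y"
      using linear_graph_minus[OF G *(1)] comp[OF *(2)] by simp
    then show "t = \<zero>\<^sub>Q" using *(4) cl by (metis QZ.r_neg)
  qed
  moreover have "(x, y) \<in> G'"
    using I[OF D(6) N.one_closed] x y by simp
  ultimately show ?thesis using sub by (intro exI[of _ G']) auto
qed

text \<open>A maximal graph has all of \<open>N\<close> as its domain, as it could be extended otherwise.\<close>

lemma QpZp_injective:
  assumes G: "linear_graph p N G"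
  obtains g where "g \<in> carrier N \<rightarrow> carrier (QpZp p)"
    "\<And>x y. x \<in> carrier N \<Longrightarrow> y \<in> carrier N \<Longrightarrow> g (x \<oplus>\<^bsub>N\<^esub> y) = g x \<oplus>\<^sub>Q g y"
    "\<And>a x. a \<in> carrier (Zp p) \<Longrightarrow> x \<in> carrier N \<Longrightarrow> g (a \<odot>\<^bsub>N\<^esub> x) = a \<odot>\<^sub>Q g x"
    "\<And>x y. (x, y) \<in> G \<Longrightarrow> g x = y"
proof -
  let ?S = "{H. linear_graph p N H \<and> G \<subseteq> H}"
  have "\<exists>H\<in>?S. \<forall>X\<in>?S. H \<subseteq> X \<longrightarrow> X = H"
  proof (rule subset_Zorn_nonempty)
    show "?S \<noteq> {}" using G by blast
    fix C assume C: "C \<noteq> {}" "subset.chain ?S C"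
    then have lg: "linear_graph p N H" "G \<subseteq> H" if "H \<in> C" for H using that by (auto simp: subset.chain_def)
    have two: "\<exists>H\<in>C. s \<in> H \<and> t \<in> H" if "s \<in> \<Union>C" "t \<in> \<Union>C" for s t
      using that C(2) unfolding subset.chain_def by blast
    have "linear_graph p N (\<Union>C)"
      unfolding linear_graph_def
    proof (intro conjI allI impI)
      show "\<Union>C \<subseteq> carrier N \<times> carrier (QpZp p)" using lg(1) by (fastforce simp: linear_graph_def)
      show "(\<zero>\<^bsub>N\<^esub>, \<zero>\<^sub>Q) \<in> \<Union>C" using C(1) linear_graphD(6)[OF lg(1)] by blast
    next
      fix s t s' t' assume "(s, t) \<in> \<Union>C" "(s', t') \<in> \<Union>C"
      then obtain H where "H \<in> C" "(s, t) \<in> H" "(s', t') \<in> H" using two by meson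
      then show "(s \<oplus>\<^bsub>N\<^esub> s', t \<oplus>\<^sub>Q t') \<in> \<Union>C" using linear_graphD(3)[OF lg(1)] by blast
    next
      fix b s t assume "b \<in> carrier (Zp p)" "(s, t) \<in> \<Union>C"
      then show "(b \<odot>\<^bsub>N\<^esub> s, b \<odot>\<^sub>Q t) \<in> \<Union>C" using linear_graphD(4)[OF lg(1)] by blast
    next
      fix t assume "(\<zero>\<^bsub>N\<^esub>, t) \<in> \<Union>C"
      then show "t = \<zero>\<^sub>Q" using linear_graphD(5)[OF lg(1)] by blast
    qed
    moreover have "G \<subseteq> \<Union>C" using C(1) lg(2) by blast
    ultimately show "\<Union>C \<in> ?S" by blast
  qed
  then obtain H where H: "linear_graph p N H" "G \<subseteq> H" and max: "\<And>X. linear_graph p N X \<Longrightarrow> H \<subseteq> X \<Longrightarrow> X = H"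
    by auto
  note D = linear_graphD[OF H(1)]
  have "x \<in> Domain H" if "x \<in> carrier N" for x
    using linear_graph_extend[OF H(1) that] max by blast
  then have "\<exists>y. (x, y) \<in> H" if "x \<in> carrier N" for x using that by blast
  then obtain g where g: "\<And>x. x \<in> carrier N \<Longrightarrow> (x, g x) \<in> H" by metis
  have gI: "g x = y" if "(x, y) \<in> H" for x y using linear_graph_unique[OF H(1) g[OF D(1)[OF that]] that] .
  show ?thesis
  proof (rule that[of g])
    show "g \<in> carrier N \<rightarrow> carrier (QpZp p)" using g D(2) by blast
    show "g (x \<oplus>\<^bsub>N\<^esub> y) = g x \<oplus>\<^sub>Q g y" if "x \<in> carrier N" "y \<in> carrier N" for x y
      by (rule gI[OF D(3)[OF g[OF that(1)] g[OF that(2)]]])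
    show "g (a \<odot>\<^bsub>N\<^esub> x) = a \<odot>\<^sub>Q g x" if "a \<in> carrier (Zp p)" "x \<in> carrier N" for a x
      by (rule gI[OF D(4)[OF that(1) g[OF that(2)]]])
    show "g x = y" if "(x, y) \<in> G" for x y using gI that H(2) by blast
  qed
qed

end

definition mod_component :: "('a, 'm) gmod \<Rightarrow> ('c \<Rightarrow> 'a) \<Rightarrow> int \<Rightarrow> ('c, 'm) module"
  where "mod_component N u n =
    \<lparr>carrier = mcar N n, monoid.mult = undefined, one = undefined, ring.zero = \<one>\<^bsub>mgrp N n\<^esub>,
     ring.add = (\<otimes>\<^bsub>mgrp N n\<^esub>), smult = (\<lambda>a x. gsmult N 0 n (u a) x)\<rparr>"

lemma mod_component_simps [simp]:
  "carrier (mod_component N u n) = mcar N n" "x \<oplus>\<^bsub>mod_component N u n\<^esub> y = x \<otimes>\<^bsub>mgrp N n\<^esub> y"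
  "\<zero>\<^bsub>mod_component N u n\<^esub> = \<one>\<^bsub>mgrp N n\<^esub>" "a \<odot>\<^bsub>mod_component N u n\<^esub> x = gsmult N 0 n (u a) x"
  by (simp_all add: mod_component_def)

lemma (in graded_algebra) module_component:
  fixes N :: "('a, 'm) gmod"
  assumes "graded_module R N"
  shows "module A (mod_component N u n)"
proof -
  interpret N: graded_module R N by fact
  interpret NG: comm_group "mgrp N k" for k by (rule N.mod_comm_group)
  note u = unit_closed
  have ag: "abelian_group (mod_component N u n)"
  proof (rule abelian_groupI)
    fix x assume "x \<in> carrier (mod_component N u n)"
    then show "\<exists>y\<in>carrier (mod_component N u n). y \<oplus>\<^bsub>mod_component N u n\<^esub> x = \<zero>\<^bsub>mod_component N u n\<^esub>"
      by (intro bexI[of _ "inv\<^bsub>mgrp N n\<^esub> x"]) auto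
  qed (auto simp: NG.m_ac)
  show ?thesis
  proof (rule moduleI)
    show "cring A" by (rule A.cring_axioms)
    show "abelian_group (mod_component N u n)" by (rule ag)
  next
    fix a b x assume "a \<in> carrier A" "b \<in> carrier A" "x \<in> carrier (mod_component N u n)"
    then show "(a \<otimes>\<^bsub>A\<^esub> b) \<odot>\<^bsub>mod_component N u n\<^esub> x = a \<odot>\<^bsub>mod_component N u n\<^esub> (b \<odot>\<^bsub>mod_component N u n\<^esub> x)"
      using N.smult_assoc[of "u a" 0 "u b" 0 x n] u by (simp add: unit_mult)
    show "(a \<oplus>\<^bsub>A\<^esub> b) \<odot>\<^bsub>mod_component N u n\<^esub> x = a \<odot>\<^bsub>mod_component N u n\<^esub> x \<oplus>\<^bsub>mod_component N u n\<^esub> b \<odot>\<^bsub>mod_component N u n\<^esub> x"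
      using N.smult_l_distr[of "u a" 0 "u b" x n] u unit_hom \<open>a \<in> carrier A\<close> \<open>b \<in> carrier A\<close> \<open>x \<in> _\<close>
      by (simp add: hom_def)
  next
    fix a x y assume "a \<in> carrier A" "x \<in> carrier (mod_component N u n)" "y \<in> carrier (mod_component N u n)"
    then show "a \<odot>\<^bsub>mod_component N u n\<^esub> (x \<oplus>\<^bsub>mod_component N u n\<^esub> y) =
       a \<odot>\<^bsub>mod_component N u n\<^esub> x \<oplus>\<^bsub>mod_component N u n\<^esub> a \<odot>\<^bsub>mod_component N u n\<^esub> y"
      using N.smult_r_distr[of "u a" 0 x n y] u by simp
  next
    fix a x assume "a \<in> carrier A" "x \<in> carrier (mod_component N u n)"
    then show "a \<odot>\<^bsub>mod_component N u n\<^esub> x \<in> carrier (mod_component N u n)"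
      using N.smult_closed[of "u a" 0 x n] u by simp
  qed (simp add: unit_one N.smult_one)
qed

lemma (in graded_comm_ring) regular_graded_module: "graded_module R (regular_gmod R)"
  by (intro graded_module.intro graded_module_axioms.intro graded_comm_ring_axioms)
    (simp_all add: regular_gmod_def comm_group mult_closed l_distr r_distr assoc l_one)

context traced_algebra
begin

text \<open>
  Duality represents functionals as \<open>b \<mapsto> \<zeta> (a b)\<close>. For left modules the form \<open>b \<mapsto> \<zeta> (b a)\<close> is needed; by
  graded commutativity the two representing elements differ by a sign that depends only on the degrees.
\<close>

lemma dual_representation:
  assumes sd: "pontrjagin_self_dual p R u d \<zeta>"
    and \<phi>: "\<And>b. b \<in> gcar R (d - n) \<Longrightarrow> \<phi> b \<in> carrier (QpZp p)"
      "\<And>b b'. b \<in> gcar R (d - n) \<Longrightarrow> b' \<in> gcar R (d - n) \<Longrightarrow>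
        \<phi> (b \<otimes>\<^bsub>ggrp R (d - n)\<^esub> b') = \<phi> b \<oplus>\<^sub>Q \<phi> b'"
      "\<And>a b. a \<in> carrier (Zp p) \<Longrightarrow> b \<in> gcar R (d - n) \<Longrightarrow>
        \<phi> (gmult R 0 (d - n) (u a) b) = a \<odot>\<^sub>Q \<phi> b"
  shows "\<exists>!a. a \<in> gcar R n \<and> (\<forall>b\<in>gcar R (d - n). \<zeta> (gmult R (d - n) n b a) = \<phi> b)"
proof -
  let ?k = "d - n"
  define s where "s a = (if even (?k * n) then a else inv\<^bsub>ggrp R n\<^esub> a)" for a
  have s_cl: "s a \<in> gcar R n" if "a \<in> gcar R n" for a using that by (simp add: s_def)
  have s_s: "s (s a) = a" if "a \<in> gcar R n" for a using that by (simp add: s_def)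
  have sign: "gmult R ?k n b a = gmult R n ?k (s a) b" if "a \<in> gcar R n" "b \<in> gcar R ?k" for a b
    using R.graded_comm[of a n b ?k] R.inv_mult_l[of a n b ?k] that
    by (simp add: s_def mult.commute add.commute)
  let ?f = "\<lambda>a. \<lambda>b\<in>gcar R ?k. \<zeta> (gmult R n ?k a b)"
  have "?f \<in> mod_iso (Zp p) (component R u n) (pontrjagin_dual p (component R u ?k))"
    using sd unfolding pontrjagin_self_dual_def by (elim conjE allE[where x = ?k]) simp
  then have bij: "bij_betw ?f (gcar R n) (carrier (pontrjagin_dual p (component R u ?k)))"
    by (simp add: mod_iso_iff)
  have mem: "restrict \<phi> (gcar R ?k) \<in> carrier (pontrjagin_dual p (component R u ?k))"
    unfolding pontrjagin_dual_iff using \<phi> R.mult_closed[of _ 0 _ ?k] unit_closed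
    by (auto simp: hom_def)
  obtain a where a: "a \<in> gcar R n" "?f a = restrict \<phi> (gcar R ?k)"
  proof -
    have "restrict \<phi> (gcar R ?k) \<in> ?f ` gcar R n" using bij_betw_imp_surj_on[OF bij] mem by simp
    then show ?thesis using that by (elim imageE) simp
  qed
  show ?thesis
  proof (rule ex1I[of _ "s a"])
    have "\<zeta> (gmult R n ?k a b) = \<phi> b" if "b \<in> gcar R ?k" for b
      using fun_cong[OF a(2), of b] that by simp
    then show "s a \<in> gcar R n \<and> (\<forall>b\<in>gcar R ?k. \<zeta> (gmult R ?k n b (s a)) = \<phi> b)"
      using a(1) by (simp add: s_cl sign s_s)
  next
    fix a' assume a': "a' \<in> gcar R n \<and> (\<forall>b\<in>gcar R ?k. \<zeta> (gmult R ?k n b a') = \<phi> b)"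
    have "gmult R n ?k (s a') b = gmult R ?k n b a'" if "b \<in> gcar R ?k" for b
      using sign[of a' b] a' that by simp
    then have "?f (s a') = restrict \<phi> (gcar R ?k)" using a' by (intro restrict_ext) simp
    then have "?f (s a') = ?f a" using a(2) by simp
    then have "s a' = a" by (rule inj_onD[OF bij_betw_imp_inj_on[OF bij]]) (use a a' s_cl in auto)
    then show "a' = s a" using a' s_s by auto
  qed
qed

text \<open>
  The value \<open>h z\<close> is characterised by \<open>\<zeta> (b \<cdot> h z) = g (b z)\<close> for all \<open>b\<close>. Additivity, linearity and
  the extension property of \<open>h\<close> follow since both sides of each equation have the same characterisation.
\<close>

theorem self_dual_imp_self_injective:
  assumes sd: "pontrjagin_self_dual p R u d \<zeta>"
  shows "self_injective TYPE('m) TYPE('n) R"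
  unfolding self_injective_def injective_gmod_def
proof (intro conjI allI impI R.regular_graded_module)
  fix M :: "('a, 'm) gmod" and N :: "('a, 'n) gmod" and i f
  assume "graded_module R M" "graded_module R N" and i: "i \<in> gmod_hom R M N" and inj: "\<forall>n. inj_on (i n) (mcar M n)"
    and f: "f \<in> gmod_hom R M (regular_gmod R)"
  interpret M: graded_module R M by fact
  interpret N: graded_module R N by fact
  interpret MG: comm_group "mgrp M k" for k by (rule M.mod_comm_group)
  interpret NG: comm_group "mgrp N k" for k by (rule N.mod_comm_group)
  interpret Nd: Zp_module p "mod_component N u d"
    by (intro Zp_module.intro prime_num_axioms module_component[OF \<open>graded_module R N\<close>])
  have i_hom: "i n \<in> hom (mgrp M n) (mgrp N n)" for n using i by (simp add: gmod_hom_def)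
  have i_cl: "i n x \<in> mcar N n" if "x \<in> mcar M n" for n x using i_hom[of n] that by (auto simp: hom_def)
  have i_add: "i n (x \<otimes>\<^bsub>mgrp M n\<^esub> y) = i n x \<otimes>\<^bsub>mgrp N n\<^esub> i n y" if "x \<in> mcar M n" "y \<in> mcar M n" for n x y
    using i_hom[of n] that by (auto simp: hom_def)
  have i_lin: "i (m + n) (gsmult M m n a x) = gsmult N m n a (i n x)" if "a \<in> gcar R m" "x \<in> mcar M n" for m n a x
    using i that by (simp add: gmod_hom_def)
  have f_hom: "f n \<in> hom (mgrp M n) (ggrp R n)" for n using f by (simp add: gmod_hom_def regular_gmod_def)
  have f_cl: "f n x \<in> gcar R n" if "x \<in> mcar M n" for n x using f_hom[of n] that by (auto simp: hom_def)
  have f_add: "f n (x \<otimes>\<^bsub>mgrp M n\<^esub> y) = f n x \<otimes>\<^bsub>ggrp R n\<^esub> f n y" if "x \<in> mcar M n" "y \<in> mcar M n" for n x y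
    using f_hom[of n] that by (auto simp: hom_def)
  have f_lin: "f (m + n) (gsmult M m n a x) = gmult R m n a (f n x)" if "a \<in> gcar R m" "x \<in> mcar M n" for m n a x
    using f that by (simp add: gmod_hom_def regular_gmod_def)
  have one: "i n \<one>\<^bsub>mgrp M n\<^esub> = \<one>\<^bsub>mgrp N n\<^esub>" "f n \<one>\<^bsub>mgrp M n\<^esub> = \<one>\<^bsub>ggrp R n\<^esub>" for n
    using hom_one[OF i_hom MG.is_group NG.is_group] hom_one[OF f_hom MG.is_group G.is_group] by auto
  define G0 where "G0 = {(i d x, \<zeta> (f d x)) | x. x \<in> mcar M d}"
  have G0I: "(i d x, \<zeta> (f d x)) \<in> G0" if "x \<in> mcar M d" for x using that unfolding G0_def by blast
  have G0E: "\<exists>x\<in>mcar M d. s = i d x \<and> t = \<zeta> (f d x)" if "(s, t) \<in> G0" for s t using that unfolding G0_def by blast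
  have "linear_graph p (mod_component N u d) G0"
    unfolding linear_graph_def mod_component_simps
  proof (intro conjI allI impI)
    show "G0 \<subseteq> mcar N d \<times> carrier (QpZp p)" using i_cl f_cl zeta_closed by (auto simp: G0_def)
    show "(\<one>\<^bsub>mgrp N d\<^esub>, \<zero>\<^sub>Q) \<in> G0" using G0I[of "\<one>\<^bsub>mgrp M d\<^esub>"] by (simp add: one zeta_one)
  next
    fix s t s' t' assume "(s, t) \<in> G0" "(s', t') \<in> G0"
    then obtain x x' where "x \<in> mcar M d" "s = i d x" "t = \<zeta> (f d x)" "x' \<in> mcar M d" "s' = i d x'" "t' = \<zeta> (f d x')"
      using G0E by metis
    then show "(s \<otimes>\<^bsub>mgrp N d\<^esub> s', t \<oplus>\<^sub>Q t') \<in> G0"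
      using G0I[of "x \<otimes>\<^bsub>mgrp M d\<^esub> x'"] by (simp add: i_add f_add zeta_add f_cl)
  next
    fix a s t assume a: "a \<in> carrier (Zp p)" and "(s, t) \<in> G0"
    then obtain x where x: "x \<in> mcar M d" "s = i d x" "t = \<zeta> (f d x)" using G0E by metis
    then show "(gsmult N 0 d (u a) s, a \<odot>\<^sub>Q t) \<in> G0"
      using G0I[of "gsmult M 0 d (u a) x"] M.smult_closed[of "u a" 0 x d] i_lin[of "u a" 0 x d] f_lin[of "u a" 0 x d] a
      by (simp add: unit_closed zeta_smult f_cl)
  next
    fix t assume "(\<one>\<^bsub>mgrp N d\<^esub>, t) \<in> G0"
    then obtain x where x: "x \<in> mcar M d" "\<one>\<^bsub>mgrp N d\<^esub> = i d x" "t = \<zeta> (f d x)" using G0E by metis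
    then have "i d x = i d \<one>\<^bsub>mgrp M d\<^esub>" by (simp add: one)
    then have "x = \<one>\<^bsub>mgrp M d\<^esub>" using inj x(1) by (metis MG.one_closed inj_onD)
    then show "t = \<zero>\<^sub>Q" using x by (simp add: one zeta_one)
  qed
  then obtain g where g_cl: "g \<in> mcar N d \<rightarrow> carrier (QpZp p)"
    and g_add: "\<And>x y. x \<in> mcar N d \<Longrightarrow> y \<in> mcar N d \<Longrightarrow> g (x \<otimes>\<^bsub>mgrp N d\<^esub> y) = g x \<oplus>\<^sub>Q g y"
    and g_lin: "\<And>a x. a \<in> carrier (Zp p) \<Longrightarrow> x \<in> mcar N d \<Longrightarrow> g (gsmult N 0 d (u a) x) = a \<odot>\<^sub>Q g x"
    and g_ext: "\<And>x y. (x, y) \<in> G0 \<Longrightarrow> g x = y"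
    by (rule Nd.QpZp_injective) (auto simp only: mod_component_simps)
  have sm_cl: "gsmult N (d - n) n b z \<in> mcar N d" if "b \<in> gcar R (d - n)" "z \<in> mcar N n" for n b z
    using N.smult_closed[OF that] by simp
  have ex1: "\<exists>!a. a \<in> gcar R n \<and> (\<forall>b\<in>gcar R (d - n). \<zeta> (gmult R (d - n) n b a) = g (gsmult N (d - n) n b z))"
    if z: "z \<in> mcar N n" for n z
  proof (rule dual_representation[OF sd])
    fix b assume b: "b \<in> gcar R (d - n)"
    show "g (gsmult N (d - n) n b z) \<in> carrier (QpZp p)" using g_cl sm_cl[OF b z] by blast
    show "g (gsmult N (d - n) n (b \<otimes>\<^bsub>ggrp R (d - n)\<^esub> b') z) = g (gsmult N (d - n) n b z) \<oplus>\<^sub>Q g (gsmult N (d - n) n b' z)"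
      if "b' \<in> gcar R (d - n)" for b'
      using N.smult_l_distr[OF b that z] g_add sm_cl z b that by simp
    show "g (gsmult N (d - n) n (gmult R 0 (d - n) (u a) b) z) = a \<odot>\<^sub>Q g (gsmult N (d - n) n b z)"
      if "a \<in> carrier (Zp p)" for a
      using N.smult_assoc[of "u a" 0 b "d - n" z n] unit_closed[OF that] b z g_lin[OF that sm_cl[OF b z]] by simp
  qed
  define h where "h n z = (THE a. a \<in> gcar R n \<and> (\<forall>b\<in>gcar R (d - n). \<zeta> (gmult R (d - n) n b a) = g (gsmult N (d - n) n b z)))" for n z
  have h: "h n z \<in> gcar R n" "\<And>b. b \<in> gcar R (d - n) \<Longrightarrow> \<zeta> (gmult R (d - n) n b (h n z)) = g (gsmult N (d - n) n b z)"
    if "z \<in> mcar N n" for n z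
    using theI'[OF ex1[OF that]] unfolding h_def by auto
  have hI: "h n z = a" if "z \<in> mcar N n" "a \<in> gcar R n"
    "\<And>b. b \<in> gcar R (d - n) \<Longrightarrow> \<zeta> (gmult R (d - n) n b a) = g (gsmult N (d - n) n b z)" for n z a
    using ex1[OF that(1)] h[OF that(1)] that(2,3) by blast
  have mul_cl: "gmult R (d - n) n b a \<in> gcar R d" if "b \<in> gcar R (d - n)" "a \<in> gcar R n" for n a b
    using R.mult_closed[OF that] by simp
  have "h \<in> gmod_hom R N (regular_gmod R)"
    unfolding gmod_hom_def regular_gmod_def
  proof (simp, intro conjI allI ballI)
    fix n
    show "h n \<in> hom (mgrp N n) (ggrp R n)"
    proof (rule homI)
      fix z w assume z: "z \<in> mcar N n" "w \<in> mcar N n"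
      show "h n (z \<otimes>\<^bsub>mgrp N n\<^esub> w) = h n z \<otimes>\<^bsub>ggrp R n\<^esub> h n w"
      proof (rule hI)
        fix b assume b: "b \<in> gcar R (d - n)"
        show "\<zeta> (gmult R (d - n) n b (h n z \<otimes>\<^bsub>ggrp R n\<^esub> h n w)) = g (gsmult N (d - n) n b (z \<otimes>\<^bsub>mgrp N n\<^esub> w))"
          using R.r_distr[OF b h(1)[OF z(1)] h(1)[OF z(2)]] N.smult_r_distr[OF b z] b z
          by (simp add: zeta_add mul_cl h g_add sm_cl)
      qed (use z h in auto)
    qed (rule h)
  next
    fix m n a z assume a: "a \<in> gcar R m" and z: "z \<in> mcar N n"
    show "h (m + n) (gsmult N m n a z) = gmult R m n a (h n z)"
    proof (rule hI)
      fix b assume b: "b \<in> gcar R (d - (m + n))"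
      have ba: "gmult R (d - (m + n)) m b a \<in> gcar R (d - n)" using R.mult_closed[OF b a] by simp
      show "\<zeta> (gmult R (d - (m + n)) (m + n) b (gmult R m n a (h n z)))
          = g (gsmult N (d - (m + n)) (m + n) b (gsmult N m n a z))"
        using R.assoc[OF b a h(1)[OF z]] N.smult_assoc[OF b a z] h(2)[OF z ba] by simp
    qed (use a z h R.mult_closed N.smult_closed in auto)
  qed
  moreover have "h n (i n x) = f n x" if x: "x \<in> mcar M n" for n x
  proof (rule hI)
    fix b assume b: "b \<in> gcar R (d - n)"
    have "gsmult M (d - n) n b x \<in> mcar M d" using M.smult_closed[OF b x] by simp
    from g_ext[OF G0I[OF this]]
    show "\<zeta> (gmult R (d - n) n b (f n x)) = g (gsmult N (d - n) n b (i n x))"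
      using i_lin[OF b x] f_lin[OF b x] by simp
  qed (use x i_cl f_cl in auto)
  ultimately show "\<exists>h\<in>gmod_hom R N (regular_gmod R). \<forall>n. \<forall>x\<in>mcar M n. h n (i n x) = f n x" by blast
qed

end

section \<open>Homomorphisms out of free modules\<close>

lemma (in comm_group) finprod_in_subgroup:
  assumes "subgroup H G" "finite A" "\<And>i. i \<in> A \<Longrightarrow> f i \<in> H"
  shows "finprod G f A \<in> H"
  using assms(2,3)
proof (induction A rule: finite_induct)
  case empty
  then show ?case using subgroup.one_closed[OF assms(1)] by simp
next
  case (insert a A)
  have "f \<in> insert a A \<rightarrow> carrier G" using insert.prems subgroup.subset[OF assms(1)] by blast
  then show ?case using insert subgroup.m_closed[OF assms(1)] by (simp add: Pi_def)
qed

lemma (in comm_group) hom_finprod: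
  assumes h: "h \<in> hom G H" and H: "comm_group H" and A: "finite A" "f \<in> A \<rightarrow> carrier G"
  shows "h (finprod G f A) = finprod H (\<lambda>i. h (f i)) A"
proof -
  interpret H: comm_group H by fact
  show ?thesis
    using A
  proof (induction A rule: finite_induct)
    case empty
    then show ?case using hom_one[OF h is_group H.is_group] by simp
  next
    case (insert a A)
    then have "finprod G f A \<in> carrier G" "f a \<in> carrier G" "f \<in> A \<rightarrow> carrier G" by auto
    moreover have "(\<lambda>i. h (f i)) \<in> A \<rightarrow> carrier H" "h (f a) \<in> carrier H"
      using insert.prems h by (auto simp: hom_def)
    ultimately show ?case using insert h by (simp add: hom_mult)
  qed
qed

definition summand_incl :: "(nat \<Rightarrow> 'a monoid) \<Rightarrow> nat \<Rightarrow> nat \<Rightarrow> 'a \<Rightarrow> nat \<Rightarrow> 'a"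
  where "summand_incl G r i a = (\<lambda>j\<in>{..<r}. if j = i then a else \<one>\<^bsub>G j\<^esub>)"

lemma product_group_hom_expansion:
  assumes G: "\<And>i. group (G i)" and H: "comm_group H"
    and h: "h \<in> hom (product_group {..<r} G) H" and z: "z \<in> carrier (product_group {..<r} G)"
  shows "h z = finprod H (\<lambda>i. h (summand_incl G r i (z i))) {..<r}"
proof -
  interpret H: comm_group H by fact
  interpret G: group "G i" for i by (rule G)
  have P: "group (product_group {..<r} G)" using G by simp
  have z': "z i \<in> carrier (G i)" if "i < r" for i using z that by auto
  define tr where "tr k = (\<lambda>j\<in>{..<r}. if j < k then z j else \<one>\<^bsub>G j\<^esub>)" for k
  have tr: "tr k \<in> carrier (product_group {..<r} G)" for k by (auto simp: tr_def z')
  have inc: "summand_incl G r i (z i) \<in> carrier (product_group {..<r} G)" if "i < r" for i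
    using that by (auto simp: summand_incl_def z')
  have "k \<le> r \<Longrightarrow> h (tr k) = finprod H (\<lambda>i. h (summand_incl G r i (z i))) {..<k}" for k
  proof (induction k)
    case 0
    have "tr 0 = \<one>\<^bsub>product_group {..<r} G\<^esub>" by (simp add: tr_def)
    then have "h (tr 0) = \<one>\<^bsub>H\<^esub>" using hom_one[OF h P H.is_group] by argo
    then show ?case by simp
  next
    case (Suc k)
    have "tr (Suc k) = summand_incl G r k (z k) \<otimes>\<^bsub>product_group {..<r} G\<^esub> tr k"
      using Suc.prems z' by (auto simp: tr_def summand_incl_def fun_eq_iff less_Suc_eq)
    then have "h (tr (Suc k)) = h (summand_incl G r k (z k)) \<otimes>\<^bsub>H\<^esub> h (tr k)"
      using hom_mult[OF h inc tr] Suc.prems by simp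
    also have "\<dots> = finprod H (\<lambda>i. h (summand_incl G r i (z i))) (insert k {..<k})"
      using Suc hom_in_carrier[OF h inc] by (subst H.finprod_insert) auto
    finally show ?case by (simp add: lessThan_Suc)
  qed
  moreover have "tr r = z" by (rule extensionalityI[of _ "{..<r}"]) (use z in \<open>auto simp: tr_def PiE_def\<close>)
  ultimately show ?thesis by (metis order_refl)
qed

context graded_comm_ring
begin

lemma free_gmod_simps:
  "mgrp (free_gmod R r d) n = product_group {..<r} (\<lambda>i. ggrp R (n - d i))"
  "gsmult (free_gmod R r d) m n a x = (\<lambda>i\<in>{..<r}. gmult R m (n - d i) a (x i))"
  by (simp_all add: free_gmod_def)

definition basis_vec :: "nat \<Rightarrow> (nat \<Rightarrow> int) \<Rightarrow> nat \<Rightarrow> nat \<Rightarrow> 'a"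
  where "basis_vec r d i = summand_incl (\<lambda>j. ggrp R (d i - d j)) r i (gone R)"

lemma basis_vec_closed: "basis_vec r d i \<in> mcar (free_gmod R r d) (d i)"
proof -
  have "monoid (ggrp R n)" for n using comm_group[of n] by (simp add: comm_group.axioms(1) comm_monoid.axioms(1))
  then show ?thesis
    using one_closed by (auto simp: free_gmod_simps basis_vec_def summand_incl_def monoid.one_closed)
qed

lemma summand_incl_eq_smult_basis_vec:
  assumes "i < r" "a \<in> gcar R (n - d i)"
  shows "summand_incl (\<lambda>j. ggrp R (n - d j)) r i a = gsmult (free_gmod R r d) (n - d i) (d i) a (basis_vec r d i)"
proof -
  have "gmult R (n - d i) (d i - d j) a \<one>\<^bsub>ggrp R (d i - d j)\<^esub> = \<one>\<^bsub>ggrp R (n - d j)\<^esub>" for j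
    using mult_zero[OF assms(2), of "d i - d j"] by simp
  moreover have "gmult R (n - d i) 0 a (gone R) = a" using assms r_one by blast
  ultimately show ?thesis by (auto simp: free_gmod_simps basis_vec_def summand_incl_def fun_eq_iff)
qed

text \<open>
  Linear expansion of \<open>h z\<close> in the images of the basis vectors. The homomorphism \<open>q\<close> serves to read off
  single coordinates when the target is free as well, and to forget that the target is only an ideal.
\<close>

lemma free_gmod_hom_expansion:
  assumes h: "h \<in> gmod_hom R (free_gmod R r d) M" and H: "comm_group H"
    and q: "q \<in> hom (mgrp M n) H" and z: "z \<in> mcar (free_gmod R r d) n"
  shows "q (h n z) = finprod H (\<lambda>i. q (gsmult M (n - d i) (d i) (z i) (h (d i) (basis_vec r d i)))) {..<r}"
proof -
  interpret H: comm_group H by fact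
  have hn: "h n \<in> hom (product_group {..<r} (\<lambda>i. ggrp R (n - d i))) (mgrp M n)"
    using h by (simp add: gmod_hom_def free_gmod_simps)
  have zi: "z i \<in> gcar R (n - d i)" if "i < r" for i using z that by (auto simp: free_gmod_simps)
  have lin: "h n (summand_incl (\<lambda>j. ggrp R (n - d j)) r i (z i)) = gsmult M (n - d i) (d i) (z i) (h (d i) (basis_vec r d i))"
    if "i < r" for i
  proof -
    have "h (n - d i + d i) (gsmult (free_gmod R r d) (n - d i) (d i) (z i) (basis_vec r d i))
      = gsmult M (n - d i) (d i) (z i) (h (d i) (basis_vec r d i))"
      using h zi[OF that] basis_vec_closed[of r d i] by (simp only: gmod_hom_def mem_Collect_eq)
    then show ?thesis using summand_incl_eq_smult_basis_vec[where d = d and n = n, OF that zi[OF that]] by simp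
  qed
  have qh: "(\<lambda>z. q (h n z)) \<in> hom (product_group {..<r} (\<lambda>i. ggrp R (n - d i))) H"
    using hom_compose[OF hn q] by (simp add: comp_def)
  have "q (h n z) = finprod H (\<lambda>i. q (h n (summand_incl (\<lambda>j. ggrp R (n - d j)) r i (z i)))) {..<r}"
    using z by (intro product_group_hom_expansion[OF _ H qh])
      (auto simp: free_gmod_simps comm_group comm_group.axioms(2))
  also have "\<dots> = finprod H (\<lambda>i. q (gsmult M (n - d i) (d i) (z i) (h (d i) (basis_vec r d i)))) {..<r}"
  proof (rule H.finprod_cong')
    fix i assume "i \<in> {..<r}"
    then show "q (h n (summand_incl (\<lambda>j. ggrp R (n - d j)) r i (z i))) = q (gsmult M (n - d i) (d i) (z i) (h (d i) (basis_vec r d i)))"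
      using lin by simp
  next
    have "summand_incl (\<lambda>j. ggrp R (n - d j)) r i (z i) \<in> carrier (product_group {..<r} (\<lambda>i. ggrp R (n - d i)))" if "i < r" for i
      using zi that comm_group by (auto simp: summand_incl_def intro!: monoid.one_closed comm_monoid.axioms(1) comm_group.axioms(1))
    from hom_in_carrier[OF qh this]
    show "(\<lambda>i. q (gsmult M (n - d i) (d i) (z i) (h (d i) (basis_vec r d i)))) \<in> {..<r} \<rightarrow> carrier H"
      by (auto simp: lin[symmetric])
  qed simp
  finally show ?thesis .
qed

lemma zero_gideal_finitely_presented:
  "finitely_presented R (ideal_gmod R (\<lambda>n. {\<one>\<^bsub>ggrp R n\<^esub>}))"
proof -
  interpret G: comm_group "ggrp R k" for k by (rule comm_group)
  show ?thesis
    unfolding finitely_presented_def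
    by (intro exI[of _ 0] exI[of _ "\<lambda>_. 0"] bexI[of _ "\<lambda>_ z. z"] bexI[of _ "\<lambda>n _. \<one>\<^bsub>ggrp R n\<^esub>"] allI)
      (auto simp: gmod_hom_def free_gmod_simps ideal_gmod_def hom_def kernel_def mult_zero)
qed

lemma unit_gideal_finitely_presented: "finitely_presented R (ideal_gmod R (gcar R))"
proof -
  interpret G: comm_group "ggrp R k" for k by (rule comm_group)
  have f: "(\<lambda>n z. \<lambda>i\<in>{..<1}. \<one>\<^bsub>ggrp R n\<^esub>) \<in> gmod_hom R (free_gmod R 0 (\<lambda>_. 0)) (free_gmod R 1 (\<lambda>_. 0))"
    by (auto simp: gmod_hom_def free_gmod_simps hom_def mult_zero fun_eq_iff)
  have g: "(\<lambda>n z. z 0) \<in> gmod_hom R (free_gmod R 1 (\<lambda>_. 0)) (ideal_gmod R (gcar R))"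
    by (auto simp: gmod_hom_def free_gmod_simps ideal_gmod_def hom_def)
  have "(\<lambda>z. \<lambda>i\<in>{..<1}. \<one>\<^bsub>ggrp R n\<^esub>) ` mcar (free_gmod R 0 (\<lambda>_. 0)) n
      = kernel (mgrp (free_gmod R 1 (\<lambda>_. 0)) n) (mgrp (ideal_gmod R (gcar R)) n) (\<lambda>z. z 0)" for n
    by (auto simp: kernel_def free_gmod_simps ideal_gmod_def PiE_def extensional_def fun_eq_iff)
  moreover have "(\<lambda>z. z 0) ` mcar (free_gmod R 1 (\<lambda>_. 0)) n = mcar (ideal_gmod R (gcar R)) n" for n
  proof -
    have "x \<in> (\<lambda>z. z 0) ` mcar (free_gmod R 1 (\<lambda>_. 0)) n" if "x \<in> gcar R n" for x
      using that by (intro image_eqI[of _ _ "\<lambda>i\<in>{..<1}. x"]) (auto simp: free_gmod_simps)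
    then show ?thesis by (auto simp: free_gmod_simps ideal_gmod_def)
  qed
  ultimately show ?thesis
    unfolding finitely_presented_def
    by (intro exI[of _ "1::nat"] exI[of _ "\<lambda>_. 0::int"] exI[of _ "0::nat"] bexI[OF _ f] bexI[OF _ g]) simp
qed

end

section \<open>The reduced quotient\<close>

text \<open>
  What the remaining arguments need to know about \<open>\<int>\<^sub>p \<otimes> J\<close>. The last assumption provides the elements
  \<open>\<alpha>\<^sub>k\<close> with \<open>k\<close> prime to \<open>p\<close>: in infinitely many degrees the component is a simple \<open>\<int>\<^sub>p\<close>-module.
\<close>

locale sparse_algebra = prime_num p + graded_algebra "Zp p" R u
  for p and R :: "'a gring" and u +
  assumes unit_bij: "bij_betw u (carrier (Zp p)) (gcar R 0)"
    and mult_trivial: "\<lbrakk>x \<in> gcar R m; y \<in> gcar R n; m \<noteq> 0; n \<noteq> 0; m + n \<noteq> - 2\<rbrakk> \<Longrightarrow>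
      gmult R m n x y = \<one>\<^bsub>ggrp R (m + n)\<^esub>"
    and torsion: "\<lbrakk>x \<in> gcar R n; n \<noteq> 0\<rbrakk> \<Longrightarrow> \<exists>k. gmult R 0 n (u (Zint p (int p ^ k))) x = \<one>\<^bsub>ggrp R n\<^esub>"
    and simple_degrees: "infinite {n. n \<noteq> 0 \<and> n \<noteq> - 2 \<and>
      (\<exists>a\<in>gcar R n. a \<noteq> \<one>\<^bsub>ggrp R n\<^esub> \<and> gmult R 0 n (u (Zint p (int p))) a = \<one>\<^bsub>ggrp R n\<^esub> \<and>
        (\<forall>x\<in>gcar R n. \<exists>c\<in>carrier (Zp p). x = gmult R 0 n (u c) a))}"
begin

lemma unit_group_hom: "group_hom (add_monoid (Zp p)) (ggrp R 0) u"
  by (intro group_hom.intro group_hom_axioms.intro A.a_group G.is_group unit_hom)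

lemma unit_add: "a \<in> carrier (Zp p) \<Longrightarrow> b \<in> carrier (Zp p) \<Longrightarrow> u (a \<oplus>\<^sub>Z b) = u a \<otimes>\<^bsub>ggrp R 0\<^esub> u b"
  using unit_hom by (auto simp: hom_def)

lemma unit_zero: "u \<zero>\<^sub>Z = \<one>\<^bsub>ggrp R 0\<^esub>"
  using group_hom.hom_one[OF unit_group_hom] by simp

lemma unit_E: assumes "x \<in> gcar R 0" obtains b where "b \<in> carrier (Zp p)" "x = u b"
  using assms unit_bij by (auto simp: bij_betw_def)

lemma unit_inj: "a \<in> carrier (Zp p) \<Longrightarrow> b \<in> carrier (Zp p) \<Longrightarrow> u a = u b \<Longrightarrow> a = b"
  using unit_bij by (auto simp: bij_betw_def dest: inj_onD)

abbreviation act :: "int \<Rightarrow> (nat \<Rightarrow> int) \<Rightarrow> 'a \<Rightarrow> 'a"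
  where "act n c x \<equiv> gmult R 0 n (u c) x"

lemma act_closed: "c \<in> carrier (Zp p) \<Longrightarrow> x \<in> gcar R n \<Longrightarrow> act n c x \<in> gcar R n"
  using R.mult_closed[of "u c" 0 x n] unit_closed by simp

lemma act_act: "b \<in> carrier (Zp p) \<Longrightarrow> c \<in> carrier (Zp p) \<Longrightarrow> x \<in> gcar R n \<Longrightarrow>
    act n b (act n c x) = act n (b \<otimes>\<^sub>Z c) x"
  using R.assoc[of "u b" 0 "u c" 0 x n] unit_closed by (simp add: unit_mult)

lemma act_add: "b \<in> carrier (Zp p) \<Longrightarrow> c \<in> carrier (Zp p) \<Longrightarrow> x \<in> gcar R n \<Longrightarrow>
    act n (b \<oplus>\<^sub>Z c) x = act n b x \<otimes>\<^bsub>ggrp R n\<^esub> act n c x"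
  using R.l_distr[of "u b" 0 "u c" x n] unit_closed by (simp add: unit_add)

lemma act_one: "x \<in> gcar R n \<Longrightarrow> act n \<one>\<^sub>Z x = x"
  by (simp add: unit_one R.l_one)

lemma act_triv: "c \<in> carrier (Zp p) \<Longrightarrow> act n c \<one>\<^bsub>ggrp R n\<^esub> = \<one>\<^bsub>ggrp R n\<^esub>"
  using R.mult_zero[of "u c" 0 n] unit_closed by simp

lemma act_hom: "c \<in> carrier (Zp p) \<Longrightarrow> act n c \<in> hom (ggrp R n) (ggrp R n)"
  using R.r_distr[of "u c" 0 _ n] unit_closed by (auto simp: hom_def act_closed)

lemma unit_mult_eq_zero:
  "x \<in> gcar R 0 \<Longrightarrow> y \<in> gcar R 0 \<Longrightarrow> gmult R 0 0 x y = \<one>\<^bsub>ggrp R 0\<^esub> \<Longrightarrow> x \<noteq> \<one>\<^bsub>ggrp R 0\<^esub> \<Longrightarrow> y = \<one>\<^bsub>ggrp R 0\<^esub>"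
proof (elim unit_E)
  fix a b assume *: "gmult R 0 0 x y = \<one>\<^bsub>ggrp R 0\<^esub>" "x \<noteq> \<one>\<^bsub>ggrp R 0\<^esub>" "a \<in> carrier (Zp p)" "x = u a" "b \<in> carrier (Zp p)" "y = u b"
  then have "u (a \<otimes>\<^sub>Z b) = u \<zero>\<^sub>Z" by (simp add: unit_mult unit_zero)
  then have "a \<otimes>\<^sub>Z b = \<zero>\<^sub>Z" using * by (intro unit_inj) auto
  then have "b = \<zero>\<^sub>Z" using Zp_integral[of a b] * unit_zero by auto
  then show ?thesis using * unit_zero by simp
qed

text \<open>
  In degree \<open>n \<noteq> 0\<close> the square of an element may be nonzero, if \<open>2 n = -2\<close>, but the cube has factors of
  degrees \<open>2 n\<close> and \<open>n\<close>, and \<open>3 n \<noteq> -2\<close>.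
\<close>

lemma nilradical_eq: "nilradical R n = (if n = 0 then {\<one>\<^bsub>ggrp R 0\<^esub>} else gcar R n)"
proof (cases "n = 0")
  case True
  have "gpow R 0 x k \<in> gcar R 0 \<and> gpow R 0 x k \<noteq> \<one>\<^bsub>ggrp R 0\<^esub>" if "x \<in> gcar R 0" "x \<noteq> \<one>\<^bsub>ggrp R 0\<^esub>" for x k
  proof (induction k)
    case 0
    have "u \<one>\<^sub>Z \<noteq> u \<zero>\<^sub>Z" using unit_inj[of "\<one>\<^sub>Z" "\<zero>\<^sub>Z"] Zp_one_not_zero by auto
    then show ?case using R.one_closed by (simp add: unit_one unit_zero)
  next
    case (Suc k)
    then show ?case using that unit_mult_eq_zero[of "gpow R 0 x k" x] R.mult_closed[of "gpow R 0 x k" 0 x 0] by auto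
  qed
  moreover have "gpow R 0 \<one>\<^bsub>ggrp R 0\<^esub> 1 = \<one>\<^bsub>ggrp R 0\<^esub>" using R.one_closed by (simp add: R.l_one)
  ultimately show ?thesis using True unfolding nilradical_def
    by (auto simp: intro!: exI[of _ "1::nat"] simp del: gpow.simps)
next
  case False
  have "\<exists>k. gpow R n x k = \<one>\<^bsub>ggrp R (int k * n)\<^esub>" if x: "x \<in> gcar R n" for x
  proof -
    have x1: "gpow R n x 1 = x" using x by (simp add: R.l_one)
    have "gpow R n x 2 = gmult R (int 1 * n) n (gpow R n x 1) x"
      by (simp only: numeral_2_eq_2 One_nat_def gpow.simps)
    then have "gpow R n x 2 = gmult R n n x x" by (simp only: x1) simp
    then have x2: "gpow R n x 2 \<in> gcar R (2 * n)" using R.mult_closed[OF x x] by (simp only: mult_2)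
    have "gpow R n x 3 = gmult R (2 * n) n (gpow R n x 2) x" by (simp add: numeral_3_eq_3 numeral_2_eq_2)
    also have "\<dots> = \<one>\<^bsub>ggrp R (2 * n + n)\<^esub>" using False by (intro mult_trivial[OF x2 x]) presburger+
    finally have "gpow R n x 3 = \<one>\<^bsub>ggrp R (int 3 * n)\<^esub>" by simp
    then show ?thesis by blast
  qed
  then show ?thesis using False by (auto simp: nilradical_def)
qed

text \<open>
  All components of nonzero degree become trivial. The product of the quotient is still trivial when such
  degrees add up to \<open>0\<close>, because the products of elements of degrees \<open>m\<close> and \<open>-m\<close> vanish for \<open>m \<noteq> 0\<close>.
\<close>

lemma reduced_quotient:
  "\<exists>h \<in> gring_iso (concentrated (Zp p)) (gquot R (nilradical R)).
     \<forall>a\<in>carrier (Zp p). h 0 a = nilradical R 0 #>\<^bsub>ggrp R 0\<^esub> u a"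
proof -
  let ?N = "nilradical R" and ?C = "concentrated (Zp p)" and ?Q = "gquot R (nilradical R)"
  define h where "h n a = ?N n #>\<^bsub>ggrp R n\<^esub> (if n = 0 then u a else \<one>\<^bsub>ggrp R n\<^esub>)" for n a
  have N0: "?N 0 #>\<^bsub>ggrp R 0\<^esub> x = {x}" if "x \<in> gcar R 0" for x using that by (simp add: nilradical_eq r_coset_def)
  have Nn: "?N n #>\<^bsub>ggrp R n\<^esub> x = gcar R n" if "x \<in> gcar R n" "n \<noteq> 0" for n x
    using that G.coset_join2[of x n "gcar R n"] G.subgroup_self by (simp add: nilradical_eq)
  have Q0: "gcar ?Q 0 = (\<lambda>x. {x}) ` gcar R 0" by (auto simp: gquot_def carrier_FactGroup N0)
  have Qn: "gcar ?Q n = {gcar R n}" if "n \<noteq> 0" for n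
    using that Nn[OF _ that] by (auto simp: gquot_def carrier_FactGroup intro!: image_eqI[of _ _ "\<one>\<^bsub>ggrp R n\<^esub>"])
  have C: "ggrp ?C 0 = add_monoid (Zp p)" "n \<noteq> 0 \<Longrightarrow> gcar ?C n = {\<zero>\<^sub>Z}"
    "n \<noteq> 0 \<Longrightarrow> x \<otimes>\<^bsub>ggrp ?C n\<^esub> y = x \<oplus>\<^sub>Z y" for n x y
    by (simp_all add: concentrated_def)
  have h0: "h 0 a = {u a}" if "a \<in> carrier (Zp p)" for a using that by (simp add: h_def N0 unit_closed)
  have hn: "h n a = gcar R n" if "n \<noteq> 0" for n a using that by (simp add: h_def Nn)
  have mulQ0: "{x} \<otimes>\<^bsub>ggrp ?Q 0\<^esub> {y} = {x \<otimes>\<^bsub>ggrp R 0\<^esub> y}" for x y by (simp add: gquot_def set_mult_def)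
  have mulQn: "gcar R n \<otimes>\<^bsub>ggrp ?Q n\<^esub> gcar R n = gcar R n" for n
    by (simp add: gquot_def G.subgroup_mult_id[OF G.subgroup_self])
  have iso: "h n \<in> iso (ggrp ?C n) (ggrp ?Q n)" for n
  proof (cases "n = 0")
    case True
    have "inj_on (h 0) (carrier (Zp p))" by (rule inj_onI) (simp add: h0 unit_inj)
    moreover have "h 0 ` carrier (Zp p) = gcar ?Q 0"
      using unit_bij by (auto simp: Q0 h0 bij_betw_def)
    moreover have "h 0 (a \<oplus>\<^sub>Z b) = h 0 a \<otimes>\<^bsub>ggrp ?Q 0\<^esub> h 0 b" if "a \<in> carrier (Zp p)" "b \<in> carrier (Zp p)" for a b
      using that by (simp add: h0 mulQ0 unit_add)
    ultimately show ?thesis using True by (auto simp: iso_def hom_def bij_betw_def C)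
  next
    case False
    then show ?thesis by (auto simp: iso_def hom_def bij_betw_def C Qn hn mulQn)
  qed
  have mult: "h (m + n) (gmult ?C m n a b) = gmult ?Q m n (h m a) (h n b)"
    if a: "a \<in> gcar ?C m" and b: "b \<in> gcar ?C n" for m n a b
  proof -
    have Cm: "gmult ?C m n a b = a \<otimes>\<^sub>Z b" by (simp add: concentrated_def)
    have Qm: "gmult ?Q m n X Y = (\<Union>x\<in>X. \<Union>y\<in>Y. ?N (m + n) #>\<^bsub>ggrp R (m + n)\<^esub> gmult R m n x y)" for X Y
      by (simp add: gquot_def)
    consider "m = 0" "n = 0" | "m + n \<noteq> 0" | "m + n = 0" "m \<noteq> 0" "n \<noteq> 0" by fastforce
    then show ?thesis
    proof cases
      case 1
      then have "a \<in> carrier (Zp p)" "b \<in> carrier (Zp p)" using a b C by simp_all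
      then show ?thesis using 1 R.mult_closed[of "u a" 0 "u b" 0] by (simp add: Cm[unfolded 1] Qm[unfolded 1] h0 unit_mult N0 unit_closed)
    next
      case 2
      have sub: "h k c \<subseteq> gcar R k \<and> h k c \<noteq> {}" if "c \<in> gcar ?C k" for k c
        using that by (cases "k = 0") (auto simp: hn h0 C unit_closed)
      have "?N (m + n) #>\<^bsub>ggrp R (m + n)\<^esub> gmult R m n x y = gcar R (m + n)" if "x \<in> h m a" "y \<in> h n b" for x y
      proof -
        have "x \<in> gcar R m" "y \<in> gcar R n" using that sub[OF a] sub[OF b] by blast+
        then show ?thesis using R.mult_closed 2 by (intro Nn)
      qed
      then show ?thesis using sub[OF a] sub[OF b] 2 by (auto simp: Qm hn)
    next
      case 3
      then have "a = \<zero>\<^sub>Z" "b = \<zero>\<^sub>Z" using a b C(2) by auto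
      then have "h (m + n) (gmult ?C m n a b) = {\<one>\<^bsub>ggrp R 0\<^esub>}"
        unfolding Cm using 3 by (simp add: h0 unit_zero)
      moreover have "gmult R m n x y = \<one>\<^bsub>ggrp R 0\<^esub>" if "x \<in> gcar R m" "y \<in> gcar R n" for x y
        using mult_trivial[OF that] 3 by simp
      moreover have "gcar R m \<noteq> {}" "gcar R n \<noteq> {}" using G.one_closed by blast+
      ultimately show ?thesis using 3 by (auto simp: Qm hn N0)
    qed
  qed
  have one: "h 0 (gone ?C) = gone ?Q"
    by (simp add: h_def concentrated_def gquot_def unit_one)
  have "h \<in> gring_iso ?C ?Q" unfolding gring_iso_def using iso mult one by blast
  moreover have "h 0 a = ?N 0 #>\<^bsub>ggrp R 0\<^esub> u a" for a by (simp add: h_def)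
  ultimately show ?thesis by blast
qed

end

section \<open>Total incoherence\<close>

lemma (in prime_num) Zint_power_mult_nth: "(Zint p (int p ^ k) \<otimes>\<^sub>Z z) k = 0"
  by (simp add: Zp_mult Zint_def)

context sparse_algebra
begin

lemma unit_ideal:
  assumes I: "gideal R I" and b: "b \<in> carrier (Zp p)" "u b \<in> I 0" "b 1 \<noteq> 0"
  shows "I = gcar R"
proof
  fix n
  have I_sub: "I n \<subseteq> gcar R n" for n using I subgroup.subset by (auto simp: gideal_def)
  have I_mult: "gmult R m n a x \<in> I (m + n)" if "a \<in> gcar R m" "x \<in> I n" for m n a x
    using I that by (auto simp: gideal_def)
  obtain v where v: "v \<in> carrier (Zp p)" "b \<otimes>\<^sub>Z v = \<one>\<^sub>Z" using Zp_unit[OF b(1,3)] by blast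
  have "gone R = gmult R 0 0 (u v) (u b)" using v b by (simp add: unit_mult[symmetric] A.m_comm unit_one)
  then have one: "gone R \<in> I 0" using I_mult[of "u v" 0 "u b" 0] v b unit_closed by simp
  have "a \<in> I n" if "a \<in> gcar R n" for a using I_mult[OF that one] that by (simp add: R.r_one)
  then show "I n = gcar R n" using I_sub by blast
qed

lemma act_eq_one_imp:
  assumes "b \<in> carrier (Zp p)" "a \<in> gcar R n" "a \<noteq> \<one>\<^bsub>ggrp R n\<^esub>" "act n b a = \<one>\<^bsub>ggrp R n\<^esub>"
  obtains c where "c \<in> carrier (Zp p)" "b = Zint p (int p) \<otimes>\<^sub>Z c"
proof -
  have "b 1 = 0"
  proof (rule ccontr)
    assume "b 1 \<noteq> 0"
    then obtain v where v: "v \<in> carrier (Zp p)" "b \<otimes>\<^sub>Z v = \<one>\<^sub>Z" using Zp_unit assms(1) by blast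
    have "act n v (act n b a) = a" using v assms(1,2) by (simp add: act_act A.m_comm[of v b] act_one)
    then show False using assms(3,4) v by (simp add: act_triv)
  qed
  then show ?thesis using Zp_divisible[OF assms(1), of 1] that by auto
qed

text \<open>
  In degree \<open>\<delta>\<close> only the generators of degree \<open>\<delta>\<close> contribute to the ideal generated by the \<open>x j\<close>.
\<close>

definition decoupled :: "nat \<Rightarrow> (nat \<Rightarrow> int) \<Rightarrow> (nat \<Rightarrow> 'a) \<Rightarrow> int \<Rightarrow> bool"
  where "decoupled r d x \<delta> \<longleftrightarrow> (\<forall>j<r. d j \<noteq> \<delta> \<longrightarrow>
    (\<forall>a\<in>gcar R (\<delta> - d j). gmult R (\<delta> - d j) (d j) a (x j) = \<one>\<^bsub>ggrp R \<delta>\<^esub>))"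

text \<open>
  The input of Nakayama's lemma: \<open>x i\<close> lies in \<open>p N\<close> for the \<open>\<int>\<^sub>p\<close>-span \<open>N\<close> of the generators of its degree.
\<close>

definition nakayama_relation :: "nat \<Rightarrow> (nat \<Rightarrow> int) \<Rightarrow> (nat \<Rightarrow> 'a) \<Rightarrow> nat \<Rightarrow> bool"
  where "nakayama_relation r d x i \<longleftrightarrow> (\<exists>c. (\<forall>j<r. c j \<in> carrier (Zp p)) \<and>
    inv\<^bsub>ggrp R (d i)\<^esub> x i = finprod (ggrp R (d i))
      (\<lambda>j. if d j = d i then act (d i) (Zint p (int p) \<otimes>\<^sub>Z c j) (x j) else \<one>\<^bsub>ggrp R (d i)\<^esub>) {..<r})"

text \<open>
  The element \<open>\<alpha>\<close> of a simple component annihilates \<open>x i\<close>, so \<open>\<alpha> e\<^sub>i\<close> is a combination of the given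
  relations \<open>y j\<close>. Its coordinates at the generators of the degree \<open>\<delta>\<close> of \<open>x i\<close> have the degree of \<open>\<alpha>\<close>, where only
  products with one factor of degree \<open>0\<close> survive; as the degree of \<open>\<alpha>\<close> is none of the degrees of the
  coordinates of the \<open>y j\<close>, that factor is a coordinate of some \<open>y j\<close> of degree \<open>\<delta>\<close>. Hence the combination
  \<open>z\<close> of these \<open>y j\<close> with the coefficients divided by \<open>\<alpha>\<close> satisfies \<open>z\<^sub>k \<alpha> = \<delta>\<^sub>i\<^sub>k \<alpha>\<close>, so that \<open>z\<^sub>k\<close> is \<open>\<delta>\<^sub>i\<^sub>k\<close>
  modulo \<open>p\<close>.
\<close>

lemma presentation_nakayama_relation:
  assumes I: "gideal R I" "I \<noteq> gcar R"
    and f: "f \<in> gmod_hom R (free_gmod R s e) (free_gmod R r d)"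
    and g: "g \<in> gmod_hom R (free_gmod R r d) (ideal_gmod R I)"
    and exact: "\<And>n. f n ` mcar (free_gmod R s e) n = kernel (mgrp (free_gmod R r d) n) (mgrp (ideal_gmod R I) n) (g n)"
    and i: "i < r"
  defines "x \<equiv> \<lambda>j. g (d j) (R.basis_vec r d j)"
  assumes decoupled: "decoupled r d x (d i)"
  shows "nakayama_relation r d x i"
proof -
  let ?F = "free_gmod R r d" and ?E = "free_gmod R s e"
  have I_sub: "I n \<subseteq> gcar R n" for n using I subgroup.subset by (auto simp: gideal_def)
  have idM: "mgrp (ideal_gmod R I) n = (ggrp R n)\<lparr>carrier := I n\<rparr>" "gsmult (ideal_gmod R I) = gmult R" for n
    by (simp_all add: ideal_gmod_def)
  have g_hom: "g n \<in> hom (mgrp ?F n) ((ggrp R n)\<lparr>carrier := I n\<rparr>)" for n using g by (simp add: gmod_hom_def idM)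
  have g_lin: "g (m + n) (gsmult ?F m n a v) = gmult R m n a (g n v)" if "a \<in> gcar R m" "v \<in> mcar ?F n" for m n a v
    using g that by (simp add: gmod_hom_def idM)
  have f_lin: "f (m + n) (gsmult ?E m n a v) = gsmult ?F m n a (f n v)" if "a \<in> gcar R m" "v \<in> mcar ?E n" for m n a v
    using f that by (simp add: gmod_hom_def)
  have f_hom: "f n \<in> hom (mgrp ?E n) (mgrp ?F n)" for n using f by (simp add: gmod_hom_def)
  have x_I: "x j \<in> I (d j)" for j
    using hom_in_carrier[OF g_hom R.basis_vec_closed[of r d j]] by (simp add: x_def)
  then have x_cl: "x j \<in> gcar R (d j)" for j using I_sub by blast
  have gE: "g n z = finprod (ggrp R n) (\<lambda>j. gmult R (n - d j) (d j) (z j) (x j)) {..<r}" if "z \<in> mcar ?F n" for n z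
  proof -
    have "(\<lambda>y. y) \<in> hom (mgrp (ideal_gmod R I) n) (ggrp R n)" using I_sub by (auto simp: idM hom_def)
    from R.free_gmod_hom_expansion[OF g R.comm_group this that] show ?thesis by (simp add: idM x_def)
  qed
  define y where "y j = f (e j) (R.basis_vec s e j)" for j
  have y_cl: "y j \<in> mcar ?F (e j)" for j
    using hom_in_carrier[OF f_hom R.basis_vec_closed] by (simp add: y_def)
  then have yk_cl: "y j k \<in> gcar R (e j - d k)" if "k < r" for j k using that by (auto simp: R.free_gmod_simps)
  have fE: "f n w k = finprod (ggrp R (n - d k)) (\<lambda>j. gmult R (n - e j) (e j - d k) (w j) (y j k)) {..<s}"
    if "w \<in> mcar ?E n" "k < r" for n w k
  proof -
    have "(\<lambda>v. v k) \<in> hom (mgrp ?F n) (ggrp R (n - d k))" using that(2) by (auto simp: hom_def R.free_gmod_simps)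
    from R.free_gmod_hom_expansion[OF f R.comm_group this that(1)] show ?thesis
      using that(2) by (simp add: R.free_gmod_simps(2) y_def)
  qed
  let ?\<delta> = "d i"
  \<comment> \<open>the degrees in which \<open>\<alpha>\<close> could pair with a generator into degree \<open>-2\<close>, or meet a coordinate of a relation\<close>
  define D where "D = (\<lambda>j. - 2 - d j) ` {..<r} \<union> (\<lambda>(j, k). e j - d k) ` ({..<s} \<times> {..<r})"
  have "finite D" by (simp add: D_def)
  from infinite_imp_nonempty[OF Diff_infinite_finite[OF this simple_degrees]]
  obtain n \<alpha> where n: "n \<noteq> 0" "n \<noteq> - 2" "n \<notin> D"
    and \<alpha>: "\<alpha> \<in> gcar R n" "\<alpha> \<noteq> \<one>\<^bsub>ggrp R n\<^esub>" "act n (Zint p (int p)) \<alpha> = \<one>\<^bsub>ggrp R n\<^esub>"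
    and gen: "\<And>t. t \<in> gcar R n \<Longrightarrow> \<exists>c\<in>carrier (Zp p). t = act n c \<alpha>"
    by blast
  have n1: "n + d j \<noteq> - 2" if "j < r" for j
  proof
    assume "n + d j = - 2"
    then have "n = - 2 - d j" by simp
    then show False using n(3) that by (auto simp: D_def)
  qed
  have n2: "n \<noteq> e j - d k" if "j < s" "k < r" for j k using n(3) that by (force simp: D_def)
  \<comment> \<open>in degree \<open>0\<close> this uses that the ideal is proper: \<open>x i\<close> is divisible by \<open>p\<close>\<close>
  have \<alpha>x: "gmult R n ?\<delta> \<alpha> (x i) = \<one>\<^bsub>ggrp R (n + ?\<delta>)\<^esub>"
  proof (cases "?\<delta> = 0")
    case True
    obtain b where b: "b \<in> carrier (Zp p)" "x i = u b" using x_cl[of i] True by (auto elim: unit_E)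
    have "b 1 = 0" using unit_ideal[OF I(1) b(1)] I(2) x_I[of i] True b(2) by auto
    then obtain c where c: "c \<in> carrier (Zp p)" "b = Zint p (int p) \<otimes>\<^sub>Z c" using Zp_divisible[OF b(1), of 1] by auto
    have "gmult R n 0 \<alpha> (u b) = act n c (act n (Zint p (int p)) \<alpha>)"
      using b c \<alpha>(1) by (simp add: unit_comm act_act A.m_comm)
    then show ?thesis using True b c \<alpha> by (simp add: act_triv)
  next
    case False
    then show ?thesis using mult_trivial[OF \<alpha>(1) x_cl[of i]] n(1) n1[OF i] by blast
  qed
  define v where "v = summand_incl (\<lambda>j. ggrp R (n + ?\<delta> - d j)) r i \<alpha>"
  have v_eq: "v = gsmult ?F n ?\<delta> \<alpha> (R.basis_vec r d i)"
    using R.summand_incl_eq_smult_basis_vec[of i r \<alpha> "n + ?\<delta>" d] i \<alpha>(1) by (simp add: v_def)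
  have "g (n + ?\<delta>) v = \<one>\<^bsub>ggrp R (n + ?\<delta>)\<^esub>"
    using g_lin[OF \<alpha>(1) R.basis_vec_closed[of r d i]] \<alpha>x by (simp add: v_eq x_def)
  moreover have "v \<in> mcar ?F (n + ?\<delta>)" using \<alpha>(1) by (auto simp: v_def summand_incl_def R.free_gmod_simps)
  ultimately have "v \<in> f (n + ?\<delta>) ` mcar ?E (n + ?\<delta>)" unfolding exact by (simp add: kernel_def idM)
  then obtain w where w: "w \<in> mcar ?E (n + ?\<delta>)" "v = f (n + ?\<delta>) w" by blast
  have w_cl: "w j \<in> gcar R (n + ?\<delta> - e j)" if "j < s" for j using w(1) that by (auto simp: R.free_gmod_simps)
  have "\<exists>c\<in>carrier (Zp p). w j = act n c \<alpha>" if "j < s" "e j = ?\<delta>" for j using gen[of "w j"] w_cl[OF that(1)] that(2) by simp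
  then obtain cc where cc: "\<And>j. j < s \<Longrightarrow> e j = ?\<delta> \<Longrightarrow> cc j \<in> carrier (Zp p) \<and> w j = act n (cc j) \<alpha>" by metis
  \<comment> \<open>the coefficients of the relations of degree \<open>\<delta>\<close>, divided by \<open>\<alpha>\<close>\<close>
  define w' where "w' = (\<lambda>j\<in>{..<s}. if e j = ?\<delta> then u (cc j) else \<one>\<^bsub>ggrp R (?\<delta> - e j)\<^esub>)"
  have w'_cl: "w' \<in> mcar ?E ?\<delta>" using cc unit_closed by (auto simp: w'_def R.free_gmod_simps)
  define z where "z = f ?\<delta> w'"
  have "z \<in> kernel (mgrp ?F ?\<delta>) (mgrp (ideal_gmod R I) ?\<delta>) (g ?\<delta>)" unfolding exact[symmetric] z_def using w'_cl by blast
  then have z: "z \<in> mcar ?F ?\<delta>" "g ?\<delta> z = \<one>\<^bsub>ggrp R ?\<delta>\<^esub>" by (simp_all add: kernel_def idM)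
  have zk: "z k \<in> gcar R (?\<delta> - d k)" if "k < r" for k using z(1) that by (auto simp: R.free_gmod_simps)
  have z\<alpha>: "gmult R 0 n (z k) \<alpha> = v k" if k: "k < r" "d k = ?\<delta>" for k
  proof -
    have t_cl: "gmult R (?\<delta> - e j) (e j - ?\<delta>) (w' j) (y j k) \<in> gcar R 0" if "j < s" for j
    proof -
      have "w' j \<in> gcar R (?\<delta> - e j)" using w'_cl that by (auto simp: R.free_gmod_simps)
      then show ?thesis using R.mult_closed[OF _ yk_cl[OF k(1), of j]] k(2) by fastforce
    qed
    have "z k = finprod (ggrp R 0) (\<lambda>j. gmult R (?\<delta> - e j) (e j - ?\<delta>) (w' j) (y j k)) {..<s}"
      using fE[OF w'_cl k(1)] k(2) by (simp add: z_def)
    moreover have "(\<lambda>t. gmult R 0 n t \<alpha>) \<in> hom (ggrp R 0) (ggrp R n)"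
      using group_hom.homh[OF R.mult_group_hom_l[OF \<alpha>(1), of 0]] by simp
    ultimately have "gmult R 0 n (z k) \<alpha> = finprod (ggrp R n) (\<lambda>j. gmult R 0 n (gmult R (?\<delta> - e j) (e j - ?\<delta>) (w' j) (y j k)) \<alpha>) {..<s}"
      using G.hom_finprod[OF _ R.comm_group, of "\<lambda>t. gmult R 0 n t \<alpha>" 0 n "{..<s}" "\<lambda>j. gmult R (?\<delta> - e j) (e j - ?\<delta>) (w' j) (y j k)"] t_cl
      by auto
    also have "\<dots> = finprod (ggrp R n) (\<lambda>j. gmult R (n + ?\<delta> - e j) (e j - ?\<delta>) (w j) (y j k)) {..<s}"
    proof (rule G.finprod_cong')
      fix j assume "j \<in> {..<s}"
      then have j: "j < s" by simp
      show "gmult R 0 n (gmult R (?\<delta> - e j) (e j - ?\<delta>) (w' j) (y j k)) \<alpha> = gmult R (n + ?\<delta> - e j) (e j - ?\<delta>) (w j) (y j k)"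
      proof (cases "e j = ?\<delta>")
        case True
        obtain b where b: "b \<in> carrier (Zp p)" "y j k = u b" using yk_cl[OF k(1), of j] True k(2) by (auto elim: unit_E)
        have "gmult R 0 n (gmult R 0 0 (u (cc j)) (u b)) \<alpha> = act n (cc j \<otimes>\<^sub>Z b) \<alpha>"
          using b cc[OF j True] by (simp add: unit_mult)
        also have "\<dots> = act n b (act n (cc j) \<alpha>)" using b cc[OF j True] \<alpha>(1) by (simp add: act_act A.m_comm)
        also have "\<dots> = gmult R n 0 (act n (cc j) \<alpha>) (u b)" using b cc[OF j True] \<alpha>(1) by (simp add: unit_comm act_closed)
        finally show ?thesis using True j b cc[OF j True] by (simp add: w'_def)
      next
        case False
        have "gmult R (?\<delta> - e j) (e j - ?\<delta>) (w' j) (y j k) = \<one>\<^bsub>ggrp R 0\<^esub>"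
          using False j yk_cl[OF k(1), of j] k(2) R.zero_mult[of "y j k" "e j - ?\<delta>" "?\<delta> - e j"] by (simp add: w'_def)
        moreover have "gmult R (n + ?\<delta> - e j) (e j - ?\<delta>) (w j) (y j k) = \<one>\<^bsub>ggrp R n\<^esub>"
          using mult_trivial[OF w_cl[OF j] yk_cl[OF k(1), of j]] False n2[OF j k(1)] n k(2) by fastforce
        ultimately show ?thesis using R.zero_mult[OF \<alpha>(1), of 0] by simp
      qed
    next
      show "(\<lambda>j. gmult R (n + ?\<delta> - e j) (e j - ?\<delta>) (w j) (y j k)) \<in> {..<s} \<rightarrow> gcar R n"
      proof
        fix j assume "j \<in> {..<s}"
        then show "gmult R (n + ?\<delta> - e j) (e j - ?\<delta>) (w j) (y j k) \<in> gcar R n"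
          using R.mult_closed[OF w_cl yk_cl[OF k(1), of j]] k(2) by fastforce
      qed
    qed simp
    also have "\<dots> = v k" using fE[OF w(1) k(1)] w(2) k(2) by simp
    finally show ?thesis .
  qed
  have "\<exists>c\<in>carrier (Zp p). z k = u ((if k = i then \<one>\<^sub>Z else \<zero>\<^sub>Z) \<oplus>\<^sub>Z Zint p (int p) \<otimes>\<^sub>Z c)"
    if k: "k < r" "d k = ?\<delta>" for k
  proof -
    let ?o = "if k = i then \<one>\<^sub>Z else \<zero>\<^sub>Z"
    obtain t where t: "t \<in> carrier (Zp p)" "z k = u t" using zk[OF k(1)] k(2) by (auto elim: unit_E)
    have "v k = act n ?o \<alpha>"
      using k \<alpha>(1) R.zero_mult[OF \<alpha>(1), of 0] by (simp add: v_def summand_incl_def act_one unit_zero)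
    then have tv: "act n t \<alpha> = act n ?o \<alpha>" using z\<alpha>[OF k] t by simp
    have "act n (t \<ominus>\<^sub>Z ?o) \<alpha> \<otimes>\<^bsub>ggrp R n\<^esub> act n ?o \<alpha> = act n t \<alpha>"
      using t \<alpha>(1) act_add[of "t \<ominus>\<^sub>Z ?o" ?o \<alpha> n] by (simp add: a_minus_def A.a_assoc A.l_neg)
    then have o: "act n (t \<ominus>\<^sub>Z ?o) \<alpha> = \<one>\<^bsub>ggrp R n\<^esub>"
      using tv t \<alpha>(1) act_closed[of "t \<ominus>\<^sub>Z ?o" \<alpha> n] act_closed[of ?o \<alpha> n] by (simp add: G.l_cancel_one)
    have tcl: "t \<ominus>\<^sub>Z ?o \<in> carrier (Zp p)" using t by simp
    obtain c where c: "c \<in> carrier (Zp p)" "t \<ominus>\<^sub>Z ?o = Zint p (int p) \<otimes>\<^sub>Z c"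
      by (rule act_eq_one_imp[OF tcl \<alpha>(1,2) o])
    have "t = ?o \<oplus>\<^sub>Z (t \<ominus>\<^sub>Z ?o)" using t by (simp add: a_minus_def A.a_ac A.r_neg)
    then show ?thesis using c t by metis
  qed
  then obtain c0 where c0: "\<And>k. k < r \<Longrightarrow> d k = ?\<delta> \<Longrightarrow> c0 k \<in> carrier (Zp p) \<and>
      z k = u ((if k = i then \<one>\<^sub>Z else \<zero>\<^sub>Z) \<oplus>\<^sub>Z Zint p (int p) \<otimes>\<^sub>Z c0 k)"
    by metis
  define c where "c k = (if k < r \<and> d k = ?\<delta> then c0 k else \<zero>\<^sub>Z)" for k
  have c_cl: "c k \<in> carrier (Zp p)" for k using c0 by (simp add: c_def)
  let ?V = "\<lambda>j. if d j = ?\<delta> then act ?\<delta> (Zint p (int p) \<otimes>\<^sub>Z c j) (x j) else \<one>\<^bsub>ggrp R ?\<delta>\<^esub>"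
  let ?X = "\<lambda>j. if j = i then x i else \<one>\<^bsub>ggrp R ?\<delta>\<^esub>"
  have V_cl: "?V j \<in> gcar R ?\<delta>" for j using act_closed[OF _ x_cl[of j]] c_cl by auto
  have X_cl: "?X j \<in> gcar R ?\<delta>" for j using x_cl[of i] by simp
  have "\<one>\<^bsub>ggrp R ?\<delta>\<^esub> = finprod (ggrp R ?\<delta>) (\<lambda>j. gmult R (?\<delta> - d j) (d j) (z j) (x j)) {..<r}"
    using gE[OF z(1)] z(2) by simp
  also have "\<dots> = finprod (ggrp R ?\<delta>) (\<lambda>j. ?X j \<otimes>\<^bsub>ggrp R ?\<delta>\<^esub> ?V j) {..<r}"
  proof (rule G.finprod_cong')
    fix j assume "j \<in> {..<r}"
    then have j: "j < r" by simp
    show "gmult R (?\<delta> - d j) (d j) (z j) (x j) = ?X j \<otimes>\<^bsub>ggrp R ?\<delta>\<^esub> ?V j"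
    proof (cases "d j = ?\<delta>")
      case True
      have xj: "x j \<in> gcar R ?\<delta>" using x_cl[of j] True by simp
      have "gmult R (?\<delta> - d j) (d j) (z j) (x j) = act ?\<delta> ((if j = i then \<one>\<^sub>Z else \<zero>\<^sub>Z) \<oplus>\<^sub>Z Zint p (int p) \<otimes>\<^sub>Z c j) (x j)"
        using c0[OF j True] True j by (simp add: c_def)
      also have "\<dots> = act ?\<delta> (if j = i then \<one>\<^sub>Z else \<zero>\<^sub>Z) (x j) \<otimes>\<^bsub>ggrp R ?\<delta>\<^esub> act ?\<delta> (Zint p (int p) \<otimes>\<^sub>Z c j) (x j)"
        using xj c_cl by (intro act_add) auto
      also have "act ?\<delta> (if j = i then \<one>\<^sub>Z else \<zero>\<^sub>Z) (x j) = ?X j"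
        using xj R.zero_mult[OF xj, of 0] by (auto simp: act_one unit_zero)
      finally show ?thesis using True by simp
    next
      case False
      then have "j \<noteq> i" by auto
      then show ?thesis using decoupled False j zk[OF j] by (simp add: decoupled_def)
    qed
  qed (use V_cl X_cl in auto)
  also have "\<dots> = finprod (ggrp R ?\<delta>) ?X {..<r} \<otimes>\<^bsub>ggrp R ?\<delta>\<^esub> finprod (ggrp R ?\<delta>) ?V {..<r}"
    using V_cl X_cl by (intro G.finprod_multf) auto
  also have "finprod (ggrp R ?\<delta>) ?X {..<r} = x i"
    using G.finprod_singleton_swap[of i "{..<r}" "\<lambda>_. x i" ?\<delta>] i x_cl[of i] by simp
  finally have "finprod (ggrp R ?\<delta>) ?V {..<r} \<otimes>\<^bsub>ggrp R ?\<delta>\<^esub> x i = \<one>\<^bsub>ggrp R ?\<delta>\<^esub>"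
    using V_cl x_cl[of i] G.finprod_closed[of ?V "{..<r}" ?\<delta>] by (simp add: G.m_comm)
  then have "inv\<^bsub>ggrp R ?\<delta>\<^esub> x i = finprod (ggrp R ?\<delta>) ?V {..<r}"
    using V_cl x_cl[of i] by (intro G.inv_equality G.finprod_closed) auto
  then show ?thesis unfolding nakayama_relation_def using c_cl by blast
qed

text \<open>
  Some power of \<open>p\<close> kills all generators of degree \<open>\<delta>\<close>. If \<open>p\<^bsup>k + 1\<^esup>\<close> does, then so does \<open>p\<^sup>k\<close>, because each
  of them is \<open>p\<close> times a combination of them. The finiteness of the set of generators is essential: the
  component of degree \<open>-2\<close> is divisible.
\<close>

lemma nakayama_torsion:
  assumes x: "\<And>j. x j \<in> gcar R (d j)" and \<delta>: "\<delta> \<noteq> 0"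
    and rel: "\<And>i. i < r \<Longrightarrow> d i = \<delta> \<Longrightarrow> nakayama_relation r d x i"
    and i: "i < r" "d i = \<delta>"
  shows "x i = \<one>\<^bsub>ggrp R \<delta>\<^esub>"
proof -
  let ?P = "\<lambda>k. \<forall>i<r. d i = \<delta> \<longrightarrow> act \<delta> (Zint p (int p ^ k)) (x i) = \<one>\<^bsub>ggrp R \<delta>\<^esub>"
  have "\<exists>k. d i = \<delta> \<longrightarrow> act \<delta> (Zint p (int p ^ k)) (x i) = \<one>\<^bsub>ggrp R \<delta>\<^esub>" for i using torsion[of "x i" \<delta>] x[of i] \<delta> by auto
  then obtain kk where kk: "\<And>i. d i = \<delta> \<Longrightarrow> act \<delta> (Zint p (int p ^ kk i)) (x i) = \<one>\<^bsub>ggrp R \<delta>\<^esub>" by metis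
  have P_sum: "?P (\<Sum>i<r. kk i)"
  proof (intro allI impI)
    fix i assume i: "i < r" "d i = \<delta>"
    have "kk i \<le> (\<Sum>i<r. kk i)" using i by (intro member_le_sum) auto
    then have "Zint p (int p ^ (\<Sum>i<r. kk i)) = Zint p (int p ^ ((\<Sum>i<r. kk i) - kk i)) \<otimes>\<^sub>Z Zint p (int p ^ kk i)"
      by (simp add: Zint_mult[symmetric] power_add[symmetric])
    moreover have "x i \<in> gcar R \<delta>" using x[of i] i by simp
    ultimately show "act \<delta> (Zint p (int p ^ (\<Sum>i<r. kk i))) (x i) = \<one>\<^bsub>ggrp R \<delta>\<^esub>"
      using kk[OF i(2)] by (simp add: act_act[symmetric] act_triv)
  qed
  have step: "?P (Suc k) \<Longrightarrow> ?P k" for k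
  proof (intro allI impI)
    fix i assume P: "?P (Suc k)" and i: "i < r" "d i = \<delta>"
    obtain c where c: "\<And>j. j < r \<Longrightarrow> c j \<in> carrier (Zp p)" and
      c': "inv\<^bsub>ggrp R \<delta>\<^esub> x i = finprod (ggrp R \<delta>)
      (\<lambda>j. if d j = \<delta> then act \<delta> (Zint p (int p) \<otimes>\<^sub>Z c j) (x j) else \<one>\<^bsub>ggrp R \<delta>\<^esub>) {..<r}"
      using rel[OF i] unfolding nakayama_relation_def i(2) by blast
    let ?V = "\<lambda>j. if d j = \<delta> then act \<delta> (Zint p (int p) \<otimes>\<^sub>Z c j) (x j) else \<one>\<^bsub>ggrp R \<delta>\<^esub>"
    let ?h = "act \<delta> (Zint p (int p ^ k))"
    have xi: "x i \<in> gcar R \<delta>" using x[of i] i by simp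
    have V: "?V \<in> {..<r} \<rightarrow> gcar R \<delta>" using c x act_closed by auto
    have hV: "?h (?V j) = \<one>\<^bsub>ggrp R \<delta>\<^esub>" if j: "j < r" for j
    proof (cases "d j = \<delta>")
      case True
      have "Zint p (int p ^ k) \<otimes>\<^sub>Z (Zint p (int p) \<otimes>\<^sub>Z c j) = c j \<otimes>\<^sub>Z Zint p (int p ^ Suc k)"
        using c[OF j] by (simp add: A.m_ac Zint_mult)
      then show ?thesis using P c[OF j] j True x[of j] by (simp add: act_act act_act[symmetric, of "c j"] act_triv)
    qed (simp add: act_triv)
    have "inv\<^bsub>ggrp R \<delta>\<^esub> ?h (x i) = ?h (inv\<^bsub>ggrp R \<delta>\<^esub> x i)"
      using R.mult_inv_r[of "u (Zint p (int p ^ k))" 0 "x i" \<delta>] xi unit_closed by simp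
    also have "\<dots> = finprod (ggrp R \<delta>) (\<lambda>j. ?h (?V j)) {..<r}"
      unfolding c' using V by (intro G.hom_finprod[OF act_hom R.comm_group]) auto
    also have "\<dots> = finprod (ggrp R \<delta>) (\<lambda>j. \<one>\<^bsub>ggrp R \<delta>\<^esub>) {..<r}"
      using hV by (intro G.finprod_cong') auto
    also have "\<dots> = \<one>\<^bsub>ggrp R \<delta>\<^esub>" by simp
    finally show "?h (x i) = \<one>\<^bsub>ggrp R \<delta>\<^esub>" using xi act_closed[of "Zint p (int p ^ k)" "x i" \<delta>] by (simp add: G.inv_eq_1_iff)
  qed
  have "?P k \<Longrightarrow> ?P 0" for k
    by (induction k) (assumption, metis step)
  then have "?P 0" using P_sum by blast
  then show ?thesis using i x[of i] act_one[of "x i" \<delta>] by (auto simp: Zint_1)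
qed

text \<open>
  The same relations make the generators of degree \<open>0\<close> divisible by every power of \<open>p\<close>, and no nonzero
  \<open>p\<close>-adic integer is.
\<close>

lemma nakayama_degree_0:
  assumes x: "\<And>j. x j \<in> gcar R (d j)"
    and rel: "\<And>i. i < r \<Longrightarrow> d i = 0 \<Longrightarrow> nakayama_relation r d x i"
    and i: "i < r" "d i = 0"
  shows "x i = \<one>\<^bsub>ggrp R 0\<^esub>"
proof -
  define H where "H k = act 0 (Zint p (int p ^ k)) ` gcar R 0" for k
  have H: "subgroup (H k) (ggrp R 0)" for k
  proof -
    interpret h: group_hom "ggrp R 0" "ggrp R 0" "act 0 (Zint p (int p ^ k))"
      by (intro group_hom.intro group_hom_axioms.intro G.is_group act_hom) simp
    show ?thesis unfolding H_def by (rule h.img_is_subgroup)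
  qed
  have "\<forall>i<r. d i = 0 \<longrightarrow> x i \<in> H k" for k
  proof (induction k)
    case 0
    have "x i = act 0 (Zint p (int p ^ 0)) (x i)" "x i \<in> gcar R 0" if "d i = 0" for i
      using x[of i] that by (simp_all add: Zint_1 act_one)
    then show ?case unfolding H_def by blast
  next
    case (Suc k)
    show ?case
    proof (intro allI impI)
      fix i assume i: "i < r" "d i = 0"
      obtain c where c: "\<And>j. j < r \<Longrightarrow> c j \<in> carrier (Zp p)" and
        c': "inv\<^bsub>ggrp R 0\<^esub> x i = finprod (ggrp R 0)
        (\<lambda>j. if d j = 0 then act 0 (Zint p (int p) \<otimes>\<^sub>Z c j) (x j) else \<one>\<^bsub>ggrp R 0\<^esub>) {..<r}"
        using rel[OF i] unfolding nakayama_relation_def i(2) by blast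
      have "(if d j = 0 then act 0 (Zint p (int p) \<otimes>\<^sub>Z c j) (x j) else \<one>\<^bsub>ggrp R 0\<^esub>) \<in> H (Suc k)" if j: "j < r" for j
      proof (cases "d j = 0")
        case True
        then obtain y where y: "y \<in> gcar R 0" "x j = act 0 (Zint p (int p ^ k)) y" using Suc j unfolding H_def by blast
        have "(Zint p (int p) \<otimes>\<^sub>Z c j) \<otimes>\<^sub>Z Zint p (int p ^ k) = Zint p (int p ^ Suc k) \<otimes>\<^sub>Z c j"
          using c[OF j] by (simp add: A.m_ac Zint_mult)
        then have "act 0 (Zint p (int p) \<otimes>\<^sub>Z c j) (x j) = act 0 (Zint p (int p ^ Suc k)) (act 0 (c j) y)"
          using y c[OF j] by (simp add: act_act)
        then show ?thesis using True y c[OF j] act_closed unfolding H_def by (auto simp del: power_Suc)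
      qed (use subgroup.one_closed[OF H] in simp)
      then have "inv\<^bsub>ggrp R 0\<^esub> x i \<in> H (Suc k)" unfolding c' by (intro G.finprod_in_subgroup[OF H]) auto
      then show "x i \<in> H (Suc k)" using subgroup.m_inv_closed[OF H] x[of i] i by fastforce
    qed
  qed
  then have xH: "x i \<in> H k" for k using i by blast
  obtain b where b: "b \<in> carrier (Zp p)" "x i = u b" using x[of i] i by (auto elim: unit_E)
  have "b k = 0" for k
  proof -
    obtain y where y: "y \<in> gcar R 0" "x i = act 0 (Zint p (int p ^ k)) y" using xH[of k] unfolding H_def by blast
    obtain a where a: "a \<in> carrier (Zp p)" "y = u a" using y(1) by (rule unit_E)
    have "u b = u (Zint p (int p ^ k) \<otimes>\<^sub>Z a)" using a b y by (simp add: unit_mult)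
    then have "b = Zint p (int p ^ k) \<otimes>\<^sub>Z a" using a b by (intro unit_inj) auto
    then show ?thesis by (simp add: Zint_power_mult_nth)
  qed
  then have "b = \<zero>\<^sub>Z" by (simp add: fun_eq_iff Zp_zero)
  then show ?thesis using b unit_zero by simp
qed

text \<open>
  The order of the degrees matters: degree \<open>0\<close> receives no products of elements of nonzero degrees, the
  other degrees except \<open>-2\<close> receive only multiples of the generators of degree \<open>0\<close>, which are already known
  to vanish, and degree \<open>-2\<close> receives products from everywhere.
\<close>

lemma finitely_presented_proper_ideal:
  assumes I: "gideal R I" "I \<noteq> gcar R" and fp: "finitely_presented R (ideal_gmod R I)"
  shows "I = (\<lambda>n. {\<one>\<^bsub>ggrp R n\<^esub>})"
proof -
  obtain r d s e f g where f: "f \<in> gmod_hom R (free_gmod R s e) (free_gmod R r d)"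
    and g: "g \<in> gmod_hom R (free_gmod R r d) (ideal_gmod R I)"
    and fg: "\<forall>n. f n ` mcar (free_gmod R s e) n = kernel (mgrp (free_gmod R r d) n) (mgrp (ideal_gmod R I) n) (g n)
      \<and> g n ` mcar (free_gmod R r d) n = mcar (ideal_gmod R I) n"
    using fp unfolding finitely_presented_def by (elim exE bexE) (rule that)
  have exact: "f n ` mcar (free_gmod R s e) n = kernel (mgrp (free_gmod R r d) n) (mgrp (ideal_gmod R I) n) (g n)"
    and surj: "g n ` mcar (free_gmod R r d) n = mcar (ideal_gmod R I) n" for n
    using fg by simp_all
  define x where "x j = g (d j) (R.basis_vec r d j)" for j
  have I_sub: "I n \<subseteq> gcar R n" for n using I subgroup.subset by (auto simp: gideal_def)
  have g_hom: "g n \<in> hom (mgrp (free_gmod R r d) n) ((ggrp R n)\<lparr>carrier := I n\<rparr>)" for n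
    using g by (simp add: gmod_hom_def ideal_gmod_def)
  have x_cl: "x j \<in> gcar R (d j)" for j
    using hom_in_carrier[OF g_hom R.basis_vec_closed[of r d j]] I_sub by (auto simp: x_def)
  have rel: "nakayama_relation r d x i" if "i < r" "decoupled r d x (d i)" for i
    using presentation_nakayama_relation[OF I f g exact that(1)] that(2) unfolding x_def by blast
  have x0: "x i = \<one>\<^bsub>ggrp R 0\<^esub>" if "i < r" "d i = 0" for i
  proof (rule nakayama_degree_0[where d = d and x = x and r = r, OF x_cl _ that])
    have "decoupled r d x 0"
      unfolding decoupled_def
    proof (intro allI impI ballI)
      fix j a assume "d j \<noteq> 0" "a \<in> gcar R (0 - d j)"
      then show "gmult R (0 - d j) (d j) a (x j) = \<one>\<^bsub>ggrp R 0\<^esub>"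
        using mult_trivial[of a "0 - d j" "x j" "d j"] x_cl[of j] by simp
    qed
    then show "nakayama_relation r d x i" if "i < r" "d i = 0" for i using rel that by simp
  qed
  have x1: "x i = \<one>\<^bsub>ggrp R (d i)\<^esub>" if i: "i < r" "d i \<noteq> - 2" for i
  proof (cases "d i = 0")
    case False
    have "decoupled r d x (d i)"
      unfolding decoupled_def
    proof (intro allI impI ballI)
      fix j a assume j: "j < r" "d j \<noteq> d i" "a \<in> gcar R (d i - d j)"
      show "gmult R (d i - d j) (d j) a (x j) = \<one>\<^bsub>ggrp R (d i)\<^esub>"
      proof (cases "d j = 0")
        case True
        then show ?thesis using x0[OF j(1)] R.mult_zero[OF j(3), of 0] by simp
      next
        case False
        then show ?thesis using mult_trivial[OF j(3) x_cl[of j]] j i by simp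
      qed
    qed
    then show ?thesis using nakayama_torsion[where d = d and x = x and r = r, OF x_cl False _ i(1) refl] rel by simp
  qed (use x0 i in simp)
  have x2: "x i = \<one>\<^bsub>ggrp R (d i)\<^esub>" if i: "i < r" for i
  proof (cases "d i = - 2")
    case True
    have "decoupled r d x (d i)"
      unfolding decoupled_def
    proof (intro allI impI ballI)
      fix j a assume j: "j < r" "d j \<noteq> d i" "a \<in> gcar R (d i - d j)"
      then show "gmult R (d i - d j) (d j) a (x j) = \<one>\<^bsub>ggrp R (d i)\<^esub>"
        using x1[OF j(1)] R.mult_zero[OF j(3), of "d j"] True by simp
    qed
    then show ?thesis using nakayama_torsion[where d = d and x = x and r = r, OF x_cl _ _ i(1) refl] rel True by simp
  qed (use x1 i in simp)
  show ?thesis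
  proof
    fix n
    have "y = \<one>\<^bsub>ggrp R n\<^esub>" if "y \<in> I n" for y
    proof -
      have "y \<in> g n ` mcar (free_gmod R r d) n" using that unfolding surj by (simp add: ideal_gmod_def)
      then obtain z where z: "z \<in> mcar (free_gmod R r d) n" "y = g n z" by blast
      have idh: "(\<lambda>y. y) \<in> hom (mgrp (ideal_gmod R I) n) (ggrp R n)" using I_sub by (auto simp: ideal_gmod_def hom_def)
      have "y = finprod (ggrp R n) (\<lambda>j. gmult R (n - d j) (d j) (z j) (x j)) {..<r}"
        using R.free_gmod_hom_expansion[OF g R.comm_group idh z(1)] z(2) by (simp add: ideal_gmod_def x_def)
      also have "\<dots> = finprod (ggrp R n) (\<lambda>j. \<one>\<^bsub>ggrp R n\<^esub>) {..<r}"
      proof (rule G.finprod_cong')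
        fix j assume "j \<in> {..<r}"
        then have "j < r" "z j \<in> gcar R (n - d j)" using z(1) by (auto simp: R.free_gmod_simps)
        then show "gmult R (n - d j) (d j) (z j) (x j) = \<one>\<^bsub>ggrp R n\<^esub>"
          using x2 R.mult_zero[of "z j" "n - d j" "d j"] by simp
      qed auto
      also have "\<dots> = \<one>\<^bsub>ggrp R n\<^esub>" by simp
      finally show ?thesis .
    qed
    moreover have "\<one>\<^bsub>ggrp R n\<^esub> \<in> I n" using I(1) subgroup.one_closed by (auto simp: gideal_def)
    ultimately show "I n = {\<one>\<^bsub>ggrp R n\<^esub>}" by blast
  qed
qed

theorem totally_incoherent: "totally_incoherent R"
  unfolding totally_incoherent_def
proof (intro allI impI iffI)
  fix I assume I: "gideal R I"
  show "I = (\<lambda>n. {\<one>\<^bsub>ggrp R n\<^esub>}) \<or> I = gcar R" if "finitely_presented R (ideal_gmod R I)"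
    using finitely_presented_proper_ideal[OF I _ that] by blast
  show "finitely_presented R (ideal_gmod R I)" if "I = (\<lambda>n. {\<one>\<^bsub>ggrp R n\<^esub>}) \<or> I = gcar R"
    using that R.zero_gideal_finitely_presented R.unit_gideal_finitely_presented by blast
qed

end

context odd_prime
begin

text \<open>
  Infinitely many integers, for instance those congruent to \<open>1\<close>, are prime to \<open>p\<close>.
\<close>

lemma J_hat_sparse: "sparse_algebra p JH \<upsilon>"
proof (intro sparse_algebra.intro sparse_algebra_axioms.intro)
  show "bij_betw \<upsilon> (carrier (Zp p)) (gcar JH 0)"
    using unit_inj unit_surj JH.unit_closed by (auto simp: bij_betw_def)
  let ?S = "{n. n \<noteq> 0 \<and> n \<noteq> - 2 \<and>
      (\<exists>a\<in>gcar JH n. a \<noteq> \<one>\<^bsub>ggrp JH n\<^esub> \<and> gmult JH 0 n (\<upsilon> (Zint p (int p))) a = \<one>\<^bsub>ggrp JH n\<^esub> \<and>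
        (\<forall>x\<in>gcar JH n. \<exists>c\<in>carrier (Zp p). x = gmult JH 0 n (\<upsilon> c) a))}"
  let ?k = "\<lambda>j::nat. alpha_deg p (int p * int j + 1)"
  have kS: "?k j \<in> ?S" for j
  proof -
    have "\<not> int p dvd int p * int j + 1" using p_gt_1 by (simp add: dvd_add_right_iff)
    then show ?thesis by (rule J_hat_socle) auto
  qed
  have "range ?k \<subseteq> ?S" by (rule image_subsetI) (rule kS)
  moreover have "infinite (range ?k)" by (intro range_inj_infinite injI) simp
  ultimately show "infinite ?S" by (rule infinite_super)
qed (use prime_num_axioms JH_graded_algebra J_hat_mult_zero J_hat_torsion in auto)

end

section \<open>The four properties of the base change\<close>

theorem theorem1p10:
  fixes p :: nat
  assumes "prime p" and "odd p"
  shows "pontrjagin_self_dual p (J_hat p) (J_hat_unit p) (-2) (zeta_hat p)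
    \<and> self_injective TYPE('m) TYPE('n) (J_hat p)
    \<and> totally_incoherent (J_hat p)
    \<and> (\<exists>h \<in> gring_iso (concentrated (Zp p)) (gquot (J_hat p) (nilradical (J_hat p))).
         \<forall>a\<in>carrier (Zp p).
           h 0 a = nilradical (J_hat p) 0 #>\<^bsub>ggrp (J_hat p) 0\<^esub> J_hat_unit p a)"
proof -
  interpret odd_prime p by unfold_locales (fact assms)+
  interpret S: sparse_algebra p JH \<upsilon> by (rule J_hat_sparse)
  show ?thesis
    using J_hat_self_dual JHT.self_dual_imp_self_injective[OF J_hat_self_dual]
      S.totally_incoherent S.reduced_quotient by blast
qed

end
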